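(* Let $\mathbf{k}$ be a finite field of odd characteristic $p$, let $R$ be an algebraically closed field of characteristic different from $p$, let $n\ge 2$, and let $\pi$ be an irreducible cuspidal $R$-representation of $\mathrm{GL}_n(\mathbf{k})$. (1) (Galois distinction) Suppose that $\mathbf{k}/\mathbf{k}_0$ is a quadratic extension and that $\pi$ is distinguished by $\mathrm{GL}_n(\mathbf{k}_0)$. Let $\psi_0:\mathbf{k}_0\to R^\times$ be a non-trivial character. Then $$\gamma(\pi,\psi_0\circ\mathrm{tr}_{\mathbf{k}/\mathbf{k}_0})=\omega_\pi(\delta),$$ where $\omega_\pi$ is the central character of $\pi$ and $\delta\in\mathbf{k}^\times$ is an element with $\mathrm{tr}_{\mathbf{k}/\mathbf{k}_0}(\delta)=0$. (2) (Linear and twisted linear distinction) Suppose $n=2m$ and that $\pi$ is distinguished by $H$, where either $H=\mathrm{GL}_m(\mathbf{k})\times\mathrm{GL}_m(\mathbf{k})$ or $H=\mathrm{GL}_m(\boldsymbol{l})$ with $\boldsymbol{l}/\mathbf{k}$ a quadratic extension, embedded in $\mathrm{GL}_n(\mathbf{k})$ as described in the context. Then the normalizer $N$ of $H$ in $\mathrm{GL}_n(\mathbf{k})$ acts on $\mathrm{Hom}_{R[H]}(\pi,R)$ by a character $\chi_\pi:N\to R^\times$, i.e. $\Lambda\circ\pi(g)=\chi_\pi(g)\Lambda$ for all $g\in N$ and $\Lambda\in\mathrm{Hom}_{R[H]}(\pi,R)$; and for every non-trivial character $\psi:\mathbf{k}\to R^\times$ one has $$\gamma(\pi,\psi)=\chi_\pi(w),$$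 where $w=\mathrm{antidiag}(1_m,1_m)$ if $H=\mathrm{GL}_m(\mathbf{k})\times\mathrm{GL}_m(\mathbf{k})$, and $w=\mathrm{diag}(1_m,-1_m)$ if $H=\mathrm{GL}_m(\boldsymbol{l})$.
   Context: An $R$-representation $(\pi,V)$ of $G=\mathrm{GL}_n(\mathbf{k})$ is cuspidal if the space of coinvariants $V_U$ is zero for the unipotent radical $U$ of every proper parabolic subgroup of $G$. It is distinguished by a subgroup $H$ if $\mathrm{Hom}_{R[H]}(\pi,R)\ne 0$, where $R$ carries the trivial action of $H$. $(\pi^\vee,V^\vee)$ denotes the contragredient, $V^\vee=\mathrm{Hom}_R(V,R)$. Gamma factor: fix a square root $|M_n(\mathbf{k})|^{1/2}$ of $|M_n(\mathbf{k})|$ in $R$. For a non-trivial character $\psi:\mathbf{k}\to R^\times$ set $\Psi=\psi\circ\mathrm{tr}:M_n(\mathbf{k})\to R^\times$. For irreducible $\pi$, the gamma factor $\gamma(\pi,\psi)\in R$ is the scalar by which the operator $|M_n(\mathbf{k})|^{-1/2}\sum_{g\in G}\Psi(g)\pi^\vee(g)$ acts on $V^\vee$. Equivalently, it is the scalar such that $\sum_{g\in G}\widehat\Phi(g)v^\vee(\pi(g^{-1})v)=\gamma(\pi,\psi)\sum_{g\in G}\Phi(g)v^\vee(\pi(g)v)$ for all functions $\Phi: M_n(\mathbf{k})\to R$ supported on $G$ and all $v\in V$, $v^\vee\in V^\vee$, where $\widehat\Phi(a)=|M_n(\mathbf{k})|^{-1/2}\sum_{g\in M_n(\mathbf{k})}\Phi(g)\Psi(ga)$.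 Choice of square root: in both parts $|M_n(\mathbf{k})|$ is the square of a positive integer, and $|M_n(\mathbf{k})|^{1/2}$ is taken to be the image in $R$ of this positive integer (so $|M_n(\mathbf{k})|^{1/2}=|M_n(\mathbf{k}_0)|$ in (1) and $|\mathbf{k}|^{2m^2}$ in (2)). Embeddings in (2): $\mathrm{GL}_m(\mathbf{k})\times\mathrm{GL}_m(\mathbf{k})$ is embedded block diagonally. For $\boldsymbol{l}=\mathbf{k}[\sqrt\alpha]$ with $\alpha\in\mathbf{k}^\times$ not a square, $M_m(\boldsymbol{l})$ is embedded in $M_{2m}(\mathbf{k})$ as the set of matrices $\begin{pmatrix}x&y\\ \alpha y&x\end{pmatrix}$ with $x,y\in M_m(\mathbf{k})$, and $\mathrm{GL}_m(\boldsymbol{l})$ is its group of units. Here $\mathrm{antidiag}(1_m,1_m)=\begin{pmatrix}0&1_m\\1_m&0\end{pmatrix}$. *)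

theory Defs
  imports
    "Jordan_Normal_Form.VS_Connect"
    "HOL-Algebra.Embedded_Algebras"
    "HOL-Algebra.Group_Action"
    "HOL-Computational_Algebra.Polynomial"
begin

section \<open>Matrix groups over a field\<close>

text \<open>The unit group of a subring \<open>S\<close> of the ring of \<open>n \<times> n\<close> matrices, and the case where \<open>S\<close> is
  the whole matrix ring.\<close>

definition matrix_units :: "nat \<Rightarrow> 'k::field mat set \<Rightarrow> 'k mat set" where
  "matrix_units n S = Units (ring_mat TYPE('k) n () \<lparr>carrier := S\<rparr>)"

definition GL :: "nat \<Rightarrow> 'k::field mat monoid" where
  "GL n = units_of (ring_mat TYPE('k) n ())"

definition mats_over :: "'k::field set \<Rightarrow> nat \<Rightarrow> 'k mat set" where
  "mats_over K\<^sub>0 n = {A \<in> carrier_mat n n. elements_mat A \<subseteq> K\<^sub>0}"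

definition mat_trace :: "'k::field mat \<Rightarrow> 'k" where
  "mat_trace A = (\<Sum>i<dim_row A. A $$ (i, i))"

text \<open>Block diagonal \<open>GL\<^sub>m(k) \<times> GL\<^sub>m(k)\<close> inside \<open>GL\<^bsub>2m\<^esub>(k)\<close>.\<close>

definition GL_block_diag :: "nat \<Rightarrow> 'k::field mat set" where
  "GL_block_diag m =
     {four_block_mat A (0\<^sub>m m m) (0\<^sub>m m m) D | A D. A \<in> carrier (GL m) \<and> D \<in> carrier (GL m)}"

text \<open>The image of \<open>M\<^sub>m(k[\<surd>\<alpha>])\<close> in \<open>M\<^bsub>2m\<^esub>(k)\<close>, where \<open>x + \<surd>\<alpha> y\<close> goes to the block matrix with
  rows \<open>(x, y)\<close> and \<open>(\<alpha>y, x)\<close>; it is a copy of \<open>M\<^sub>m\<close> of a quadratic extension when \<open>\<alpha>\<close> is not a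
  square.\<close>

definition quadratic_mats :: "'k::field \<Rightarrow> nat \<Rightarrow> 'k mat set" where
  "quadratic_mats \<alpha> m =
     {four_block_mat x y (\<alpha> \<cdot>\<^sub>m y) x | x y. x \<in> carrier_mat m m \<and> y \<in> carrier_mat m m}"


section \<open>Characters and the trace of a field extension\<close>

definition characters :: "('a, 'b) monoid_scheme \<Rightarrow> ('a \<Rightarrow> 'r::field) set" where
  "characters G = hom G (units_of class_ring)"

text \<open>Non-trivial characters of the additive group of a subfield \<open>A\<close> of \<open>k\<close>, as functions on \<open>k\<close>
  of which only the restriction to \<open>A\<close> matters.\<close>

definition nontrivial_additive_character :: "'k::field set \<Rightarrow> ('k \<Rightarrow> 'r::field) \<Rightarrow> bool" where
  "nontrivial_additive_character A \<psi> \<longleftrightarrow>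
     \<psi> \<in> characters (add_monoid (class_ring \<lparr>carrier := A\<rparr>)) \<and> (\<exists>x\<in>A. \<psi> x \<noteq> 1)"

definition galois_group :: "'k::field set \<Rightarrow> ('k \<Rightarrow> 'k) set" where
  "galois_group K\<^sub>0 = {\<sigma> \<in> ring_iso class_ring class_ring. \<forall>x\<in>K\<^sub>0. \<sigma> x = x}"

text \<open>The trace of the extension \<open>k/K\<^sub>0\<close> as the sum of Galois conjugates, which is the field trace
  because an extension of finite fields is Galois. It is valued in \<open>K\<^sub>0\<close>.\<close>

definition ext_trace :: "'k::{finite,field} set \<Rightarrow> 'k \<Rightarrow> 'k" where
  "ext_trace K\<^sub>0 x = (\<Sum>\<sigma>\<in>galois_group K\<^sub>0. \<sigma> x)"

definition quadratic_subfield :: "'k::field set \<Rightarrow> bool" where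
  "quadratic_subfield K\<^sub>0 \<longleftrightarrow>
     subfield K\<^sub>0 (class_ring :: 'k ring) \<and> ring.dimension (class_ring :: 'k ring) 2 K\<^sub>0 UNIV"


section \<open>Representations of the general linear group\<close>

text \<open>The representation space is a whole type \<open>'v\<close> with scalar multiplication \<open>scale\<close>; the values
  of \<open>\<pi>\<close> outside \<open>GL n\<close> are irrelevant.\<close>

locale GL_rep = vector_space scale
  for scale :: "'r::field \<Rightarrow> 'v::ab_group_add \<Rightarrow> 'v" +
  fixes n :: nat and \<pi> :: "'k::field mat \<Rightarrow> 'v \<Rightarrow> 'v"
  assumes rep_linear: "g \<in> carrier (GL n) \<Longrightarrow> Vector_Spaces.linear scale scale (\<pi> g)"
    and rep_one: "\<pi> \<one>\<^bsub>GL n\<^esub> = id"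
    and rep_mult: "\<lbrakk>g \<in> carrier (GL n); h \<in> carrier (GL n)\<rbrakk> \<Longrightarrow> \<pi> (g \<otimes>\<^bsub>GL n\<^esub> h) = \<pi> g \<circ> \<pi> h"

definition irreducible_GL_rep ::
    "('r::field \<Rightarrow> 'v::ab_group_add \<Rightarrow> 'v) \<Rightarrow> nat \<Rightarrow> ('k::field mat \<Rightarrow> 'v \<Rightarrow> 'v) \<Rightarrow> bool" where
  "irreducible_GL_rep scale n \<pi> \<longleftrightarrow>
     GL_rep scale n \<pi> \<and> (UNIV :: 'v set) \<noteq> {0} \<and>
     (\<forall>W. Modules.module.subspace scale W \<and> (\<forall>g\<in>carrier (GL n). \<pi> g ` W \<subseteq> W)
        \<longrightarrow> W = {0} \<or> W = UNIV)"

text \<open>The underlying set of the quotient space of coinvariants \<open>V\<^sub>U = V / \<langle>\<pi>(u)v - v\<rangle>\<close>.\<close>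

definition coinvariants ::
    "('r::field \<Rightarrow> 'v::ab_group_add \<Rightarrow> 'v) \<Rightarrow> ('k mat \<Rightarrow> 'v \<Rightarrow> 'v) \<Rightarrow> 'k mat set \<Rightarrow> 'v set set" where
  "coinvariants scale \<pi> U =
     UNIV // {(v, w). v - w \<in> Modules.module.span scale {\<pi> u x - x | u x. u \<in> U}}"

text \<open>The parabolic subgroups of \<open>GL\<^sub>n(k)\<close> are the stabilizers of flags
  \<open>0 = W\<^sub>0 \<subset> W\<^sub>1 \<subset> \<dots> \<subset> W\<^sub>r = k\<^sup>n\<close>; the unipotent radical consists of the elements acting
  trivially on all \<open>W\<^bsub>i+1\<^esub>/W\<^sub>i\<close>.\<close>

definition is_flag :: "nat \<Rightarrow> 'k::field vec set list \<Rightarrow> bool" where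
  "is_flag n Ws \<longleftrightarrow>
     (\<forall>W\<in>set Ws. VectorSpace.subspace class_ring W (module_vec TYPE('k) n)) \<and>
     sorted_wrt (\<subset>) Ws \<and> Ws \<noteq> [] \<and> hd Ws = {0\<^sub>v n} \<and> last Ws = carrier_vec n"

definition parabolic :: "nat \<Rightarrow> 'k::field vec set list \<Rightarrow> 'k mat set" where
  "parabolic n Ws = {g \<in> carrier (GL n). \<forall>W\<in>set Ws. (\<lambda>w. g *\<^sub>v w) ` W = W}"

definition unipotent_radical :: "nat \<Rightarrow> 'k::field vec set list \<Rightarrow> 'k mat set" where
  "unipotent_radical n Ws =
     {g \<in> carrier (GL n). \<forall>i. Suc i < length Ws \<longrightarrow> (\<forall>w\<in>Ws ! Suc i. g *\<^sub>v w - w \<in> Ws ! i)}"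

definition cuspidal ::
    "('r::field \<Rightarrow> 'v::ab_group_add \<Rightarrow> 'v) \<Rightarrow> nat \<Rightarrow> ('k::field mat \<Rightarrow> 'v \<Rightarrow> 'v) \<Rightarrow> bool" where
  "cuspidal scale n \<pi> \<longleftrightarrow>
     (\<forall>Ws. is_flag n Ws \<and> parabolic n Ws \<noteq> carrier (GL n)
        \<longrightarrow> is_singleton (coinvariants scale \<pi> (unipotent_radical n Ws)))"

definition dual_space :: "('r::field \<Rightarrow> 'v::ab_group_add \<Rightarrow> 'v) \<Rightarrow> ('v \<Rightarrow> 'r) set" where
  "dual_space scale = {f. Vector_Spaces.linear scale (*) f}"

text \<open>\<open>Hom\<^bsub>R[H]\<^esub>(\<pi>, R)\<close> with \<open>R\<close> the trivial representation.\<close>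

definition invariant_forms ::
    "('r::field \<Rightarrow> 'v::ab_group_add \<Rightarrow> 'v) \<Rightarrow> ('k mat \<Rightarrow> 'v \<Rightarrow> 'v) \<Rightarrow> 'k mat set \<Rightarrow> ('v \<Rightarrow> 'r) set" where
  "invariant_forms scale \<pi> H = {\<Lambda> \<in> dual_space scale. \<forall>h\<in>H. \<Lambda> \<circ> \<pi> h = \<Lambda>}"

definition distinguished ::
    "('r::field \<Rightarrow> 'v::ab_group_add \<Rightarrow> 'v) \<Rightarrow> ('k mat \<Rightarrow> 'v \<Rightarrow> 'v) \<Rightarrow> 'k mat set \<Rightarrow> bool" where
  "distinguished scale \<pi> H \<longleftrightarrow> (\<exists>\<Lambda>\<in>invariant_forms scale \<pi> H. \<Lambda> \<noteq> (\<lambda>_. 0))"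

text \<open>For irreducible \<open>\<pi>\<close> over an algebraically closed field, Schur's lemma makes the central
  character and the gamma factor well defined.\<close>

definition central_character ::
    "('r::field \<Rightarrow> 'v::ab_group_add \<Rightarrow> 'v) \<Rightarrow> nat \<Rightarrow> ('k::field mat \<Rightarrow> 'v \<Rightarrow> 'v) \<Rightarrow> 'k \<Rightarrow> 'r" where
  "central_character scale n \<pi> z = (THE c. \<forall>v. \<pi> (z \<cdot>\<^sub>m 1\<^sub>m n) v = scale c v)"

definition contragredient ::
    "nat \<Rightarrow> ('k::field mat \<Rightarrow> 'v \<Rightarrow> 'v) \<Rightarrow> 'k mat \<Rightarrow> ('v \<Rightarrow> 'r) \<Rightarrow> 'v \<Rightarrow> 'r" where
  "contragredient n \<pi> g f = f \<circ> \<pi> (inv\<^bsub>GL n\<^esub> g)"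

text \<open>The gamma factor relative to a chosen square root \<open>s\<close> of \<open>|M\<^sub>n(k)|\<close> in \<open>R\<close>.\<close>

definition gamma_factor ::
    "'r \<Rightarrow> ('r::field \<Rightarrow> 'v::ab_group_add \<Rightarrow> 'v) \<Rightarrow> nat \<Rightarrow>
     ('k::{finite,field} mat \<Rightarrow> 'v \<Rightarrow> 'v) \<Rightarrow> ('k \<Rightarrow> 'r) \<Rightarrow> 'r" where
  "gamma_factor s scale n \<pi> \<psi> =
     (THE c. \<forall>f\<in>dual_space scale. \<forall>v.
        inverse s * (\<Sum>g\<in>carrier (GL n). \<psi> (mat_trace g) * contragredient n \<pi> g f v) = c * f v)"

end

theory Submission
  imports
    Defs
    "Jordan_Normal_Form.Determinant"
    "HOL-Algebra.Sylow"
    "HOL-Number_Theory.Cong"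
begin

text \<open>
  In each case \<open>H = M \<inter> GL\<^sub>n(k)\<close> for a subalgebra \<open>M\<close> of \<open>M\<^sub>n(k)\<close> whose orthogonal complement for the
  pairing \<open>\<psi>(tr(xy))\<close> is \<open>wM\<close> with \<open>w\<close> in \<open>GL\<^sub>n(k)\<close>, so that \<open>|M|\<close> is the square root of \<open>|M\<^sub>n(k)|\<close>.
  For an \<open>H\<close>-invariant form \<open>\<Lambda>\<close> one has, with \<open>t\<close> running over representatives of \<open>GL\<^sub>n(k)/H\<close>,
  \<open>|M| \<gamma> \<Lambda>(v) = \<Sum>\<^sub>t \<Lambda>(\<pi>(t\<inverse>)v) \<Sum>\<^bsub>h \<in> H\<^esub> \<Psi>(th)\<close>. Extending the inner sum from \<open>H\<close> to \<open>M\<close> changes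
  nothing: collecting the new terms by the singular matrix \<open>y = tx\<close> gives forms invariant under
  \<open>{u. uy = y}\<close>, a group that contains the unipotent radical of the stabilizer of a hyperplane, and
  such forms vanish by cuspidality. The sum over \<open>M\<close> is \<open>|M|\<close> if \<open>t \<in> wM\<close> and \<open>0\<close> otherwise, hence
  \<open>\<gamma> \<Lambda> = \<Lambda> \<circ> \<pi>(w\<inverse>)\<close>. Working with cosets throughout avoids dividing by \<open>|H|\<close>, which may be zero
  in \<open>R\<close>.
\<close>

section \<open>Matrices over a finite field\<close>

text \<open>The transformation rule holds for each invariant form separately, so the scalar it
  produces acts on all of Hom_{R[H]}(\<pi>, R). In the Galois case w is the scalar matrix \<delta>;
  since \<delta>^2 lies in k_0, w^2 lies in H, and \<pi>(w^-1) may be replaced by \<pi>(w) under the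
  form. This turns the inverse of \<omega>(\<delta>) into \<omega>(\<delta>). In the other two cases
  M is the centralizer of a matrix J with J^2 = \<alpha>, and w is an involution with wJ = -Jw; the
  orthogonal complement of M consists of the matrices anticommuting with J, which is wM. The same J
  controls the normalizer: the commutant of H is k[J], so a normalizing g conjugates J to a
  non-scalar square root of \<alpha> in k[J], that is to J or -J, and N is the union of H and wH.
  The character is therefore 1 on H and \<gamma> on wH. The values of \<gamma> for different \<psi>
  agree because each is the scalar by which w acts.\<close>

lemma carrier_GL:
  "carrier (GL n) = {A \<in> carrier_mat n n. \<exists>B\<in>carrier_mat n n. B * A = 1\<^sub>m n \<and> A * B = 1\<^sub>m n}"
  by (auto simp: GL_def units_of_def Units_def ring_mat_def)

lemma mult_GL [simp]: "g \<otimes>\<^bsub>GL n\<^esub> h = g * h"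
  by (simp add: GL_def units_of_def ring_mat_def)

lemma one_GL [simp]: "\<one>\<^bsub>GL n\<^esub> = 1\<^sub>m n"
  unfolding GL_def units_of_def ring_mat_def by (simp only: monoid.simps)

lemma group_GL: "group (GL n :: 'k::field mat monoid)"
  unfolding GL_def by (rule monoid.units_group[OF ring.is_monoid[OF ring_mat]])

lemma GL_carrier_mat: "g \<in> carrier (GL n) \<Longrightarrow> g \<in> carrier_mat n n"
  by (simp add: carrier_GL)

lemma GL_I:
  "\<lbrakk>A \<in> carrier_mat n n; B \<in> carrier_mat n n; A * B = 1\<^sub>m n; B * A = 1\<^sub>m n\<rbrakk> \<Longrightarrow> A \<in> carrier (GL n)"
  by (auto simp: carrier_GL)

lemma GL_inv:
  fixes g :: "'k::field mat"
  assumes "g \<in> carrier (GL n)"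
  shows "inv\<^bsub>GL n\<^esub> g \<in> carrier (GL n)" "inv\<^bsub>GL n\<^esub> g \<in> carrier_mat n n"
    "g * inv\<^bsub>GL n\<^esub> g = 1\<^sub>m n" "inv\<^bsub>GL n\<^esub> g * g = 1\<^sub>m n"
proof -
  interpret group "GL n :: 'k mat monoid" by (rule group_GL)
  show "inv\<^bsub>GL n\<^esub> g \<in> carrier (GL n)" using assms by simp
  then show "inv\<^bsub>GL n\<^esub> g \<in> carrier_mat n n" by (rule GL_carrier_mat)
  show "g * inv\<^bsub>GL n\<^esub> g = 1\<^sub>m n" "inv\<^bsub>GL n\<^esub> g * g = 1\<^sub>m n"
    using r_inv[OF assms] l_inv[OF assms] by simp_all
qed

lemma GL_mult:
  fixes g :: "'k::field mat"
  assumes "g \<in> carrier (GL n)" "h \<in> carrier (GL n)"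
  shows "g * h \<in> carrier (GL n)"
  using monoid.m_closed[OF group.is_monoid[OF group_GL] assms] by simp

lemma GL_one: "1\<^sub>m n \<in> carrier (GL n :: 'k::field mat monoid)"
  using monoid.one_closed[OF group.is_monoid[OF group_GL]] by simp

lemma GL_inv_cancel:
  fixes g :: "'k::field mat"
  assumes "g \<in> carrier (GL n)" "A \<in> carrier_mat n m"
  shows "g * (inv\<^bsub>GL n\<^esub> g * A) = A" "inv\<^bsub>GL n\<^esub> g * (g * A) = A"
  using assms GL_inv[OF assms(1)] GL_carrier_mat[OF assms(1)]
  by (simp_all flip: assoc_mult_mat[of _ n n _ n _ m])

lemma GL_inv_cancel_right:
  fixes g :: "'k::field mat"
  assumes "g \<in> carrier (GL n)" "A \<in> carrier_mat m n"
  shows "A * g * inv\<^bsub>GL n\<^esub> g = A" "A * inv\<^bsub>GL n\<^esub> g * g = A"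
  using assms GL_inv[OF assms(1)] GL_carrier_mat[OF assms(1)]
  by (simp_all add: assoc_mult_mat[of _ m n _ n _ n])

lemma GL_inv_mult:
  fixes g :: "'k::field mat"
  assumes "g \<in> carrier (GL n)" "h \<in> carrier (GL n)"
  shows "inv\<^bsub>GL n\<^esub> (g * h) = inv\<^bsub>GL n\<^esub> h * inv\<^bsub>GL n\<^esub> g"
  using group.inv_mult_group[OF group_GL assms] by simp

lemma GL_inv_eqI:
  fixes g :: "'k::field mat"
  assumes "g \<in> carrier (GL n)" "h \<in> carrier_mat n n" "g * h = 1\<^sub>m n"
  shows "inv\<^bsub>GL n\<^esub> g = h"
  using GL_inv_cancel(2)[OF assms(1,2)] assms(3) GL_inv(2)[OF assms(1)] by simp

lemma mats_over_iff:
  "A \<in> mats_over S n \<longleftrightarrow> A \<in> carrier_mat n n \<and> (\<forall>i<n. \<forall>j<n. A $$ (i,j) \<in> S)"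
proof -
  have "elements_mat A = (\<lambda>(i,j). A $$ (i,j)) ` ({..<n} \<times> {..<n})" if "A \<in> carrier_mat n n"
    using that by force
  then show ?thesis by (fastforce simp: mats_over_def)
qed

text \<open>The bijection with functions on index pairs gives |K|^(n^2) for a subfield K, so the
  count is non-zero in R as soon as |K| is.\<close>

lemma card_mats_over: "card (mats_over S n) = card S ^ (n * n)"
proof -
  let ?I = "{..<n} \<times> {..<n}"
  let ?r = "\<lambda>A. restrict (\<lambda>ij. A $$ ij) ?I"
  have "bij_betw (mat n n) (?I \<rightarrow>\<^sub>E S) (mats_over S n)"
  proof (rule bij_betw_byWitness[where f' = ?r])
    show "\<forall>f\<in>?I \<rightarrow>\<^sub>E S. ?r (mat n n f) = f"
    proof
      fix f assume f: "f \<in> ?I \<rightarrow>\<^sub>E S"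
      show "?r (mat n n f) = f"
      proof
        fix ij show "?r (mat n n f) ij = f ij"
          using PiE_arb[OF f, of ij] by (cases ij) (auto simp: restrict_def)
      qed
    qed
    show "\<forall>A\<in>mats_over S n. mat n n (?r A) = A"
      by (intro ballI eq_matI) (auto simp: mats_over_iff)
    show "mat n n ` (?I \<rightarrow>\<^sub>E S) \<subseteq> mats_over S n"
      by (rule image_subsetI) (simp add: mats_over_iff PiE_iff)
    show "?r ` mats_over S n \<subseteq> ?I \<rightarrow>\<^sub>E S"
      by (rule image_subsetI) (simp add: mats_over_iff PiE_iff)
  qed
  from bij_betw_same_card[OF this] show ?thesis
    by (simp add: card_PiE card_cartesian_product)
qed

lemma mats_over_UNIV: "mats_over UNIV n = carrier_mat n n"
  by (simp add: mats_over_def)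

text \<open>An infinite set has \<open>card\<close> 0, so the non-zero count |k|^(n^2) already gives
  finiteness.\<close>

lemma finite_carrier_mat: "finite (carrier_mat n n :: 'k::{finite,field} mat set)"
proof -
  have "card (carrier_mat n n :: 'k mat set) \<noteq> 0"
    using card_mats_over[of "UNIV :: 'k set" n] by (simp add: mats_over_UNIV)
  then show ?thesis by (rule contrapos_np) (rule card.infinite)
qed

lemma finite_GL: "finite (carrier (GL n) :: 'k::{finite,field} mat set)"
  by (rule finite_subset[OF _ finite_carrier_mat[of n]]) (blast dest: GL_carrier_mat)

lemma mat_trace_comm:
  fixes A :: "'k::field mat"
  assumes "A \<in> carrier_mat n m" "B \<in> carrier_mat m n"
  shows "mat_trace (A * B) = mat_trace (B * A)"
proof -
  have "mat_trace (A * B) = (\<Sum>i<n. \<Sum>j<m. A $$ (i,j) * B $$ (j,i))"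
    using assms by (auto simp: mat_trace_def scalar_prod_def atLeast0LessThan intro!: sum.cong)
  also have "\<dots> = (\<Sum>j<m. \<Sum>i<n. B $$ (j,i) * A $$ (i,j))"
    by (subst sum.swap) (simp add: mult.commute)
  also have "\<dots> = mat_trace (B * A)"
    using assms by (auto simp: mat_trace_def scalar_prod_def atLeast0LessThan intro!: sum.cong)
  finally show ?thesis .
qed

lemma mat_trace_add:
  "\<lbrakk>A \<in> carrier_mat n n; B \<in> carrier_mat n n\<rbrakk> \<Longrightarrow> mat_trace (A + B) = mat_trace A + mat_trace B"
  by (simp add: mat_trace_def sum.distrib)

lemma mat_trace_smult: "A \<in> carrier_mat n n \<Longrightarrow> mat_trace (c \<cdot>\<^sub>m A) = c * mat_trace A"
  by (simp add: mat_trace_def sum_distrib_left)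

section \<open>Singular matrices, hyperplanes and unipotent radicals\<close>

text \<open>A kernel vector of the transpose is a non-zero functional that kills the image of
  \<open>y\<close>, so this image lies in a hyperplane.\<close>

lemma singular_hyperplane:
  fixes y :: "'k::field mat"
  assumes y: "y \<in> carrier_mat n n" "y \<notin> carrier (GL n)"
  obtains r where "r \<in> carrier_vec n" "r \<noteq> 0\<^sub>v n" "\<And>v. v \<in> carrier_vec n \<Longrightarrow> r \<bullet> (y *\<^sub>v v) = 0"
proof -
  have "det y = 0"
    using y det_non_zero_imp_unit[OF y(1), of "()"] by (auto simp: GL_def units_of_def)
  then have "det (transpose_mat y) = 0" using y by (simp add: det_transpose)
  then obtain r where r: "r \<in> carrier_vec n" "r \<noteq> 0\<^sub>v n" "transpose_mat y *\<^sub>v r = 0\<^sub>v n"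
    using det_0_iff_vec_prod_zero[of "transpose_mat y" n] y by auto
  have "r \<bullet> (y *\<^sub>v v) = 0" if v: "v \<in> carrier_vec n" for v
  proof -
    have "r \<bullet> (y *\<^sub>v v) = (transpose_mat y *\<^sub>v r) \<bullet> v"
      using transpose_vec_mult_scalar[OF y(1) v r(1)] by simp
    then show ?thesis using r v by simp
  qed
  with r that show ?thesis by blast
qed

definition hyperplane :: "nat \<Rightarrow> 'k::field vec \<Rightarrow> 'k vec set" where
  "hyperplane n r = {v \<in> carrier_vec n. r \<bullet> v = 0}"

lemma subspace_vecI:
  fixes W :: "'k::field vec set"
  assumes "W \<subseteq> carrier_vec n" "0\<^sub>v n \<in> W" "\<And>v w. v \<in> W \<Longrightarrow> w \<in> W \<Longrightarrow> v + w \<in> W"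
    "\<And>c v. v \<in> W \<Longrightarrow> c \<cdot>\<^sub>v v \<in> W"
  shows "VectorSpace.subspace class_ring W (module_vec TYPE('k) n)"
proof -
  interpret vec_space "TYPE('k)" n .
  have "submodule class_ring W (module_vec TYPE('k) n)"
    using assms module_axioms by (intro submodule.intro) (auto simp: module_vec_def)
  then show ?thesis
    unfolding VectorSpace.subspace_def by (simp add: vectorspace_axioms)
qed

text \<open>Cuspidality speaks of proper parabolic subgroups, so the stabilizer of a hyperplane has
  to be seen to be proper. The bound n \<ge> 2 provides a second coordinate \<open>j\<close> and
  with it a non-zero vector in the hyperplane; for n = 1 the flag would not be strict.\<close>

lemma hyperplane_flag:
  fixes r :: "'k::field vec"
  assumes r: "r \<in> carrier_vec n" "r \<noteq> 0\<^sub>v n" and n: "n \<ge> 2"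
  defines "Ws \<equiv> [{0\<^sub>v n}, hyperplane n r, carrier_vec n]"
  shows "is_flag n Ws" "parabolic n Ws \<noteq> carrier (GL n)"
proof -
  obtain i where i: "i < n" "r $ i \<noteq> 0"
    using r by (metis carrier_vecD eq_vecI index_zero_vec)
  obtain j where j: "j < n" "j \<noteq> i"
    using n that[of 0] that[of 1] by (cases "i = 0") auto
  \<comment> \<open>This is r_i e_j - r_j e_i: it is orthogonal to r, and its j-th entry r_i is
    non-zero.\<close>
  define w where "w = vec n (\<lambda>l. if l = j then r $ i else if l = i then - r $ j else 0)"
  have w: "w \<in> carrier_vec n" by (simp add: w_def)
  have sum_ij: "(\<Sum>l<n. f l) = f i + f j" if "\<And>l. l < n \<Longrightarrow> l \<noteq> i \<Longrightarrow> l \<noteq> j \<Longrightarrow> f l = 0"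
    for f :: "nat \<Rightarrow> 'k"
  proof -
    have "(\<Sum>l<n. f l) = (\<Sum>l\<in>{i,j}. f l)"
      using that i j by (intro sum.mono_neutral_right) auto
    then show ?thesis using j by simp
  qed
  have "r \<bullet> w = (\<Sum>l<n. r $ l * w $ l)"
    by (simp add: scalar_prod_def atLeast0LessThan w_def)
  also have "\<dots> = r $ i * w $ i + r $ j * w $ j" by (rule sum_ij) (simp add: w_def)
  also have "\<dots> = 0" using i j by (simp add: w_def)
  finally have rw: "r \<bullet> w = 0" .
  have wW: "w \<in> hyperplane n r" using w rw by (simp add: hyperplane_def)
  have w0: "w \<noteq> 0\<^sub>v n"
  proof
    assume "w = 0\<^sub>v n"
    then have "w $ j = 0" using j by simp
    then show False using i j by (simp add: w_def)
  qed
  have ru: "r \<bullet> unit_vec n i = r $ i" using r i by simp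
  have "sorted_wrt (\<subset>) Ws"
  proof -
    have "{0\<^sub>v n} \<subset> hyperplane n r"
      using wW w0 r by (auto simp: hyperplane_def)
    moreover have "hyperplane n r \<subset> carrier_vec n"
    proof (rule psubsetI)
      show "hyperplane n r \<noteq> carrier_vec n"
      proof
        assume "hyperplane n r = carrier_vec n"
        then have "unit_vec n i \<in> hyperplane n r" by simp
        then show False using ru i by (simp add: hyperplane_def)
      qed
    qed (simp add: hyperplane_def)
    ultimately show ?thesis unfolding Ws_def by (simp add: psubset_trans)
  qed
  moreover have "VectorSpace.subspace class_ring {0\<^sub>v n} (module_vec TYPE('k) n)"
    by (rule subspace_vecI) auto
  moreover have "VectorSpace.subspace class_ring (carrier_vec n) (module_vec TYPE('k) n)"
    by (rule subspace_vecI) auto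
  moreover have "VectorSpace.subspace class_ring (hyperplane n r) (module_vec TYPE('k) n)"
    by (rule subspace_vecI) (use r in \<open>auto simp: hyperplane_def scalar_prod_add_distrib[of _ n]\<close>)
  ultimately show "is_flag n Ws" by (simp add: is_flag_def Ws_def)
  \<comment> \<open>The transvection 1 + E_ij moves \<open>w\<close> to w + r_i e_i, on which r
    takes the value r_i^2, so it does not preserve the hyperplane.\<close>
  define g where "g = addrow_mat n (1::'k) i j"
  have g: "g \<in> carrier (GL n)"
    using addrow_mat_inv[OF i(1) j(1) j(2)[symmetric], of "1::'k"]
      addrow_mat_inv[OF i(1) j(1) j(2)[symmetric], of "- 1::'k"]
    by (intro GL_I[of _ _ "addrow_mat n (- 1) i j"]) (auto simp: g_def)
  have "g *\<^sub>v w = w + (r $ i) \<cdot>\<^sub>v unit_vec n i"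
  proof (rule eq_vecI)
    fix l assume "l < dim_vec (w + (r $ i) \<cdot>\<^sub>v unit_vec n i)"
    then have l: "l < n" by simp
    have "(g *\<^sub>v w) $ l = (\<Sum>p<n. g $$ (l, p) * w $ p)"
      using l by (simp add: g_def scalar_prod_def atLeast0LessThan w_def)
    also have "\<dots> = w $ l + (if l = i then r $ i else 0)"
    proof (cases "l = i")
      case True
      then have "(\<Sum>p<n. g $$ (l, p) * w $ p) = g $$ (l,i) * w $ i + g $$ (l,j) * w $ j"
        using l j by (intro sum_ij) (auto simp: g_def addrow_mat_def)
      then show ?thesis using True i j by (simp add: g_def addrow_mat_def w_def)
    next
      case False
      then have "(\<Sum>p<n. g $$ (l, p) * w $ p) = (\<Sum>p<n. if p = l then w $ p else 0)"
        using l by (intro sum.cong) (auto simp: g_def addrow_mat_def)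
      then show ?thesis using False l by simp
    qed
    finally show "(g *\<^sub>v w) $ l = (w + (r $ i) \<cdot>\<^sub>v unit_vec n i) $ l"
      using l w i by (simp add: unit_vec_def)
  qed (use w in \<open>simp add: g_def\<close>)
  then have "r \<bullet> (g *\<^sub>v w) = r $ i * r $ i"
    using r w ru rw by (simp add: scalar_prod_add_distrib[of _ n])
  then have "g *\<^sub>v w \<notin> hyperplane n r" using i by (simp add: hyperplane_def)
  then have "g \<notin> parabolic n Ws"
    using wW by (auto simp: parabolic_def Ws_def)
  with g show "parabolic n Ws \<noteq> carrier (GL n)" by blast
qed

text \<open>The radical acts trivially on the hyperplane, which is the first quotient of the flag,
  and all columns of \<open>y\<close> lie in it.\<close>

lemma unipotent_radical_fixes:
  fixes y u :: "'k::field mat"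
  assumes y: "y \<in> carrier_mat n n" and r: "\<And>v. v \<in> carrier_vec n \<Longrightarrow> r \<bullet> (y *\<^sub>v v) = 0"
    and u: "u \<in> unipotent_radical n [{0\<^sub>v n}, hyperplane n r, carrier_vec n]"
  shows "u * y = y"
proof (rule eq_matI)
  have uc: "u \<in> carrier_mat n n"
    using u by (simp add: unipotent_radical_def carrier_GL)
  then show "dim_row (u * y) = dim_row y" "dim_col (u * y) = dim_col y" using y by auto
  fix i j assume "i < dim_row y" "j < dim_col y"
  then have ij: "i < n" "j < n" using y by auto
  have cy: "col y j = y *\<^sub>v unit_vec n j" using y ij by (intro eq_vecI) auto
  then have "col y j \<in> hyperplane n r"
    using r[of "unit_vec n j"] y by (simp add: hyperplane_def)
  then have 1: "u *\<^sub>v col y j - col y j = 0\<^sub>v n"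
    using u unfolding unipotent_radical_def by fastforce
  have "(u * y) $$ (i,j) = (u *\<^sub>v col y j) $ i" using uc y ij by simp
  also have "\<dots> = (u *\<^sub>v col y j - col y j) $ i + col y j $ i" using uc y ij by simp
  also have "\<dots> = y $$ (i,j)" using 1 y ij by simp
  finally show "(u * y) $$ (i,j) = y $$ (i,j)" .
qed

section \<open>Transversals and eigenvectors\<close>

text \<open>A function \<open>rep\<close> constant on left cosets encodes the transversal; its image
  is the set of representatives. The choice depends on the coset alone, so equal cosets receive
  equal representatives.\<close>

lemma (in group) left_transversal:
  assumes H: "subgroup H G"
  obtains rep where
    "\<And>g. g \<in> carrier G \<Longrightarrow> \<exists>h\<in>H. rep g = g \<otimes> h"
    "\<And>g h. \<lbrakk>g \<in> carrier G; h \<in> H\<rbrakk> \<Longrightarrow> rep (g \<otimes> h) = rep g"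
proof -
  interpret H: subgroup H G by (rule H)
  define rep where "rep g = (SOME x. x \<in> l_coset G g H)" for g
  have "rep g \<in> l_coset G g H" if "g \<in> carrier G" for g
    unfolding rep_def by (rule someI[of _ g]) (use that in \<open>auto simp: l_coset_def intro!: bexI[of _ \<one>]\<close>)
  then have "\<exists>h\<in>H. rep g = g \<otimes> h" if "g \<in> carrier G" for g
    using that by (auto simp: l_coset_def)
  moreover have "rep (g \<otimes> h) = rep g" if "g \<in> carrier G" "h \<in> H" for g h
  proof -
    have "l_coset G g H = l_coset G (g \<otimes> h) H"
      using that H by (intro l_repr_independence) (auto simp: l_coset_def)
    then show ?thesis by (simp add: rep_def)
  qed
  ultimately show ?thesis using that by blast
qed

text \<open>Every g factors uniquely as th with t = \<open>rep g\<close> and h in H, so the sum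
  splits over the cosets without a factor |H|.\<close>

lemma (in group) sum_over_transversal:
  assumes H: "subgroup H G"
    and rep1: "\<And>g. g \<in> carrier G \<Longrightarrow> \<exists>h\<in>H. rep g = g \<otimes> h"
    and rep2: "\<And>g h. \<lbrakk>g \<in> carrier G; h \<in> H\<rbrakk> \<Longrightarrow> rep (g \<otimes> h) = rep g"
  shows "(\<Sum>g\<in>carrier G. \<phi> g) = (\<Sum>t\<in>rep ` carrier G. \<Sum>h\<in>H. \<phi> (t \<otimes> h))"
proof -
  interpret H: subgroup H G by (rule H)
  have repc: "rep g \<in> carrier G" if "g \<in> carrier G" for g using rep1[OF that] that by auto
  have rep_rep: "rep (rep g) = rep g" if "g \<in> carrier G" for g
    using rep1[OF that] rep2 that by force
  have inH: "inv (rep g) \<otimes> g \<in> H" if g: "g \<in> carrier G" for g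
  proof -
    obtain h where h: "h \<in> H" "rep g = g \<otimes> h" using rep1 g by blast
    then have "inv (rep g) \<otimes> g = inv h"
      using g by (simp add: inv_mult_group m_assoc)
    then show ?thesis using h by simp
  qed
  have "(\<Sum>g\<in>carrier G. \<phi> g) = (\<Sum>(t,h)\<in>rep ` carrier G \<times> H. \<phi> (t \<otimes> h))"
    by (rule sum.reindex_bij_witness[where i = "\<lambda>(t,h). t \<otimes> h" and j = "\<lambda>g. (rep g, inv (rep g) \<otimes> g)"])
       (auto simp: repc rep2 rep_rep inH split_beta simp flip: m_assoc
          simp del: H.m_inv_closed)
  then show ?thesis by (simp add: sum.cartesian_product)
qed

text \<open>Left translation by \<open>u\<close> permutes the left cosets contained in
  \<open>A\<close>. It need not send representatives to representatives, but \<open>F\<close> is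
  constant on cosets, so \<open>rep (u \<otimes> t)\<close> may replace
  \<open>u \<otimes> t\<close>.\<close>

lemma (in group) transversal_sum_shift:
  assumes H: "subgroup H G"
    and rep1: "\<And>g. g \<in> carrier G \<Longrightarrow> \<exists>h\<in>H. rep g = g \<otimes> h"
    and rep2: "\<And>g h. \<lbrakk>g \<in> carrier G; h \<in> H\<rbrakk> \<Longrightarrow> rep (g \<otimes> h) = rep g"
    and A: "A \<subseteq> carrier G" "\<And>a h. \<lbrakk>a \<in> A; h \<in> H\<rbrakk> \<Longrightarrow> a \<otimes> h \<in> A"
    and u: "u \<in> carrier G" "\<And>a. a \<in> A \<Longrightarrow> u \<otimes> a \<in> A" "\<And>a. a \<in> A \<Longrightarrow> inv u \<otimes> a \<in> A"
    and F: "\<And>g h. \<lbrakk>g \<in> carrier G; h \<in> H\<rbrakk> \<Longrightarrow> F (g \<otimes> h) = F g"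
  shows "(\<Sum>t\<in>rep ` carrier G \<inter> A. F (u \<otimes> t)) = (\<Sum>t\<in>rep ` carrier G \<inter> A. F t)"
proof -
  interpret H: subgroup H G by (rule H)
  have rep_rep: "rep (rep g) = rep g" if "g \<in> carrier G" for g
    using rep1[OF that] rep2 that by force
  have repA: "rep a \<in> A" if "a \<in> A" for a using rep1[of a] that A by (metis subsetD)
  have repF: "F (rep g) = F g" if "g \<in> carrier G" for g using rep1[OF that] F that by force
  have rep_shift: "rep (x \<otimes> rep a) = rep (x \<otimes> a)" if "x \<in> carrier G" "a \<in> carrier G" for x a
  proof -
    obtain h where "h \<in> H" "rep a = a \<otimes> h" using rep1 \<open>a \<in> carrier G\<close> by blast
    then show ?thesis using that rep2[of "x \<otimes> a" h] by (simp add: m_assoc)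
  qed
  have cancel: "inv u \<otimes> (u \<otimes> a) = a" "u \<otimes> (inv u \<otimes> a) = a" if "a \<in> carrier G" for a
    using that u(1) by (simp_all flip: m_assoc)
  have Ac: "a \<in> carrier G" if "a \<in> A" for a using that A by blast
  show ?thesis
    by (rule sum.reindex_bij_witness[where i = "\<lambda>t. rep (inv u \<otimes> t)" and j = "\<lambda>t. rep (u \<otimes> t)"])
       (use u in \<open>auto simp: Ac rep_shift cancel rep_rep repF intro!: repA\<close>)
qed

section \<open>Eigenvectors over an algebraically closed field\<close>

text \<open>Linear dependence among v, Tv, ..., T^N v with N = |B| gives a polynomial p \<noteq> 0
  with p(T)v = 0. Write p = (X - a)q: either q(T)v is an eigenvector for a, or q annihilates v and
  has smaller degree.\<close>

lemma linear_eigenvector: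
  fixes scale :: "'r::alg_closed_field \<Rightarrow> 'v::ab_group_add \<Rightarrow> 'v"
  assumes T: "Vector_Spaces.linear scale scale T"
    and B: "finite B" "Modules.module.span scale B = UNIV" and V: "(UNIV :: 'v set) \<noteq> {0}"
  obtains c v where "v \<noteq> 0" "T v = scale c v"
proof -
  interpret vector_space scale using T by (simp add: Vector_Spaces.linear_iff)
  interpret T: Vector_Spaces.linear scale scale T by (rule T)
  \<comment> \<open>This is p(T)v. The next fact computes it with any bound for the degree, so that
    polynomials of different degrees can be compared term by term.\<close>
  define ev where "ev p v = (\<Sum>i\<le>degree p. scale (Polynomial.coeff p i) ((T ^^ i) v))" for p v
  have ev: "ev p v = (\<Sum>i\<le>N. scale (Polynomial.coeff p i) ((T ^^ i) v))" if "degree p \<le> N" for p v N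
    unfolding ev_def using that by (intro sum.mono_neutral_left) (auto simp: coeff_eq_0)
  have ev_step: "ev ([:- a, 1:] * q) v = T (ev q v) - scale a (ev q v)" for a q v
  proof -
    define N where "N = degree q"
    have "degree ([:- a, 1:] * q) \<le> Suc N"
      using degree_mult_le[of "[:- a, 1:]" q] by (simp add: N_def)
    then have "ev ([:- a, 1:] * q) v
        = (\<Sum>i\<le>Suc N. scale (Polynomial.coeff (pCons 0 q) i) ((T ^^ i) v) - scale a (scale (Polynomial.coeff q i) ((T ^^ i) v)))"
      by (simp add: ev algebra_simps del: sum.atMost_Suc)
    also have "\<dots> = (\<Sum>i\<le>Suc N. scale (Polynomial.coeff (pCons 0 q) i) ((T ^^ i) v)) - scale a (ev q v)"
      using ev[of q "Suc N" v] by (simp add: N_def sum_subtractf scale_sum_right del: sum.atMost_Suc)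
    also have "(\<Sum>i\<le>Suc N. scale (Polynomial.coeff (pCons 0 q) i) ((T ^^ i) v)) = T (ev q v)"
      by (subst sum.atMost_Suc_shift) (simp add: ev[of q N] N_def T.sum T.scale)
    finally show ?thesis .
  qed
  have eig: "\<exists>c v. v \<noteq> 0 \<and> T v = scale c v" if "p \<noteq> 0" "v \<noteq> 0" "ev p v = 0" for p v
    using that
  proof (induction "degree p" arbitrary: p rule: less_induct)
    case less
    have "degree p \<noteq> 0"
    proof
      assume "degree p = 0"
      then have "scale (Polynomial.coeff p 0) v = 0" using less.prems by (simp add: ev_def)
      then have "Polynomial.coeff p 0 = 0" using less.prems by simp
      then show False using \<open>degree p = 0\<close> less.prems(1) by (metis leading_coeff_0_iff)
    qed
    then obtain a where "poly p a = 0" using alg_closed_imp_poly_has_root[of p] by auto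
    then obtain q where q: "p = [:- a, 1:] * q" by (metis dvdE poly_eq_0_iff_dvd)
    then have "q \<noteq> 0" using less.prems by auto
    then have "degree q < degree p" unfolding q by (subst degree_mult_eq) auto
    show ?case
    proof (cases "ev q v = 0")
      case True
      then show ?thesis using less \<open>q \<noteq> 0\<close> \<open>degree q < degree p\<close> by blast
    next
      case False
      have "T (ev q v) = scale a (ev q v)" using ev_step[of a q v] less.prems(3) q by simp
      with False show ?thesis by blast
    qed
  qed
  obtain v :: 'v where v: "v \<noteq> 0" using V by auto
  define N where "N = card B"
  have "\<exists>p. p \<noteq> 0 \<and> ev p v = 0"
  \<comment> \<open>\<open>dependent\<close> concerns sets of vectors and does not see a repetition
    among the T^i v; a repetition is handled by the polynomial X^j - X^i.\<close>
  proof (cases "inj_on (\<lambda>i. (T ^^ i) v) {..N}")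
    case False
    then obtain i j where ij: "i < j" "(T ^^ i) v = (T ^^ j) v"
      unfolding inj_on_def by (metis linorder_neqE_nat)
    define p :: "'r poly" where "p = Polynomial.monom 1 j - Polynomial.monom 1 i"
    have "Polynomial.coeff p j \<noteq> 0" using ij by (simp add: p_def)
    moreover have "degree p \<le> j" unfolding p_def
      using ij degree_diff_le[of "Polynomial.monom 1 j" j "Polynomial.monom (1::'r) i"] by (simp add: degree_monom_eq)
    then have "ev p v = (\<Sum>l\<le>j. (if l = j then (T ^^ l) v else 0) - (if l = i then (T ^^ l) v else 0))"
      by (subst ev) (auto simp: p_def scale_left_diff_distrib intro!: sum.cong)
    then have "ev p v = 0" using ij by (simp add: sum_subtractf)
    ultimately show ?thesis by (metis coeff_0)
  next
    case True
    define X where "X = (\<lambda>i. (T ^^ i) v) ` {..N}"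
    have cX: "card X = Suc N" unfolding X_def using True by (simp add: card_image)
    have "dependent X"
      using independent_span_bound[OF B(1), of X] B(2) cX N_def by force
    then obtain u where u: "\<exists>x\<in>X. u x \<noteq> 0" "(\<Sum>x\<in>X. scale (u x) x) = 0"
      using dependent_finite[of X] by (auto simp: X_def)
    define p where "p = (\<Sum>i\<le>N. Polynomial.monom (u ((T ^^ i) v)) i)"
    have cp: "Polynomial.coeff p i = (if i \<le> N then u ((T ^^ i) v) else 0)" for i
      by (simp add: p_def coeff_sum)
    have "degree p \<le> N" by (rule degree_le) (simp add: cp)
    then have "ev p v = (\<Sum>i\<le>N. scale (u ((T ^^ i) v)) ((T ^^ i) v))" by (simp add: ev cp)
    also have "\<dots> = 0" using u(2) unfolding X_def by (simp add: sum.reindex[OF True])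
    finally have "ev p v = 0" .
    moreover obtain i where "i \<le> N" "u ((T ^^ i) v) \<noteq> 0" using u(1) by (auto simp: X_def)
    then have "Polynomial.coeff p i \<noteq> 0" by (simp add: cp)
    ultimately show ?thesis by (metis coeff_0)
  qed
  then show ?thesis using eig v that by blast
qed

section \<open>Cuspidal representations\<close>

locale cuspidal_GL_rep = GL_rep scale n \<pi>
  for scale :: "'r::alg_closed_field \<Rightarrow> 'v::ab_group_add \<Rightarrow> 'v" and n :: nat
    and \<pi> :: "'k::{finite,field} mat \<Rightarrow> 'v \<Rightarrow> 'v" +
  assumes n_ge_2: "n \<ge> 2"
    and irreducible: "irreducible_GL_rep scale n \<pi>"
    and cuspidal: "cuspidal scale n \<pi>"
begin

section \<open>Linear algebra of an irreducible representation\<close>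

lemma rep_comp:
  "\<lbrakk>g \<in> carrier (GL n); h \<in> carrier (GL n)\<rbrakk> \<Longrightarrow> \<pi> (g * h) v = \<pi> g (\<pi> h v)"
  using rep_mult[of g h] by simp

lemma rep_1: "\<pi> (1\<^sub>m n) v = v"
  using rep_one by simp

lemma rep_hom:
  assumes "g \<in> carrier (GL n)"
  shows "\<pi> g (v + w) = \<pi> g v + \<pi> g w" "\<pi> g (scale c v) = scale c (\<pi> g v)"
    "\<pi> g (\<Sum>x\<in>A. f x) = (\<Sum>x\<in>A. \<pi> g (f x))" "\<pi> g 0 = 0"
proof -
  interpret Vector_Spaces.linear scale scale "\<pi> g" using rep_linear assms .
  show "\<pi> g (v + w) = \<pi> g v + \<pi> g w" "\<pi> g (scale c v) = scale c (\<pi> g v)"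
    "\<pi> g (\<Sum>x\<in>A. f x) = (\<Sum>x\<in>A. \<pi> g (f x))" "\<pi> g 0 = 0"
    by (simp_all add: add scale sum)
qed

lemma nonzero_space: "(UNIV :: 'v set) \<noteq> {0}"
  using irreducible by (simp add: irreducible_GL_rep_def)

lemma invariant_subspace:
  assumes "subspace W" "\<And>g w. g \<in> carrier (GL n) \<Longrightarrow> w \<in> W \<Longrightarrow> \<pi> g w \<in> W"
  shows "W = {0} \<or> W = UNIV"
proof -
  have "\<forall>g\<in>carrier (GL n). \<pi> g ` W \<subseteq> W" using assms(2) by (auto intro: image_subsetI)
  then show ?thesis using irreducible assms(1) by (simp add: irreducible_GL_rep_def)
qed

text \<open>The orbit of a non-zero vector under the finite group is finite and its span is
  invariant, so irreducibility makes V finite-dimensional.\<close>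

lemma finite_spanning: "\<exists>B. finite B \<and> span B = UNIV"
proof -
  obtain v :: 'v where v: "v \<noteq> 0" using nonzero_space by auto
  define B where "B = (\<lambda>g. \<pi> g v) ` carrier (GL n)"
  have B_inv: "\<pi> g w \<in> span B" if g: "g \<in> carrier (GL n)" and w: "w \<in> span B" for g w
    using w
  proof (induction rule: span_induct_alt)
    case base
    then show ?case using rep_hom(4)[OF g] span_zero by simp
  next
    case (step c x y)
    then obtain h where h: "h \<in> carrier (GL n)" "x = \<pi> h v" by (auto simp: B_def)
    then have "\<pi> g x \<in> B"
      unfolding B_def using g by (intro image_eqI[of _ _ "g * h"]) (simp_all add: rep_comp GL_mult)
    then show ?case using step rep_hom[OF g] by (simp add: span_add span_base span_scale)
  qed
  have "span B = {0} \<or> span B = UNIV" using invariant_subspace[OF subspace_span B_inv] .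
  moreover have "v \<in> B"
    unfolding B_def using GL_one by (rule image_eqI[rotated]) (simp add: rep_1)
  then have "v \<in> span B" by (rule span_base)
  ultimately have "span B = UNIV" using v by auto
  moreover have "finite B" unfolding B_def by (rule finite_imageI[OF finite_GL])
  ultimately show ?thesis by (intro exI conjI)
qed

lemma schur:
  assumes T: "Vector_Spaces.linear scale scale T"
    and comm: "\<And>g v. g \<in> carrier (GL n) \<Longrightarrow> T (\<pi> g v) = \<pi> g (T v)"
  shows "\<exists>c. \<forall>v. T v = scale c v"
proof -
  interpret T: Vector_Spaces.linear scale scale T by (rule T)
  obtain c v where cv: "v \<noteq> 0" "T v = scale c v"
    using linear_eigenvector[OF T] finite_spanning nonzero_space by metis
  define W where "W = {v. T v = scale c v}"
  have "subspace W"
    by (rule subspaceI) (auto simp: W_def T.zero T.add T.scale scale_right_distrib mult.commute)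
  moreover have "\<pi> g w \<in> W" if "g \<in> carrier (GL n)" "w \<in> W" for g w
    using that by (simp add: W_def comm rep_hom)
  ultimately have "W = {0} \<or> W = UNIV" by (rule invariant_subspace)
  with cv show ?thesis by (auto simp: W_def)
qed

lemma dual_hom:
  assumes "f \<in> dual_space scale"
  shows "f (v + w) = f v + f w" "f (scale c v) = c * f v" "f (v - w) = f v - f w" "f 0 = 0"
    "f (\<Sum>x\<in>A. h x) = (\<Sum>x\<in>A. f (h x))"
proof -
  interpret Vector_Spaces.linear scale "(*)" f using assms by (simp add: dual_space_def)
  show "f (v + w) = f v + f w" "f (scale c v) = c * f v" "f (v - w) = f v - f w" "f 0 = 0"
    "f (\<Sum>x\<in>A. h x) = (\<Sum>x\<in>A. f (h x))"
    by (simp_all add: add scale diff zero sum)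
qed

lemma dual_I:
  assumes "\<And>v w. f (v + w) = f v + f w" "\<And>c v. f (scale c v) = c * f v"
  shows "f \<in> dual_space scale"
proof -
  have "vector_space ((*) :: 'r \<Rightarrow> 'r \<Rightarrow> 'r)" by unfold_locales (simp_all add: algebra_simps)
  then show ?thesis
    using assms vector_space_axioms by (simp add: dual_space_def Vector_Spaces.linear_iff)
qed

section \<open>The central character and the gamma factor as scalars\<close>

lemma central_char_unique:
  assumes "\<And>v. \<pi> (z \<cdot>\<^sub>m 1\<^sub>m n) v = scale c v"
  shows "central_character scale n \<pi> z = c"
  unfolding central_character_def
proof (rule the_equality)
  fix d assume d: "\<forall>v. \<pi> (z \<cdot>\<^sub>m 1\<^sub>m n) v = scale d v"
  obtain v :: 'v where "v \<noteq> 0" using nonzero_space by auto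
  then show "d = c" using d assms by (metis scale_right_imp_eq)
qed (use assms in blast)

lemma central_char:
  assumes "z \<noteq> 0"
  shows "\<pi> (z \<cdot>\<^sub>m 1\<^sub>m n) v = scale (central_character scale n \<pi> z) v"
proof -
  have z: "z \<cdot>\<^sub>m 1\<^sub>m n \<in> carrier (GL n)"
    using assms by (intro GL_I[of _ _ "inverse z \<cdot>\<^sub>m 1\<^sub>m n"]) auto
  have "\<pi> (z \<cdot>\<^sub>m 1\<^sub>m n) (\<pi> g v) = \<pi> g (\<pi> (z \<cdot>\<^sub>m 1\<^sub>m n) v)" if g: "g \<in> carrier (GL n)" for g v
  proof -
    have "z \<cdot>\<^sub>m 1\<^sub>m n * g = g * (z \<cdot>\<^sub>m 1\<^sub>m n)" using GL_carrier_mat[OF g] by auto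
    then show ?thesis using g z by (simp flip: rep_comp)
  qed
  then obtain c where "\<forall>v. \<pi> (z \<cdot>\<^sub>m 1\<^sub>m n) v = scale c v"
    using schur[OF rep_linear[OF z]] by blast
  then show ?thesis using central_char_unique[of z c] by simp
qed

text \<open>The operator \<Sum> \<Psi>(g) \<pi>(g^-1) on V commutes with \<pi> because the trace is
  invariant under conjugation, so Schur's lemma makes it a scalar; composing it with linear forms
  gives the operator of the definition. Schur's lemma is thus applied to \<pi> and not to its
  contragredient. The non-zero form \<open>\<Lambda>\<close> makes the scalar unique.\<close>

lemma gamma_factor_eq:
  assumes \<Lambda>: "\<Lambda> \<in> dual_space scale" "\<Lambda> \<noteq> (\<lambda>_. 0)" and f: "f \<in> dual_space scale"
  shows "inverse s * (\<Sum>g\<in>carrier (GL n). \<psi> (mat_trace g) * f (\<pi> (inv\<^bsub>GL n\<^esub> g) v))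
    = gamma_factor s scale n \<pi> \<psi> * f v"
proof -
  define T where "T v = (\<Sum>g\<in>carrier (GL n). scale (\<psi> (mat_trace g)) (\<pi> (inv\<^bsub>GL n\<^esub> g) v))" for v
  have T: "Vector_Spaces.linear scale scale T"
    using vector_space_axioms
    by (auto simp: Vector_Spaces.linear_iff T_def rep_hom GL_inv scale_right_distrib sum.distrib scale_sum_right
        mult.commute intro!: sum.cong)
  have comm: "T (\<pi> h v) = \<pi> h (T v)" if h: "h \<in> carrier (GL n)" for h v
  proof -
    note hi = GL_inv(1)[OF h] and hc = GL_carrier_mat[OF h] and hic = GL_inv(2)[OF h]
    have "T (\<pi> h v) = (\<Sum>g\<in>carrier (GL n). scale (\<psi> (mat_trace g)) (\<pi> (inv\<^bsub>GL n\<^esub> g * h) v))"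
      using h by (auto simp: T_def rep_comp GL_inv intro!: sum.cong)
    also have "\<dots> = (\<Sum>g\<in>carrier (GL n). scale (\<psi> (mat_trace g)) (\<pi> (h * inv\<^bsub>GL n\<^esub> g) v))"
    \<comment> \<open>Substituting h^-1 g h for g keeps the trace and turns h g^-1 into g^-1
      h.\<close>
    proof (rule sum.reindex_bij_witness[where j = "\<lambda>g. inv\<^bsub>GL n\<^esub> h * g * h"
          and i = "\<lambda>g. h * g * inv\<^bsub>GL n\<^esub> h"])
      fix g :: "'k mat" assume g: "g \<in> carrier (GL n)"
      note gc = GL_carrier_mat[OF g] and gi = GL_inv[OF g]
      show "h * (inv\<^bsub>GL n\<^esub> h * g * h) * inv\<^bsub>GL n\<^esub> h = g"
        using GL_inv_cancel(1)[OF h gc] GL_inv_cancel_right(1)[OF h gc] gc hc hic GL_inv[OF h]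
        by (simp add: assoc_mult_mat[of _ n n _ n _ n])
      show "inv\<^bsub>GL n\<^esub> h * (h * g * inv\<^bsub>GL n\<^esub> h) * h = g"
        using GL_inv_cancel(2)[OF h gc] GL_inv_cancel_right(1)[OF h gc] gc hc hic GL_inv[OF h]
        by (simp add: assoc_mult_mat[of _ n n _ n _ n])
      show "inv\<^bsub>GL n\<^esub> h * g * h \<in> carrier (GL n)" "h * g * inv\<^bsub>GL n\<^esub> h \<in> carrier (GL n)"
        using g h hi by (simp_all add: GL_mult)
      have "mat_trace (inv\<^bsub>GL n\<^esub> h * g * h) = mat_trace g"
        using gc hc hic GL_inv_cancel(1)[OF h gc]
        by (subst mat_trace_comm[of _ n n]) (auto)
      moreover have "inv\<^bsub>GL n\<^esub> (inv\<^bsub>GL n\<^esub> h * g * h) = inv\<^bsub>GL n\<^esub> h * (inv\<^bsub>GL n\<^esub> g * h)"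
        using g h hi group.inv_inv[OF group_GL h] by (simp add: GL_inv_mult GL_mult)
      then have "h * inv\<^bsub>GL n\<^esub> (inv\<^bsub>GL n\<^esub> h * g * h) = inv\<^bsub>GL n\<^esub> g * h"
        using GL_inv_cancel(1)[OF h, of "inv\<^bsub>GL n\<^esub> g * h" n] gi hc by simp
      ultimately show "scale (\<psi> (mat_trace (inv\<^bsub>GL n\<^esub> h * g * h))) (\<pi> (h * inv\<^bsub>GL n\<^esub> (inv\<^bsub>GL n\<^esub> h * g * h)) v)
        = scale (\<psi> (mat_trace g)) (\<pi> (inv\<^bsub>GL n\<^esub> g * h) v)" by simp
    qed
    also have "\<dots> = \<pi> h (T v)"
      using h by (auto simp: T_def rep_comp rep_hom GL_inv intro!: sum.cong)
    finally show ?thesis .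
  qed
  obtain t where t: "\<And>v. T v = scale t v" using schur[OF T comm] by blast
  have sum_eq: "(\<Sum>g\<in>carrier (GL n). \<psi> (mat_trace g) * f (\<pi> (inv\<^bsub>GL n\<^esub> g) v)) = t * f v"
    if f: "f \<in> dual_space scale" for f v
    using arg_cong[OF t[of v], of f] by (simp add: T_def dual_hom[OF f])
  obtain u where u: "\<Lambda> u \<noteq> 0" using \<Lambda> by auto
  have "gamma_factor s scale n \<pi> \<psi> = inverse s * t"
    unfolding gamma_factor_def contragredient_def
  proof (rule the_equality)
    show "\<forall>f\<in>dual_space scale. \<forall>v. inverse s *
        (\<Sum>g\<in>carrier (GL n). \<psi> (mat_trace g) * (f \<circ> \<pi> (inv\<^bsub>GL n\<^esub> g)) v) = inverse s * t * f v"
      by (simp add: sum_eq)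
  next
    fix d assume "\<forall>f\<in>dual_space scale. \<forall>v. inverse s *
        (\<Sum>g\<in>carrier (GL n). \<psi> (mat_trace g) * (f \<circ> \<pi> (inv\<^bsub>GL n\<^esub> g)) v) = d * f v"
    then have "inverse s * (\<Sum>g\<in>carrier (GL n). \<psi> (mat_trace g) * \<Lambda> (\<pi> (inv\<^bsub>GL n\<^esub> g) u)) = d * \<Lambda> u"
      using \<Lambda>(1) by simp
    then have "inverse s * t * \<Lambda> u = d * \<Lambda> u" by (simp add: sum_eq[OF \<Lambda>(1)])
    then show "d = inverse s * t" using u by simp
  qed
  then show ?thesis by (simp add: sum_eq[OF f])
qed

section \<open>Vanishing by cuspidality and the transformation rule\<close>

text \<open>\<open>S\<close> is invariant under the unipotent radical attached to a hyperplane
  containing the image of \<open>y\<close>, so it kills every \<pi>(u)x - x with u in this radical;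
  vanishing of the coinvariants means that these vectors span V.\<close>

lemma cuspidal_form_zero:
  assumes y: "y \<in> carrier_mat n n" "y \<notin> carrier (GL n)"
    and S: "S \<in> dual_space scale"
    and inv: "\<And>u v. \<lbrakk>u \<in> carrier (GL n); u * y = y\<rbrakk> \<Longrightarrow> S (\<pi> u v) = S v"
  shows "S v = 0"
proof -
  obtain r where r: "r \<in> carrier_vec n" "r \<noteq> 0\<^sub>v n" "\<And>v. v \<in> carrier_vec n \<Longrightarrow> r \<bullet> (y *\<^sub>v v) = 0"
    using singular_hyperplane[OF y] by blast
  define U where "U = unipotent_radical n [{0\<^sub>v n}, hyperplane n r, carrier_vec n]"
  define E where "E = {(v, w). v - w \<in> span {\<pi> u x - x | u x. u \<in> U}}"
  \<comment> \<open>The zero quotient has a single class, so every vector is equivalent to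
    0.\<close>
  have "is_singleton (UNIV // E)"
    using cuspidal hyperplane_flag[OF r(1,2) n_ge_2]
    unfolding cuspidal_def coinvariants_def U_def E_def by blast
  then obtain C where C: "UNIV // E = {C}" by (auto simp: is_singleton_def)
  have "E `` {x} = C" for x using C by (metis UNIV_I quotientI singletonD)
  then have "E `` {v} = E `` {0}" by simp
  moreover have "0 \<in> E `` {0}" by (simp add: E_def span_zero)
  ultimately have "(v, 0) \<in> E" by blast
  then have "v \<in> span {\<pi> u x - x | u x. u \<in> U}" by (simp add: E_def)
  then show ?thesis
  proof (induction rule: span_induct_alt)
    case base
    then show ?case using dual_hom(4)[OF S] by simp
  next
    case (step c x z)
    then obtain u w where u: "u \<in> U" "x = \<pi> u w - w" by blast
    then have "u * y = y" using unipotent_radical_fixes[OF y(1) r(3)] by (simp add: U_def)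
    moreover have "u \<in> carrier (GL n)" using u by (simp add: U_def unipotent_radical_def)
    ultimately show ?case using step u inv by (simp add: dual_hom[OF S])
  qed
qed

lemma invariant_form_transform:
  assumes M: "M \<subseteq> carrier_mat n n" "1\<^sub>m n \<in> M" "\<And>x y. x \<in> M \<Longrightarrow> y \<in> M \<Longrightarrow> x * y \<in> M"
    and H: "subgroup (M \<inter> carrier (GL n)) (GL n)"
    and w: "w \<in> carrier (GL n)"
    and s: "s \<noteq> 0"
    and orth: "\<And>y. y \<in> carrier_mat n n \<Longrightarrow>
      (\<Sum>x\<in>M. \<psi> (mat_trace (y * x))) = (if y \<in> (*) w ` M then s else 0)"
    and \<Lambda>: "\<Lambda> \<in> invariant_forms scale \<pi> (M \<inter> carrier (GL n))"
  shows "inverse s * (\<Sum>g\<in>carrier (GL n). \<psi> (mat_trace g) * \<Lambda> (\<pi> (inv\<^bsub>GL n\<^esub> g) v))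
    = \<Lambda> (\<pi> (inv\<^bsub>GL n\<^esub> w) v)"
proof -
  interpret G: group "GL n :: 'k mat monoid" by (rule group_GL)
  let ?H = "M \<inter> carrier (GL n)"
  obtain rep where rep:
    "\<And>g. g \<in> carrier (GL n) \<Longrightarrow> \<exists>h\<in>?H. rep g = g \<otimes>\<^bsub>GL n\<^esub> h"
    "\<And>g h. \<lbrakk>g \<in> carrier (GL n); h \<in> ?H\<rbrakk> \<Longrightarrow> rep (g \<otimes>\<^bsub>GL n\<^esub> h) = rep g"
    using G.left_transversal[OF H] by blast
  define X where "X = rep ` carrier (GL n)"
  have rep_G: "rep g \<in> carrier (GL n)" if "g \<in> carrier (GL n)" for g
    using rep(1)[OF that] that GL_mult by auto
  then have X_G: "X \<subseteq> carrier (GL n)" by (auto simp: X_def)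
  then have X_mat: "t \<in> carrier_mat n n" if "t \<in> X" for t using that GL_carrier_mat by blast
  have X_fin: "finite X" unfolding X_def by (rule finite_imageI[OF finite_GL])
  have M_fin: "finite M" using M(1) finite_carrier_mat finite_subset by blast
  define F where "F v g = \<Lambda> (\<pi> (inv\<^bsub>GL n\<^esub> g) v)" for v g
  have \<Lambda>d: "\<Lambda> \<in> dual_space scale" using \<Lambda> by (simp add: invariant_forms_def)
  have \<Lambda>inv: "\<Lambda> (\<pi> h x) = \<Lambda> x" if "h \<in> ?H" for h x
    using \<Lambda> that unfolding invariant_forms_def by (metis (mono_tags, lifting) comp_apply mem_Collect_eq)
  have F_inv: "F v (g * h) = F v g" if g: "g \<in> carrier (GL n)" and h: "h \<in> ?H" for g h v
  proof -
    have "inv\<^bsub>GL n\<^esub> h \<in> ?H" using subgroup.m_inv_closed[OF H h] .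
    then show ?thesis using g h by (simp add: F_def GL_inv_mult GL_inv rep_comp \<Lambda>inv)
  qed
  have F_rep: "F v (rep g) = F v g" if "g \<in> carrier (GL n)" for g
    using rep(1)[OF that] F_inv that by auto

  \<comment> \<open>The singular matrices contribute nothing: for fixed singular \<open>y\<close> the sum of \<open>F v\<close> over the cosets
    \<open>tH\<close> with \<open>y \<in> tM\<close> is a form in \<open>v\<close> invariant under all \<open>u\<close> with \<open>uy = y\<close>.\<close>
  have singular: "(\<Sum>t\<in>X \<inter> {g\<in>carrier (GL n). inv\<^bsub>GL n\<^esub> g * y \<in> M}. F v t) = 0" (is "?S v = 0")
    if y: "y \<in> carrier_mat n n" "y \<notin> carrier (GL n)" for y v
  proof -
    define A where "A = {g\<in>carrier (GL n). inv\<^bsub>GL n\<^esub> g * y \<in> M}"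
    have A: "a * h \<in> A" if "a \<in> A" "h \<in> ?H" for a h
    proof -
      have "inv\<^bsub>GL n\<^esub> h \<in> M" using subgroup.m_inv_closed[OF H] that by blast
      then have "inv\<^bsub>GL n\<^esub> h * (inv\<^bsub>GL n\<^esub> a * y) \<in> M" using that M(3) by (simp add: A_def)
      then show ?thesis using that y GL_inv[of a n] GL_inv[of h n]
        by (simp add: A_def GL_mult GL_inv_mult assoc_mult_mat[of _ n n _ n _ n])
    qed
    \<comment> \<open>If uy = y then (ua)^-1 y = a^-1 y, so the set of cosets is stable under the
      stabilizer of \<open>y\<close>.\<close>
    have uA: "u * a \<in> A" if "u \<in> carrier (GL n)" "u * y = y" "a \<in> A" for u a
    proof -
      have "inv\<^bsub>GL n\<^esub> u * y = y" using GL_inv_cancel(2)[OF that(1) y(1)] that(2) by simp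
      then show ?thesis using that y GL_inv[of a n] GL_inv[of u n]
        by (simp add: A_def GL_mult GL_inv_mult assoc_mult_mat[of _ n n _ n _ n])
    qed
    define S where "S v = (\<Sum>t\<in>X \<inter> A. F v t)" for v
    have "S \<in> dual_space scale"
    proof (rule dual_I)
      have XA: "t \<in> carrier (GL n)" if "t \<in> X \<inter> A" for t using that X_G by blast
      fix v w c
      have "F (v + w) t = F v t + F w t" "F (scale c v) t = c * F v t" if "t \<in> X \<inter> A" for t
        using XA[OF that] by (simp_all add: F_def rep_hom GL_inv dual_hom[OF \<Lambda>d])
      note F_lin = this
      show "S (v + w) = S v + S w"
        unfolding S_def sum.distrib[symmetric] by (rule sum.cong[OF refl F_lin(1)])
      show "S (scale c v) = c * S v"
        unfolding S_def sum_distrib_left by (rule sum.cong[OF refl F_lin(2)])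
    qed
    moreover have "S (\<pi> u v) = S v" if u: "u \<in> carrier (GL n)" "u * y = y" for u v
    proof -
      have ui: "inv\<^bsub>GL n\<^esub> u \<in> carrier (GL n)" "inv\<^bsub>GL n\<^esub> u * y = y"
        using GL_inv_cancel(2)[OF u(1) y(1)] u by (simp_all add: GL_inv)
      \<comment> \<open>Since t^-1 u = (u^-1 t)^-1, the action on \<open>v\<close> becomes a
        translation of cosets.\<close>
      have "F (\<pi> u v) t = F v (inv\<^bsub>GL n\<^esub> u * t)" if "t \<in> carrier (GL n)" for t
        using that u ui G.inv_inv[OF u(1)] by (simp add: F_def GL_inv_mult GL_inv rep_comp)
      then have "S (\<pi> u v) = (\<Sum>t\<in>X \<inter> A. F v (inv\<^bsub>GL n\<^esub> u * t))"
        by (auto simp: S_def A_def intro!: sum.cong)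
      also have "\<dots> = S v"
        using G.transversal_sum_shift[OF H rep, of A "inv\<^bsub>GL n\<^esub> u" "F v"] A uA[OF ui] uA[OF u] F_inv
          ui(1) G.inv_inv[OF u(1)]
        by (auto simp: S_def X_def A_def)
      finally show ?thesis .
    qed
    ultimately have "S v = 0" by (rule cuspidal_form_zero[OF y])
    then show ?thesis by (simp add: S_def A_def)
  qed

  have "(\<Sum>g\<in>carrier (GL n). \<psi> (mat_trace g) * F v g)
      = (\<Sum>t\<in>X. \<Sum>h\<in>?H. \<psi> (mat_trace (t * h)) * F v (t * h))"
    using G.sum_over_transversal[OF H rep] by (simp add: X_def)
  also have "\<dots> = (\<Sum>t\<in>X. F v t * (\<Sum>h\<in>?H. \<psi> (mat_trace (t * h))))"
    using X_G F_inv by (auto simp: sum_distrib_left subsetD intro!: sum.cong)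
  also have "\<dots> = (\<Sum>t\<in>X. F v t * (\<Sum>x\<in>M. \<psi> (mat_trace (t * x))))"
  proof -
    define Y where "Y = carrier_mat n n - carrier (GL n :: 'k mat monoid)"
    have Y_fin: "finite Y" unfolding Y_def using finite_carrier_mat by blast
    \<comment> \<open>Sending x to y = tx carries the singular elements of M to the singular y with
      t^-1 y in M. Placing this condition in the summand makes the range of y independent of t, so
      the sums over t and y can be exchanged.\<close>
    have shift: "(\<Sum>x\<in>M - ?H. \<psi> (mat_trace (t * x)))
        = (\<Sum>y\<in>Y. if inv\<^bsub>GL n\<^esub> t * y \<in> M then \<psi> (mat_trace y) else 0)" if t: "t \<in> X" for t
    proof -
      have tG: "t \<in> carrier (GL n)" using t X_G by blast
      note tc = GL_carrier_mat[OF tG]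
      have "(\<Sum>x\<in>M - ?H. \<psi> (mat_trace (t * x)))
          = (\<Sum>y\<in>{y\<in>Y. inv\<^bsub>GL n\<^esub> t * y \<in> M}. \<psi> (mat_trace y))"
      proof (rule sum.reindex_bij_witness[where j = "(*) t" and i = "(*) (inv\<^bsub>GL n\<^esub> t)"])
        fix x assume x: "x \<in> M - ?H"
        then have xc: "x \<in> carrier_mat n n" using M by blast
        show "inv\<^bsub>GL n\<^esub> t * (t * x) = x" using GL_inv_cancel[OF tG xc] by simp
        have "t * x \<notin> carrier (GL n)"
        proof
          assume "t * x \<in> carrier (GL n)"
          then have "inv\<^bsub>GL n\<^esub> t * (t * x) \<in> carrier (GL n)" using GL_mult GL_inv(1)[OF tG] by blast
          then show False using x GL_inv_cancel[OF tG xc] by simp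
        qed
        then show "t * x \<in> {y\<in>Y. inv\<^bsub>GL n\<^esub> t * y \<in> M}"
          using x xc tc GL_inv_cancel[OF tG xc] by (simp add: Y_def)
      next
        fix y assume y: "y \<in> {y\<in>Y. inv\<^bsub>GL n\<^esub> t * y \<in> M}"
        then have yc: "y \<in> carrier_mat n n" by (simp add: Y_def)
        show "t * (inv\<^bsub>GL n\<^esub> t * y) = y" using GL_inv_cancel[OF tG yc] by simp
        have "inv\<^bsub>GL n\<^esub> t * y \<notin> carrier (GL n)"
        proof
          assume "inv\<^bsub>GL n\<^esub> t * y \<in> carrier (GL n)"
          then have "t * (inv\<^bsub>GL n\<^esub> t * y) \<in> carrier (GL n)" using GL_mult tG by blast
          then show False using y GL_inv_cancel[OF tG yc] by (simp add: Y_def)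
        qed
        then show "inv\<^bsub>GL n\<^esub> t * y \<in> M - ?H" using y by simp
      qed simp
      then show ?thesis using Y_fin by (simp add: sum.If_cases Int_def)
    qed
    have "(\<Sum>t\<in>X. F v t * (\<Sum>x\<in>M - ?H. \<psi> (mat_trace (t * x))))
        = (\<Sum>t\<in>X. \<Sum>y\<in>Y. if inv\<^bsub>GL n\<^esub> t * y \<in> M then \<psi> (mat_trace y) * F v t else 0)"
      by (auto simp: shift sum_distrib_left intro!: sum.cong)
    also have "\<dots> = (\<Sum>y\<in>Y. \<Sum>t\<in>X. if inv\<^bsub>GL n\<^esub> t * y \<in> M then \<psi> (mat_trace y) * F v t else 0)"
      by (rule sum.swap)
    also have "\<dots> = (\<Sum>y\<in>Y. 0)"
    proof (rule sum.cong[OF refl])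
      fix y assume y: "y \<in> Y"
      have "X \<inter> {g\<in>carrier (GL n). inv\<^bsub>GL n\<^esub> g * y \<in> M} = X \<inter> {t. inv\<^bsub>GL n\<^esub> t * y \<in> M}"
        using X_G by auto
      then show "(\<Sum>t\<in>X. if inv\<^bsub>GL n\<^esub> t * y \<in> M then \<psi> (mat_trace y) * F v t else 0) = 0"
        using singular[of y v] y X_fin
        by (simp add: Y_def sum.If_cases flip: sum_distrib_left)
    qed
    finally have zero: "(\<Sum>t\<in>X. F v t * (\<Sum>x\<in>M - ?H. \<psi> (mat_trace (t * x)))) = 0" by simp
    have "(\<Sum>x\<in>M. \<phi> x) = (\<Sum>x\<in>?H. \<phi> x) + (\<Sum>x\<in>M - ?H. \<phi> x)" for \<phi> :: "'k mat \<Rightarrow> 'r"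
      using M_fin by (simp add: sum.subset_diff[of ?H M] add.commute)
    then show ?thesis using zero by (simp add: distrib_left sum.distrib)
  qed
  also have "\<dots> = (\<Sum>t\<in>X. F v t * (if t \<in> (*) w ` M then s else 0))"
    using X_mat by (intro sum.cong) (simp_all add: orth)
  also have "\<dots> = (\<Sum>t\<in>X. if t = rep w then s * F v w else 0)"
  proof (rule sum.cong[OF refl])
    fix t assume t: "t \<in> X"
    then obtain g where g: "g \<in> carrier (GL n)" "t = rep g" by (auto simp: X_def)
    have tG: "t \<in> carrier (GL n)" using t X_G by blast
    \<comment> \<open>An invertible t in wM lies in wH, because w^-1 t is in M and invertible; the
      only representative in this coset is \<open>rep w\<close>.\<close>
    have "t \<in> (*) w ` M \<longleftrightarrow> t = rep w"
    proof
      assume "t \<in> (*) w ` M"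
      then obtain x where x: "x \<in> M" "t = w * x" by blast
      then have "x = inv\<^bsub>GL n\<^esub> w * t" using GL_inv_cancel[OF w, of x n] M by auto
      then have "x \<in> ?H" using x GL_mult GL_inv(1)[OF w] tG by blast
      then have "rep t = rep w" using rep(2)[OF w] x by simp
      moreover have "rep t = t" using g rep by force
      ultimately show "t = rep w" by simp
    next
      assume "t = rep w"
      then show "t \<in> (*) w ` M" using rep(1)[OF w] by auto
    qed
    then show "F v t * (if t \<in> (*) w ` M then s else 0) = (if t = rep w then s * F v w else 0)"
      using F_rep[OF w] by simp
  qed
  also have "\<dots> = s * F v w" using w X_fin by (simp add: X_def)
  finally show ?thesis using s by (simp add: F_def)
qed

end

section \<open>Additive characters\<close>

lemma units_class_ring [simp]: "carrier (units_of class_ring) = {x :: 'r::field. x \<noteq> 0}"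
proof -
  have "\<exists>y. y * x = 1 \<and> x * y = 1" if "x \<noteq> 0" for x :: 'r
    using that by (intro exI[of _ "inverse x"]) simp
  then show ?thesis by (auto simp: units_of_def Units_def)
qed

lemma mult_units_class_ring [simp]: "x \<otimes>\<^bsub>units_of class_ring\<^esub> y = x * (y :: 'r::field)"
  by (simp add: units_of_def)

lemma nontrivial_additive_characterD:
  assumes "nontrivial_additive_character A \<psi>"
  shows "\<And>x y. x \<in> A \<Longrightarrow> y \<in> A \<Longrightarrow> \<psi> (x + y) = \<psi> x * \<psi> y" "\<And>x. x \<in> A \<Longrightarrow> \<psi> x \<noteq> 0"
    "\<exists>x\<in>A. \<psi> x \<noteq> 1"
  using assms by (auto simp: nontrivial_additive_character_def characters_def hom_def Pi_iff)

lemma nontrivial_additive_characterI: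
  assumes "\<And>x y. x \<in> A \<Longrightarrow> y \<in> A \<Longrightarrow> \<psi> (x + y) = \<psi> x * \<psi> y" "\<And>x. x \<in> A \<Longrightarrow> \<psi> x \<noteq> 0"
    "\<exists>x\<in>A. \<psi> x \<noteq> 1"
  shows "nontrivial_additive_character A \<psi>"
  using assms by (auto simp: nontrivial_additive_character_def characters_def hom_def Pi_iff)

section \<open>The order of k in R and the existence of additive characters\<close>

lemma prime_CHAR_finite_field: "prime CHAR('k::{finite,field})"
  by (intro prime_CHAR_semidom finite_imp_CHAR_pos) simp

text \<open>If the characteristic r of R divided |k|, it would be a prime, and Cauchy's theorem
  would give x \<noteq> 0 in k with rx = 0; then the characteristic of k divides r and equals it.
  This makes |M| invertible in R.\<close>

lemma of_nat_card_field_nonzero: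
  assumes "CHAR('r::field) \<noteq> CHAR('k::{finite,field})"
  shows "of_nat (card (UNIV :: 'k::{finite,field} set)) \<noteq> (0 :: 'r::field)"
proof
  assume "of_nat (card (UNIV :: 'k set)) = (0 :: 'r)"
  then have dvd: "CHAR('r) dvd card (UNIV :: 'k set)" by (simp add: of_nat_eq_0_iff_char_dvd)
  moreover have "card (UNIV :: 'k set) > 0" by (simp add: card_gt_0_iff)
  ultimately have "CHAR('r) > 0" by (auto intro: Nat.gr0I)
  then have r: "prime CHAR('r)" by (rule prime_CHAR_semidom)
  define G where "G = \<lparr>carrier = (UNIV :: 'k set), monoid.mult = (+), one = (0 :: 'k)\<rparr>"
  have G: "group G"
    by (rule groupI) (auto simp: G_def add.assoc intro: exI[of _ "- _"])
  interpret group G by (rule G)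
  \<comment> \<open>Sylow's theorem with exponent 1 is Cauchy's theorem; \<open>G\<close> is the
    additive group of k written multiplicatively.\<close>
  obtain m where "card (UNIV :: 'k set) = CHAR('r) ^ 1 * m" using dvd by auto
  then have "Coset.order G = CHAR('r) ^ 1 * m" by (simp add: Coset.order_def G_def)
  moreover have "finite (carrier G)" by (simp add: G_def)
  ultimately obtain H where H: "subgroup H G" "card H = CHAR('r) ^ 1"
    using sylow_thm[OF r G] by blast
  have "card H > 1" using H prime_gt_1_nat[OF r] by simp
  then obtain x where x: "x \<in> H" "x \<noteq> 0"
    by (metis card_le_Suc0_iff_eq card.infinite linorder_not_less not_less_zero
        One_nat_def)
  have pow: "x [^]\<^bsub>G\<lparr>carrier := H\<rparr>\<^esub> (j::nat) = of_nat j * x" for j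
    by (induction j) (simp_all add: G_def algebra_simps)
  have "x [^]\<^bsub>G\<lparr>carrier := H\<rparr>\<^esub> Coset.order (G\<lparr>carrier := H\<rparr>) = \<one>\<^bsub>G\<lparr>carrier := H\<rparr>\<^esub>"
    by (rule group.pow_order_eq_1[OF subgroup_imp_group[OF H(1)]]) (simp add: x)
  then have "of_nat (CHAR('r)) * x = 0"
    unfolding pow by (simp add: Coset.order_def H G_def)
  then have "CHAR('k) dvd CHAR('r)" using x by (simp add: of_nat_eq_0_iff_char_dvd)
  then show False
    using primes_dvd_imp_eq[OF prime_CHAR_finite_field r] assms by metis
qed

text \<open>A root of 1 + X + ... + X^(p-1) works: at 1 this polynomial has the value p, which is
  non-zero in R.\<close>

lemma primitive_root_of_unity:
  assumes "CHAR('r::alg_closed_field) \<noteq> p" "prime p"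
  obtains \<zeta> :: "'r::alg_closed_field" where "\<zeta> ^ p = 1" "\<zeta> \<noteq> 1"
proof -
  have p: "p > 1" using assms prime_gt_1_nat by blast
  then obtain \<zeta> :: 'r where z: "(\<Sum>k\<le>p - 1. \<zeta> ^ k) = 0"
    using alg_closed[of "p - 1" "\<lambda>_. 1"] by auto
  have "{..p - 1} = {..<p}" using p by auto
  with z have z: "(\<Sum>k<p. \<zeta> ^ k) = 0" by (simp only:)
  have "\<zeta> ^ p - 1 = (\<zeta> - 1) * (\<Sum>k<p. \<zeta> ^ k)" by (rule power_diff_1_eq)
  then have "\<zeta> ^ p = 1" using z by simp
  moreover have "\<zeta> \<noteq> 1"
  proof
    assume "\<zeta> = 1"
    then have "of_nat p = (0::'r)" using z by simp
    then have "CHAR('r) dvd p" by (simp add: of_nat_eq_0_iff_char_dvd)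
    then show False using assms by (auto simp: prime_nat_iff)
  qed
  ultimately show ?thesis using that by blast
qed

text \<open>A maximal proper additive submonoid \<open>B\<close> of k plays the part of a hyperplane
  over the prime field: with x outside B every element is b + jx, and its character value is
  \<zeta>^j. Existence matters because the character of the normalizer is built from one gamma
  factor before any \<psi> is given.\<close>

lemma ex_nontrivial_additive_character:
  assumes "CHAR('r::alg_closed_field) \<noteq> CHAR('k::{finite,field})"
  shows "\<exists>\<psi> :: 'k::{finite,field} \<Rightarrow> 'r::alg_closed_field. nontrivial_additive_character UNIV \<psi>"
proof -
  define p where "p = CHAR('k)"
  have p: "prime p" unfolding p_def by (rule prime_CHAR_finite_field)
  obtain \<zeta> :: 'r where \<zeta>: "\<zeta> ^ p = 1" "\<zeta> \<noteq> 1"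
    using primitive_root_of_unity[of p] assms p p_def by blast
  define \<S> where "\<S> = {B :: 'k set. 0 \<in> B \<and> (\<forall>x\<in>B. \<forall>y\<in>B. x + y \<in> B) \<and> B \<noteq> UNIV}"
  have "{0} \<in> \<S>"
  proof -
    have "(1::'k) \<notin> {0}" by simp
    then have "{0} \<noteq> (UNIV :: 'k set)" by blast
    then show ?thesis by (simp add: \<S>_def)
  qed
  moreover have "finite \<S>" by simp
  ultimately obtain B where B: "B \<in> \<S>" and max: "\<And>C. C \<in> \<S> \<Longrightarrow> B \<subseteq> C \<Longrightarrow> C = B"
    using finite_has_maximal[of \<S>] by (metis empty_iff)
  then obtain x where x: "x \<notin> B" by (auto simp: \<S>_def)
  have B_add: "a + b \<in> B" if "a \<in> B" "b \<in> B" for a b using B that by (simp add: \<S>_def)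
  have B_mult: "of_nat j * a \<in> B" if "a \<in> B" for j a
    using B B_add that by (induction j) (auto simp: \<S>_def algebra_simps)
  have p0: "of_nat p = (0::'k)" by (simp add: p_def)
  \<comment> \<open>In characteristic p, -a is the multiple (p-1)a, so a submonoid is a
    subgroup.\<close>
  have B_uminus: "- a \<in> B" if "a \<in> B" for a
  proof -
    have "of_nat (p - 1) * a = - a"
      using p0 p prime_gt_0_nat[OF p] by (simp add: Suc_leI)
    then show ?thesis using B_mult[OF that, of "p - 1"] by simp
  qed
  define C where "C = {b + of_nat j * x | b j. b \<in> B}"
  have "C = UNIV"
  proof (rule ccontr)
    assume "C \<noteq> UNIV"
    moreover have "u + v \<in> C" if uv: "u \<in> C" "v \<in> C" for u v
    proof -
      obtain b j b' j' where "b \<in> B" "b' \<in> B" "u = b + of_nat j * x" "v = b' + of_nat j' * x"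
        using uv by (auto simp: C_def)
      then show ?thesis
        unfolding C_def by (intro CollectI exI[of _ "b + b'"] exI[of _ "j + j'"])
          (simp add: B_add algebra_simps)
    qed
    moreover have BC: "B \<subseteq> C"
    proof
      fix b assume "b \<in> B"
      then show "b \<in> C" unfolding C_def by (intro CollectI exI[of _ b] exI[of _ 0]) simp
    qed
    moreover have "0 \<in> C" using B BC by (auto simp: \<S>_def)
    ultimately have "C = B" using max by (simp add: \<S>_def)
    moreover have "x \<in> C"
      unfolding C_def using B by (intro CollectI exI[of _ 0] exI[of _ 1]) (simp add: \<S>_def)
    ultimately show False using x by simp
  qed
  \<comment> \<open>If jx and j'x agree modulo B then p divides j' - j, since otherwise an inverse
    of j' - j modulo p would put x into B. The order j \<le> j' keeps the difference a natural
    number.\<close>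
  have aux: "\<zeta> ^ j = \<zeta> ^ j'"
    if eq: "b + of_nat j * x = b' + of_nat j' * x" and b: "b \<in> B" "b' \<in> B" and le: "j \<le> j'" for b b' j j'
  proof -
    have "of_nat (j' - j) * x = b + - b'"
      using eq le by (simp add: algebra_simps)
    then have inB: "of_nat (j' - j) * x \<in> B" using b B_add B_uminus by (simp only:)
    have "p dvd j' - j"
    proof (rule ccontr)
      assume "\<not> p dvd j' - j"
      then have "of_nat (j' - j) \<noteq> (0::'k)" by (simp only: of_nat_eq_0_iff_char_dvd p_def not_False_eq_True)
      have "coprime (j' - j) p"
        using p \<open>\<not> p dvd j' - j\<close> by (simp add: prime_imp_coprime coprime_commute)
      then obtain e where "[(j' - j) * e = 1] (mod p)"
        using cong_solve_coprime_nat[of "j' - j" p] by auto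
      then have "of_nat ((j' - j) * e) = (of_nat 1 :: 'k)"
        by (subst of_nat_eq_iff_cong_CHAR) (simp add: p_def)
      then have "of_nat e * (of_nat (j' - j) * x) = x"
        by (simp add: mult.assoc[symmetric] mult.commute del: of_nat_diff)
      then show False using B_mult[OF inB, of e] x by (simp only:)
    qed
    then obtain d where "j' = j + p * d" using le by (metis dvdE le_add_diff_inverse)
    then show ?thesis using \<zeta> by (simp add: power_add power_mult)
  qed
  have wd: "\<zeta> ^ j = \<zeta> ^ j'"
    if "b + of_nat j * x = b' + of_nat j' * x" "b \<in> B" "b' \<in> B" for b b' j j'
  proof (cases "j \<le> j'")
    case True
    then show ?thesis by (rule aux[OF that])
  next
    case False
    then have "j' \<le> j" by simp
    then show ?thesis by (rule aux[OF that(1)[symmetric] that(3,2), symmetric])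
  qed
  define J where "J y = (SOME j. \<exists>b\<in>B. y = b + of_nat j * x)" for y
  have J: "\<exists>b\<in>B. y = b + of_nat (J y) * x" for y
  proof -
    have "\<exists>j. \<exists>b\<in>B. y = b + of_nat j * x" using \<open>C = UNIV\<close> unfolding C_def by blast
    then show ?thesis unfolding J_def by (rule someI_ex)
  qed
  define \<psi> where "\<psi> y = \<zeta> ^ J y" for y
  have \<psi>: "\<psi> (b + of_nat j * x) = \<zeta> ^ j" if "b \<in> B" for b j
  proof -
    obtain c where "c \<in> B" "b + of_nat j * x = c + of_nat (J (b + of_nat j * x)) * x"
      using J by blast
    from wd[OF this(2) that this(1)] show ?thesis by (simp add: \<psi>_def)
  qed
  have "\<psi> (y + z) = \<psi> y * \<psi> z" for y z
  proof -
    obtain b c where bc: "b \<in> B" "c \<in> B" "y = b + of_nat (J y) * x" "z = c + of_nat (J z) * x"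
      using J[of y] J[of z] by blast
    have "y + z = (b + of_nat (J y) * x) + (c + of_nat (J z) * x)"
      using arg_cong2[OF bc(3,4), of "(+)"] .
    then have "y + z = (b + c) + of_nat (J y + J z) * x" by (simp only: of_nat_add) (simp add: algebra_simps)
    then have "\<psi> (y + z) = \<zeta> ^ (J y + J z)" by (simp only: \<psi>[OF B_add[OF bc(1,2)]])
    then show ?thesis by (simp add: \<psi>_def power_add)
  qed
  moreover have "\<psi> y \<noteq> 0" for y
    using \<zeta> prime_gt_0_nat[OF p] by (auto simp: \<psi>_def power_0_left)
  moreover have "\<psi> x = \<zeta>" using \<psi>[of 0 1] B by (simp add: \<S>_def)
  ultimately have "nontrivial_additive_character UNIV \<psi>"
    using \<zeta>(2) by (intro nontrivial_additive_characterI) auto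
  then show ?thesis by blast
qed

section \<open>Orthogonality of characters and units of finite matrix monoids\<close>

text \<open>Translation by some z with \<chi>(z) \<noteq> 1 is injective on the finite set M, hence
  permutes it, and it multiplies the sum by \<chi>(z).\<close>

lemma sum_character:
  fixes \<chi> :: "'k::{finite,field} mat \<Rightarrow> 'r::field"
  assumes M: "M \<subseteq> carrier_mat n n" "\<And>x y. x \<in> M \<Longrightarrow> y \<in> M \<Longrightarrow> x + y \<in> M"
    and \<chi>: "\<And>x y. x \<in> M \<Longrightarrow> y \<in> M \<Longrightarrow> \<chi> (x + y) = \<chi> x * \<chi> y"
  shows "(\<Sum>x\<in>M. \<chi> x) = (if \<forall>x\<in>M. \<chi> x = 1 then of_nat (card M) else 0)"
proof (cases "\<forall>x\<in>M. \<chi> x = 1")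
  case False
  then obtain z where z: "z \<in> M" "\<chi> z \<noteq> 1" by blast
  have fin: "finite M" using M(1) finite_carrier_mat finite_subset by blast
  have inj: "inj_on (\<lambda>x. x + z) M"
  proof (rule inj_onI)
    fix x y assume xy: "x \<in> M" "y \<in> M" "x + z = y + z"
    have c: "x \<in> carrier_mat n n" "y \<in> carrier_mat n n" "z \<in> carrier_mat n n" using xy z M by auto
    show "x = y"
    proof (rule eq_matI)
      fix i j assume "i < dim_row y" "j < dim_col y"
      then show "x $$ (i,j) = y $$ (i,j)"
        using c arg_cong[OF xy(3), of "\<lambda>A. A $$ (i,j)"] by simp
    qed (use c in auto)
  qed
  have "(\<lambda>x. x + z) ` M = M"
    using M(2) z by (intro endo_inj_surj[OF fin _ inj]) auto
  then have "(\<Sum>x\<in>M. \<chi> x) = (\<Sum>x\<in>M. \<chi> (x + z))"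
    using sum.reindex[OF inj, of \<chi>] by simp
  also have "\<dots> = (\<Sum>x\<in>M. \<chi> x) * \<chi> z" using z by (simp add: \<chi> sum_distrib_right)
  finally have "(\<Sum>x\<in>M. \<chi> x) * (1 - \<chi> z) = 0" by (simp add: algebra_simps)
  then show ?thesis using z False by auto
qed simp

text \<open>Multiplication by an invertible g in M is injective on the finite set M, hence onto, so
  1 = gx with x in M: the inverse already lies in M.\<close>

lemma subgroup_units_submonoid:
  fixes M :: "'k::{finite,field} mat set"
  assumes M: "M \<subseteq> carrier_mat n n" "1\<^sub>m n \<in> M" "\<And>x y. x \<in> M \<Longrightarrow> y \<in> M \<Longrightarrow> x * y \<in> M"
  shows "subgroup (M \<inter> carrier (GL n)) (GL n)"
proof -
  have fin: "finite M" using M(1) finite_carrier_mat finite_subset by blast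
  have "inv\<^bsub>GL n\<^esub> g \<in> M" if g: "g \<in> M" "g \<in> carrier (GL n)" for g
  proof -
    have "inj_on ((*) g) M"
      by (rule inj_on_inverseI[of _ "(*) (inv\<^bsub>GL n\<^esub> g)"])
        (use GL_inv_cancel(2)[OF g(2), of _ n] M in auto)
    then have "(*) g ` M = M" using M(3) g by (intro endo_inj_surj[OF fin]) auto
    then obtain x where x: "x \<in> M" "g * x = 1\<^sub>m n" using M(2) by (metis imageE)
    then have "inv\<^bsub>GL n\<^esub> g = x" using g M by (intro GL_inv_eqI) auto
    then show ?thesis using x by simp
  qed
  then show ?thesis
    using M by (intro group.subgroupI[OF group_GL]) (auto simp: GL_mult GL_one GL_inv)
qed

lemma matrix_units_eq:
  fixes M :: "'k::{finite,field} mat set"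
  assumes M: "M \<subseteq> carrier_mat n n" "1\<^sub>m n \<in> M" "\<And>x y. x \<in> M \<Longrightarrow> y \<in> M \<Longrightarrow> x * y \<in> M"
  shows "matrix_units n M = M \<inter> carrier (GL n)"
proof
  show "matrix_units n M \<subseteq> M \<inter> carrier (GL n)"
    using M(1) by (auto simp: matrix_units_def Units_def ring_mat_def carrier_GL)
  show "M \<inter> carrier (GL n) \<subseteq> matrix_units n M"
  proof
    fix g assume g: "g \<in> M \<inter> carrier (GL n)"
    then have "inv\<^bsub>GL n\<^esub> g \<in> M"
      using subgroup.m_inv_closed[OF subgroup_units_submonoid[OF M]] by blast
    then show "g \<in> matrix_units n M"
      using g GL_inv[of g n] by (auto simp: matrix_units_def Units_def ring_mat_def)
  qed
qed

lemma normalizer_GL: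
  assumes "subgroup H (GL n :: 'k::field mat monoid)"
  shows "g \<in> normalizer (GL n) H \<longleftrightarrow>
    g \<in> carrier (GL n) \<and> {g * h * inv\<^bsub>GL n\<^esub> g | h. h \<in> H} = H"
  using subgroup.subset[OF assms]
  by (auto simp: normalizer_def stabilizer_def l_coset_def r_coset_def)

text \<open>The test matrix is c E_ji; pairing with it reads off one entry of \<open>y\<close>,
  which gives non-degeneracy of the trace form.\<close>

lemma mat_trace_elementary:
  fixes y :: "'k::field mat"
  assumes y: "y \<in> carrier_mat n n" and ij: "i < n" "j < n"
  shows "mat_trace (y * mat n n (\<lambda>(a,b). if a = j \<and> b = i then c else 0)) = c * y $$ (i,j)"
proof -
  let ?E = "mat n n (\<lambda>(a,b). if a = j \<and> b = i then c else 0)"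
  have "(y * ?E) $$ (l,l) = (if l = i then c * y $$ (i,j) else 0)" if l: "l < n" for l
  proof -
    have "(y * ?E) $$ (l,l) = (\<Sum>a<n. y $$ (l,a) * (if a = j \<and> l = i then c else 0))"
      using y l by (simp add: scalar_prod_def atLeast0LessThan)
    also have "\<dots> = (\<Sum>a<n. if a = j then (if l = i then c * y $$ (i,j) else 0) else 0)"
      by (intro sum.cong) auto
    finally show ?thesis using ij by simp
  qed
  then have "mat_trace (y * ?E) = (\<Sum>l<n. if l = i then c * y $$ (i,j) else 0)"
    using y by (simp add: mat_trace_def)
  then show ?thesis using ij by simp
qed

section \<open>The centralizer of a square root of a scalar matrix\<close>

lemma smult_smult_mat: "a \<cdot>\<^sub>m (b \<cdot>\<^sub>m A) = (a * b :: 'a::semigroup_mult) \<cdot>\<^sub>m A"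
  by (intro eq_matI) (auto simp: mult.assoc)

lemma one_smult_mat: "(1 :: 'a::monoid_mult) \<cdot>\<^sub>m A = A"
  by (intro eq_matI) auto

text \<open>\<open>J\<close> generates the quadratic algebra whose centralizer in \<open>M\<^sub>n(k)\<close> is the algebra spanned
  by \<open>H\<close>: in the linear case \<open>J = diag(1, -1)\<close>, in the twisted case \<open>J = \<surd>\<alpha>\<close>.\<close>

locale anticommuting_matrices =
  fixes n :: nat and J w :: "'k::{finite,field} mat" and \<alpha> :: 'k
  assumes n_pos: "n > 0" and two: "(2::'k) \<noteq> 0" and \<alpha>: "\<alpha> \<noteq> 0"
    and J: "J \<in> carrier_mat n n" "J * J = \<alpha> \<cdot>\<^sub>m 1\<^sub>m n"
    and w: "w \<in> carrier_mat n n" "w * w = 1\<^sub>m n"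
    and wJ: "w * J = (- 1) \<cdot>\<^sub>m (J * w)"
begin

definition cent :: "'k mat set" where
  "cent = {x \<in> carrier_mat n n. x * J = J * x}"

lemmas assoc = assoc_mult_mat[of _ n n _ n _ n]

lemma cancel_w: "y \<in> carrier_mat n n \<Longrightarrow> w * (w * y) = y"
  using w by (simp flip: assoc)

lemma cancel_J: "y \<in> carrier_mat n n \<Longrightarrow> J * (J * y) = \<alpha> \<cdot>\<^sub>m y"
  using J by (simp add: mult_smult_assoc_mat[of _ n n _ n] flip: assoc)

lemma cancel_J_right: "y \<in> carrier_mat n n \<Longrightarrow> y * J * J = \<alpha> \<cdot>\<^sub>m y"
  using J by (simp add: assoc mult_smult_distrib[of _ n n _ n])

lemma cent_carrier: "cent \<subseteq> carrier_mat n n"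
  by (auto simp: cent_def)

lemma cent_one: "1\<^sub>m n \<in> cent"
  using J by (simp add: cent_def)

lemma cent_J: "J \<in> cent"
  using J by (simp add: cent_def)

lemma cent_mult:
  assumes "x \<in> cent" "y \<in> cent"
  shows "x * y \<in> cent"
proof -
  have c: "x \<in> carrier_mat n n" "y \<in> carrier_mat n n" "x * J = J * x" "y * J = J * y"
    using assms by (auto simp: cent_def)
  have "x * y * J = x * (y * J)" using c(1,2) J by (simp add: assoc)
  also have "\<dots> = x * J * y" unfolding c(4) using c(1,2) J by (simp add: assoc)
  also have "\<dots> = J * (x * y)" unfolding c(3) using c(1,2) J by (simp add: assoc)
  finally show ?thesis using c by (simp add: cent_def)
qed

lemma cent_add: "x \<in> cent \<Longrightarrow> y \<in> cent \<Longrightarrow> x + y \<in> cent"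
  using J by (auto simp: cent_def add_mult_distrib_mat[of _ n n _ _ n] mult_add_distrib_mat[of _ n n _ n])

lemma cent_smult: "x \<in> cent \<Longrightarrow> c \<cdot>\<^sub>m x \<in> cent"
  using J by (auto simp: cent_def mult_smult_distrib[of _ n n _ n] mult_smult_assoc_mat[of _ n n _ n])

lemma w_GL: "w \<in> carrier (GL n)" "inv\<^bsub>GL n\<^esub> w = w"
proof -
  show "w \<in> carrier (GL n)" using w by (intro GL_I[of _ _ w])
  then show "inv\<^bsub>GL n\<^esub> w = w" using w by (intro GL_inv_eqI)
qed

lemma J_GL: "J \<in> carrier (GL n)"
  using J \<alpha> by (intro GL_I[of _ _ "inverse \<alpha> \<cdot>\<^sub>m J"])
    (auto simp: mult_smult_distrib[of _ n n _ n] mult_smult_assoc_mat[of _ n n _ n] smult_smult_mat one_smult_mat)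

text \<open>Left multiplication by the involution \<open>w\<close>, which anticommutes with
  \<open>J\<close>, interchanges the matrices commuting with \<open>J\<close> and those
  anticommuting with it.\<close>

lemma w_image_cent:
  assumes y: "y \<in> carrier_mat n n"
  shows "y \<in> (*) w ` cent \<longleftrightarrow> y * J = (- 1) \<cdot>\<^sub>m (J * y)"
proof
  assume "y \<in> (*) w ` cent"
  then obtain x where x: "x \<in> carrier_mat n n" "x * J = J * x" "y = w * x" by (auto simp: cent_def)
  then have "y * J = (w * J) * x" using w J by (simp add: assoc)
  also have "\<dots> = (- 1) \<cdot>\<^sub>m (J * y)"
    unfolding wJ using w J x by (simp add: assoc mult_smult_assoc_mat[of _ n n _ n])
  finally show "y * J = (- 1) \<cdot>\<^sub>m (J * y)" .
next
  assume a: "y * J = (- 1) \<cdot>\<^sub>m (J * y)"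
  have "w * y * J = (- 1) \<cdot>\<^sub>m (w * J * y)"
    using w J y a by (simp add: assoc mult_smult_distrib[of _ n n _ n])
  also have "\<dots> = J * (w * y)"
    unfolding wJ using w J y
    by (simp add: assoc mult_smult_assoc_mat[of _ n n _ n] smult_smult_mat one_smult_mat)
  finally have "w * y \<in> cent" using w y by (simp add: cent_def)
  then show "y \<in> (*) w ` cent" using cancel_w[OF y] by (metis image_eqI)
qed

text \<open>If y anticommutes with J and x commutes with it, cyclicity of the trace gives \<alpha>
  tr(yx) = tr(JyxJ) = -\<alpha> tr(yx), and 2\<alpha> \<noteq> 0. Conversely, z + \<alpha>^-1 JzJ
  lies in the centralizer for every z, and z \<mapsto> z + \<alpha>^-1 JzJ is self-adjoint for the
  trace form, so it sends y to 0.\<close>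

lemma trace_orthogonal:
  assumes y: "y \<in> carrier_mat n n"
  shows "(\<forall>x\<in>cent. mat_trace (y * x) = 0) \<longleftrightarrow> y * J = (- 1) \<cdot>\<^sub>m (J * y)"
proof
  assume a: "y * J = (- 1) \<cdot>\<^sub>m (J * y)"
  show "\<forall>x\<in>cent. mat_trace (y * x) = 0"
  proof
    fix x assume "x \<in> cent"
    then have x: "x \<in> carrier_mat n n" "x * J = J * x" by (auto simp: cent_def)
    have "\<alpha> * mat_trace (y * x) = mat_trace (J * (J * (y * x)))"
      using x y by (simp add: cancel_J mat_trace_smult[of _ n])
    also have "\<dots> = mat_trace (J * (y * x) * J)"
      using x y J by (intro mat_trace_comm[of _ n n]) auto
    also have "J * (y * x) * J = J * (y * J) * x"
      using x y J by (simp add: assoc)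
    also have "\<dots> = (- 1) \<cdot>\<^sub>m (J * (J * (y * x)))"
      unfolding a using x y J
      by (simp add: assoc mult_smult_assoc_mat[of _ n n _ n] mult_smult_distrib[of _ n n _ n])
    also have "mat_trace \<dots> = - (\<alpha> * mat_trace (y * x))"
      using x y J by (simp add: cancel_J mat_trace_smult[of _ n])
    finally have "2 * (\<alpha> * mat_trace (y * x)) = 0" by simp
    then show "mat_trace (y * x) = 0" using two \<alpha> by simp
  qed
next
  assume a: "\<forall>x\<in>cent. mat_trace (y * x) = 0"
  define \<beta> where "\<beta> = inverse \<alpha>"
  \<comment> \<open>As J^-1 = \<alpha>^-1 J, this is y + JyJ^-1, twice the projection of y to the
    centralizer; its vanishing says that y anticommutes with J.\<close>
  define u where "u = y + \<beta> \<cdot>\<^sub>m (J * y * J)"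
  have u: "u \<in> carrier_mat n n" using y J by (simp add: u_def)
  have tr: "mat_trace (u * z) = 0" if z: "z \<in> carrier_mat n n" for z
  proof -
    have "z + \<beta> \<cdot>\<^sub>m (J * z * J) \<in> cent"
    proof -
      have "(z + \<beta> \<cdot>\<^sub>m (J * z * J)) * J = z * J + J * z"
        using z J cancel_J_right[of "J * z"] \<alpha>
        by (simp add: add_mult_distrib_mat[of _ n n _ _ n] mult_smult_assoc_mat[of _ n n _ n] \<beta>_def smult_smult_mat one_smult_mat)
      also have "\<dots> = J * z + z * J" using z J by (intro comm_add_mat[of _ n n]) auto
      also have "\<dots> = J * (z + \<beta> \<cdot>\<^sub>m (J * z * J))"
        using z J cancel_J[of "z * J"] \<alpha>
        by (simp add: mult_add_distrib_mat[of _ n n _ n] mult_smult_distrib[of _ n n _ n] \<beta>_def smult_smult_mat one_smult_mat assoc)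
      finally show ?thesis using z J by (simp add: cent_def)
    qed
    then have "0 = mat_trace (y * (z + \<beta> \<cdot>\<^sub>m (J * z * J)))" using a by simp
    also have "\<dots> = mat_trace (y * z) + \<beta> * mat_trace (y * (J * z * J))"
      using y z J by (simp add: mult_add_distrib_mat[of _ n n _ n] mult_smult_distrib[of _ n n _ n]
          mat_trace_add[of _ n] mat_trace_smult[of _ n])
    also have "mat_trace (y * (J * z * J)) = mat_trace (y * J * z * J)"
      using y z J by (simp add: assoc)
    also have "\<dots> = mat_trace (J * (y * J * z))"
      using y z J by (intro mat_trace_comm[of _ n n]) auto
    also have "mat_trace (y * z) + \<beta> * mat_trace (J * (y * J * z)) = mat_trace (u * z)"
      using y z J by (simp add: u_def add_mult_distrib_mat[of _ n n _ _ n] mult_smult_assoc_mat[of _ n n _ n]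
          mat_trace_add[of _ n] mat_trace_smult[of _ n] assoc)
    finally show ?thesis by simp
  qed
  have "u $$ (i,j) = 0" if "i < n" "j < n" for i j
    using mat_trace_elementary[OF u that, of 1] tr by simp
  then have "u = 0\<^sub>m n n" using u by (intro eq_matI) auto
  then have "u * J = 0\<^sub>m n n" using J by simp
  moreover have "u * J = y * J + J * y"
    using y J cancel_J_right[of "J * y"] \<alpha>
    by (simp add: u_def add_mult_distrib_mat[of _ n n _ _ n] mult_smult_assoc_mat[of _ n n _ n] \<beta>_def smult_smult_mat one_smult_mat)
  ultimately have z: "y * J + J * y = 0\<^sub>m n n" by simp
  show "y * J = (- 1) \<cdot>\<^sub>m (J * y)"
  proof (rule eq_matI)
    fix i j assume "i < dim_row ((- 1) \<cdot>\<^sub>m (J * y))" "j < dim_col ((- 1) \<cdot>\<^sub>m (J * y))"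
    then have ij: "i < n" "j < n" using J y by auto
    have "(y * J) $$ (i,j) + (J * y) $$ (i,j) = 0"
      using arg_cong[OF z, of "\<lambda>A. A $$ (i,j)"] ij J y by simp
    then show "(y * J) $$ (i,j) = ((- 1) \<cdot>\<^sub>m (J * y)) $$ (i,j)"
      using ij J y by (simp add: eq_neg_iff_add_eq_0)
  qed (use J y in auto)
qed

text \<open>The centralizer is a k-subspace, so a non-zero value tr(yx) could be scaled to any b
  with \<psi>(b) \<noteq> 1. Hence orthogonality for \<psi> of the trace is orthogonality for the
  trace itself.\<close>

lemma character_orthogonal:
  fixes \<psi> :: "'k \<Rightarrow> 'r::field"
  assumes \<psi>: "nontrivial_additive_character UNIV \<psi>" and y: "y \<in> carrier_mat n n"
  shows "(\<Sum>x\<in>cent. \<psi> (mat_trace (y * x))) = (if y \<in> (*) w ` cent then of_nat (card cent) else 0)"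
proof -
  note \<psi>D = nontrivial_additive_characterD[OF \<psi>]
  have "(\<Sum>x\<in>cent. \<psi> (mat_trace (y * x)))
      = (if \<forall>x\<in>cent. \<psi> (mat_trace (y * x)) = 1 then of_nat (card cent) else 0)"
  proof (rule sum_character[OF cent_carrier cent_add])
    fix x z assume "x \<in> cent" "z \<in> cent"
    then have "x \<in> carrier_mat n n" "z \<in> carrier_mat n n" using cent_carrier by auto
    then show "\<psi> (mat_trace (y * (x + z))) = \<psi> (mat_trace (y * x)) * \<psi> (mat_trace (y * z))"
      using y by (simp add: mult_add_distrib_mat[of _ n n _ n] mat_trace_add[of _ n] \<psi>D(1))
  qed
  moreover have "(\<forall>x\<in>cent. \<psi> (mat_trace (y * x)) = 1) \<longleftrightarrow> (\<forall>x\<in>cent. mat_trace (y * x) = 0)"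
  proof
    assume "\<forall>x\<in>cent. mat_trace (y * x) = 0"
    moreover have "\<psi> 0 = 1" using \<psi>D(1)[of 0 0] \<psi>D(2)[of 0] by simp
    ultimately show "\<forall>x\<in>cent. \<psi> (mat_trace (y * x)) = 1" by simp
  next
    assume a: "\<forall>x\<in>cent. \<psi> (mat_trace (y * x)) = 1"
    obtain b where b: "\<psi> b \<noteq> 1" using \<psi>D(3) by blast
    show "\<forall>x\<in>cent. mat_trace (y * x) = 0"
    proof (rule ballI, rule ccontr)
      fix x assume x: "x \<in> cent" and t: "mat_trace (y * x) \<noteq> 0"
      have xc: "x \<in> carrier_mat n n" using x cent_carrier by blast
      have "mat_trace (y * ((b / mat_trace (y * x)) \<cdot>\<^sub>m x)) = b"
        using t y xc by (simp add: mult_smult_distrib[of _ n n _ n] mat_trace_smult[of _ n])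
      then show False using a b cent_smult[OF x] by metis
    qed
  qed
  ultimately show ?thesis using trace_orthogonal[OF y] w_image_cent[OF y] by presburger
qed

section \<open>The normalizer of H\<close>

text \<open>Conjugation by \<open>w\<close> changes the sign of J, so a + bJ = 0 and a - bJ = 0 hold
  together. Adding gives 2a = 0, and then bJ^2 = b\<alpha> gives b = 0.\<close>

lemma one_J_independent:
  assumes "a \<cdot>\<^sub>m 1\<^sub>m n + b \<cdot>\<^sub>m J = 0\<^sub>m n n"
  shows "a = 0 \<and> b = 0"
proof -
  let ?Z = "a \<cdot>\<^sub>m 1\<^sub>m n + b \<cdot>\<^sub>m J"
  have "w * ?Z * w = a \<cdot>\<^sub>m 1\<^sub>m n + b \<cdot>\<^sub>m (w * J * w)"
    using w J by (simp add: mult_add_distrib_mat[of _ n n _ n] add_mult_distrib_mat[of _ n n _ _ n]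
        mult_smult_distrib[of _ n n _ n] mult_smult_assoc_mat[of _ n n _ n])
  also have "w * J * w = (- 1) \<cdot>\<^sub>m J"
    unfolding wJ using w J by (simp add: mult_smult_assoc_mat[of _ n n _ n] assoc)
  also have "w * ?Z * w = 0\<^sub>m n n" using w assms by simp
  finally have neg: "a \<cdot>\<^sub>m 1\<^sub>m n + b \<cdot>\<^sub>m ((- 1) \<cdot>\<^sub>m J) = 0\<^sub>m n n" by simp
  have "2 * a = ?Z $$ (0,0) + (a \<cdot>\<^sub>m 1\<^sub>m n + b \<cdot>\<^sub>m ((- 1) \<cdot>\<^sub>m J)) $$ (0,0)"
    using J n_pos by simp
  then have a0: "a = 0" unfolding neg assms using n_pos two by simp
  have "?Z = b \<cdot>\<^sub>m J" using a0 J by (intro eq_matI) auto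
  then have "?Z * J = (b * \<alpha>) \<cdot>\<^sub>m 1\<^sub>m n"
    using J by (simp add: mult_smult_assoc_mat[of _ n n _ n] smult_smult_mat)
  then have "(b * \<alpha>) \<cdot>\<^sub>m 1\<^sub>m n = (0\<^sub>m n n :: 'k mat)" unfolding assms using J by simp
  from arg_cong[OF this, of "\<lambda>A. A $$ (0,0)"] have "b = 0" using n_pos \<alpha> by simp
  with a0 show ?thesis by simp
qed

abbreviation "H \<equiv> cent \<inter> carrier (GL n)"

lemma subgroup_H: "subgroup H (GL n)"
  by (rule subgroup_units_submonoid[OF cent_carrier cent_one cent_mult])

text \<open>The conjugate gJg^-1 commutes with gHg^-1 = H, so it is a + bJ by the hypothesis on the
  commutant. Its square is \<alpha>, whence a^2 + b^2 \<alpha> = \<alpha> and 2ab = 0, which leaves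
  a = 0 and b = 1 or -1: g commutes or anticommutes with J.\<close>

lemma normalizer_cases:
  assumes commutant: "\<And>A. \<lbrakk>A \<in> carrier_mat n n; \<And>h. h \<in> H \<Longrightarrow> A * h = h * A\<rbrakk>
      \<Longrightarrow> \<exists>a b. A = a \<cdot>\<^sub>m 1\<^sub>m n + b \<cdot>\<^sub>m J"
    and g: "g \<in> normalizer (GL n) H"
  shows "g \<in> H \<or> (\<exists>h\<in>H. g = w * h)"
proof -
  have gG: "g \<in> carrier (GL n)" and gH: "{g * h * inv\<^bsub>GL n\<^esub> g | h. h \<in> H} = H"
    using g normalizer_GL[OF subgroup_H] by auto
  note gc = GL_carrier_mat[OF gG] and gi = GL_inv[OF gG]
  define A where "A = g * J * inv\<^bsub>GL n\<^esub> g"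
  have A: "A \<in> carrier_mat n n" using gc gi J by (simp add: A_def)
  have Ag: "A * g = g * J"
    using GL_inv_cancel_right(2)[OF gG, of "g * J" n] gc J by (simp add: A_def)
  have "\<exists>a b. A = a \<cdot>\<^sub>m 1\<^sub>m n + b \<cdot>\<^sub>m J"
  proof (rule commutant[OF A])
    fix h assume "h \<in> H"
    then obtain x where x: "x \<in> H" "h = g * x * inv\<^bsub>GL n\<^esub> g" using gH by blast
    then have xc: "x \<in> carrier_mat n n" "x * J = J * x" by (auto simp: cent_def)
    have "A * h = A * g * x * inv\<^bsub>GL n\<^esub> g" using A gc gi xc x(2) by (simp add: assoc)
    also have "\<dots> = g * (J * x) * inv\<^bsub>GL n\<^esub> g" unfolding Ag using gc gi xc J by (simp add: assoc)
    also have "\<dots> = g * x * (J * inv\<^bsub>GL n\<^esub> g)" using gc gi xc J by (simp add: assoc flip: xc(2))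
    also have "J * inv\<^bsub>GL n\<^esub> g = inv\<^bsub>GL n\<^esub> g * A"
      using GL_inv_cancel(2)[OF gG, of "J * inv\<^bsub>GL n\<^esub> g" n] gc gi J by (simp add: A_def assoc)
    also have "g * x * (inv\<^bsub>GL n\<^esub> g * A) = h * A" using A gc gi xc x(2) by (simp add: assoc)
    finally show "A * h = h * A" .
  qed
  then obtain a b where ab: "A = a \<cdot>\<^sub>m 1\<^sub>m n + b \<cdot>\<^sub>m J" by blast
  have "A * A = A * (g * J * inv\<^bsub>GL n\<^esub> g)"
    by (simp only: A_def)
  also have "\<dots> = A * g * J * inv\<^bsub>GL n\<^esub> g"
    using A gc gi J by (simp add: assoc)
  also have "\<dots> = g * (J * J) * inv\<^bsub>GL n\<^esub> g" unfolding Ag using gc gi J by (simp add: assoc)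
  also have "\<dots> = \<alpha> \<cdot>\<^sub>m 1\<^sub>m n"
    using gc gi J by (simp add: mult_smult_distrib[of _ n n _ n] mult_smult_assoc_mat[of _ n n _ n])
  finally have AA: "A * A = \<alpha> \<cdot>\<^sub>m 1\<^sub>m n" .
  have "A * A = (a * a + b * b * \<alpha>) \<cdot>\<^sub>m 1\<^sub>m n + (2 * a * b) \<cdot>\<^sub>m J"
  proof -
    have "A * A = a \<cdot>\<^sub>m A + b \<cdot>\<^sub>m (J * A)"
      by (subst (1) ab) (use A J in \<open>simp add: add_mult_distrib_mat[of _ n n _ _ n] mult_smult_assoc_mat[of _ n n _ n]\<close>)
    also have "J * A = a \<cdot>\<^sub>m J + (b * \<alpha>) \<cdot>\<^sub>m 1\<^sub>m n"
      unfolding ab using J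
      by (simp add: mult_add_distrib_mat[of _ n n _ n] mult_smult_distrib[of _ n n _ n] smult_smult_mat one_smult_mat)
    finally show ?thesis
      unfolding ab using J by (intro eq_matI) (auto simp: algebra_simps)
  qed
  then have eq: "\<alpha> \<cdot>\<^sub>m 1\<^sub>m n = (a * a + b * b * \<alpha>) \<cdot>\<^sub>m 1\<^sub>m n + (2 * a * b) \<cdot>\<^sub>m J"
    unfolding AA .
  have "(a * a + b * b * \<alpha> - \<alpha>) \<cdot>\<^sub>m 1\<^sub>m n + (2 * a * b) \<cdot>\<^sub>m J = 0\<^sub>m n n"
  proof (rule eq_matI)
    fix i j assume "i < dim_row (0\<^sub>m n n :: 'k mat)" "j < dim_col (0\<^sub>m n n :: 'k mat)"
    then have ij: "i < n" "j < n" by auto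
    define d where "d = (if i = j then 1 else (0::'k))"
    have entry: "(x \<cdot>\<^sub>m 1\<^sub>m n + y \<cdot>\<^sub>m J) $$ (i,j) = x * d + y * J $$ (i,j)"
      "(x \<cdot>\<^sub>m 1\<^sub>m n) $$ (i,j) = x * d" for x y
      using J(1) ij by (simp_all add: d_def)
    have "\<alpha> * d = (a * a + b * b * \<alpha>) * d + 2 * a * b * J $$ (i,j)"
      using arg_cong[OF eq, of "\<lambda>A. A $$ (i,j)"] unfolding entry .
    then have "(a * a + b * b * \<alpha> - \<alpha>) * d + 2 * a * b * J $$ (i,j) = 0"
      unfolding left_diff_distrib by (subst diff_add_eq) (rule right_minus_eq[THEN iffD2, OF sym])
    then show "((a * a + b * b * \<alpha> - \<alpha>) \<cdot>\<^sub>m 1\<^sub>m n + (2 * a * b) \<cdot>\<^sub>m J) $$ (i,j) = 0\<^sub>m n n $$ (i,j)"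
      unfolding entry using ij by simp
  qed (use J in auto)
  from one_J_independent[OF this] have rel: "a * a + b * b * \<alpha> = \<alpha>" "a * b = 0" using two by auto
  \<comment> \<open>Otherwise gJg^-1, and with it J, would be scalar.\<close>
  have "b \<noteq> 0"
  proof
    assume "b = 0"
    then have "A = a \<cdot>\<^sub>m 1\<^sub>m n" using ab J by (intro eq_matI) auto
    have "J = inv\<^bsub>GL n\<^esub> g * (A * g)" unfolding Ag using GL_inv_cancel(2)[OF gG J(1)] by (rule sym)
    also have "A * g = a \<cdot>\<^sub>m g"
      unfolding \<open>A = a \<cdot>\<^sub>m 1\<^sub>m n\<close> using gc by (simp add: mult_smult_assoc_mat[of _ n n _ n])
    also have "inv\<^bsub>GL n\<^esub> g * (a \<cdot>\<^sub>m g) = a \<cdot>\<^sub>m 1\<^sub>m n"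
      using gc gi by (simp add: mult_smult_distrib[of _ n n _ n])
    finally have Ja: "J = a \<cdot>\<^sub>m 1\<^sub>m n" .
    have "a \<cdot>\<^sub>m 1\<^sub>m n + (- 1) \<cdot>\<^sub>m J = 0\<^sub>m n n" unfolding Ja by (intro eq_matI) auto
    then have "(- 1 :: 'k) = 0" using one_J_independent by blast
    then show False by simp
  qed
  then have "a = 0" "b * b = 1" using rel \<alpha> by auto
  then have "A = b \<cdot>\<^sub>m J" using ab J by (intro eq_matI) auto
  then have gJ: "g * J = b \<cdot>\<^sub>m (J * g)" using Ag J gc by (simp add: mult_smult_assoc_mat[of _ n n _ n])
  have "b = 1 \<or> b = - 1" using \<open>b * b = 1\<close> by (simp add: square_eq_1_iff)
  then show ?thesis
  proof
    assume "b = 1"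
    then show ?thesis using gJ gG gc J by (auto simp: cent_def)
  next
    assume "b = - 1"
    then have "g \<in> (*) w ` cent" using w_image_cent[OF gc] gJ by simp
    then obtain x where x: "x \<in> cent" "g = w * x" by blast
    then have "w * g = x" using cancel_w cent_carrier by auto
    then have "x \<in> carrier (GL n)" using GL_mult[OF w_GL(1) gG] by simp
    with x show ?thesis by blast
  qed
qed

text \<open>Conjugation by \<open>w\<close> sends J to -J, which has the same centralizer; as
  \<open>w\<close> is an involution, one inclusion gives equality.\<close>

lemma w_normalizes: "w \<in> normalizer (GL n) H"
proof -
  have inH: "w * h * w \<in> H" if h: "h \<in> H" for h
  proof -
    have hc: "h \<in> carrier_mat n n" "h * J = J * h" using h by (auto simp: cent_def)
    have "w * h * w * J = w * h * ((- 1) \<cdot>\<^sub>m (J * w))" using w J hc by (simp add: assoc wJ)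
    also have "\<dots> = (- 1) \<cdot>\<^sub>m (w * (h * J) * w)"
      using w J hc(1) by (simp add: assoc mult_smult_distrib[of _ n n _ n])
    also have "\<dots> = (- 1) \<cdot>\<^sub>m (w * J * h * w)" unfolding hc(2) using w J hc(1) by (simp add: assoc)
    also have "\<dots> = J * (w * h * w)"
      unfolding wJ using w J hc by (simp add: assoc mult_smult_assoc_mat[of _ n n _ n] smult_smult_mat one_smult_mat)
    finally show ?thesis using h hc w w_GL by (simp add: cent_def GL_mult)
  qed
  have "{w * h * inv\<^bsub>GL n\<^esub> w | h. h \<in> H} = H"
  proof (intro equalityI subsetI)
    fix x assume x: "x \<in> H"
    then have xc: "x \<in> carrier_mat n n" by (auto simp: cent_def)
    have "x = w * (w * x * w) * w" using w xc cancel_w[of "x"] by (simp add: assoc)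
    then show "x \<in> {w * h * inv\<^bsub>GL n\<^esub> w | h. h \<in> H}" using inH[OF x] w_GL(2) by auto
  qed (use inH w_GL(2) in auto)
  then show ?thesis using normalizer_GL[OF subgroup_H] w_GL(1) by simp
qed

end

section \<open>Distinction by the unit group of a centralizer\<close>

text \<open>The transformation rule says that w = w^-1 acts on every invariant form by
  \<gamma>(\<pi>,\<psi>), whichever non-trivial \<psi> is taken. Together with the decomposition of
  the normalizer into H and wH this determines the character.\<close>

lemma (in cuspidal_GL_rep) centralizer_distinction:
  fixes J w :: "'k mat"
  assumes AM: "anticommuting_matrices n J w \<alpha>"
    and char: "CHAR('r) \<noteq> CHAR('k)"
    and s: "s = (of_nat (card (anticommuting_matrices.cent n J)) :: 'r)" "s \<noteq> 0"
    and H: "H = anticommuting_matrices.cent n J \<inter> carrier (GL n)"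
    and commutant: "\<And>A. \<lbrakk>A \<in> carrier_mat n n; \<And>h. h \<in> H \<Longrightarrow> A * h = h * A\<rbrakk>
      \<Longrightarrow> \<exists>a b. A = a \<cdot>\<^sub>m 1\<^sub>m n + b \<cdot>\<^sub>m J"
    and dist: "distinguished scale \<pi> H"
  shows "\<exists>\<chi> \<in> characters (GL n \<lparr>carrier := normalizer (GL n) H\<rparr>).
    (\<forall>g\<in>normalizer (GL n) H. \<forall>\<Lambda>\<in>invariant_forms scale \<pi> H. \<Lambda> \<circ> \<pi> g = (\<lambda>v. \<chi> g * \<Lambda> v)) \<and>
    (\<forall>\<psi>. nontrivial_additive_character UNIV \<psi> \<longrightarrow> gamma_factor s scale n \<pi> \<psi> = \<chi> w)"
proof -
  interpret anticommuting_matrices n J w \<alpha> by (rule AM)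
  have sub: "subgroup H (GL n)" using subgroup_H H by simp
  interpret N: subgroup "normalizer (GL n) H" "GL n :: 'k mat monoid"
    using group.normalizer_imp_subgroup[OF group_GL subgroup.subset[OF sub]] .
  obtain \<Lambda>\<^sub>0 where \<Lambda>0: "\<Lambda>\<^sub>0 \<in> invariant_forms scale \<pi> H" "\<Lambda>\<^sub>0 \<noteq> (\<lambda>_. 0)"
    using dist by (auto simp: distinguished_def)
  have dual: "\<Lambda> \<in> dual_space scale" if "\<Lambda> \<in> invariant_forms scale \<pi> H" for \<Lambda>
    using that by (simp add: invariant_forms_def)
  have \<Lambda>H: "\<Lambda> (\<pi> h v) = \<Lambda> v" if "\<Lambda> \<in> invariant_forms scale \<pi> H" "h \<in> H" for \<Lambda> h v
    using that unfolding invariant_forms_def by (metis (mono_tags, lifting) comp_apply mem_Collect_eq)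
  have \<Lambda>w: "\<Lambda> (\<pi> w v) = gamma_factor s scale n \<pi> \<psi> * \<Lambda> v"
    if \<Lambda>: "\<Lambda> \<in> invariant_forms scale \<pi> H" and \<psi>: "nontrivial_additive_character UNIV \<psi>" for \<Lambda> \<psi> v
  proof -
    have "\<Lambda> (\<pi> (inv\<^bsub>GL n\<^esub> w) v)
      = inverse s * (\<Sum>g\<in>carrier (GL n). \<psi> (mat_trace g) * \<Lambda> (\<pi> (inv\<^bsub>GL n\<^esub> g) v))"
      using \<Lambda> s character_orthogonal[OF \<psi>]
      by (intro invariant_form_transform[symmetric, OF cent_carrier cent_one cent_mult subgroup_H w_GL(1)])
        (auto simp: H)
    then show ?thesis using gamma_factor_eq[OF dual[OF \<Lambda>0(1)] \<Lambda>0(2) dual[OF \<Lambda>]] w_GL(2) by simp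
  qed
  obtain \<psi>\<^sub>0 :: "'k \<Rightarrow> 'r" where \<psi>0: "nontrivial_additive_character UNIV \<psi>\<^sub>0"
    using ex_nontrivial_additive_character[OF char] by blast
  define c where "c = gamma_factor s scale n \<pi> \<psi>\<^sub>0"
  \<comment> \<open>On the normalizer the second case is the coset wH; values outside the normalizer
    carry no meaning.\<close>
  define \<chi> where "\<chi> g = (if g \<in> H then 1 else c)" for g
  have "w \<notin> H"
  proof
    assume "w \<in> H"
    \<comment> \<open>If w were in H, then 1 = ww would lie in wM and anticommute with J, so that J
      = -J = 0.\<close>
    then have "1\<^sub>m n \<in> (*) w ` cent" using w by (auto simp: H cent_def intro!: image_eqI[of _ _ w])
    then have "J = (- 1) \<cdot>\<^sub>m J" using w_image_cent[of "1\<^sub>m n"] J by simp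
    then have "J $$ (i,j) = - J $$ (i,j)" if "i < n" "j < n" for i j
      using that J arg_cong[of J _ "\<lambda>A. A $$ (i,j)"] by (metis carrier_matD index_smult_mat(1) mult_minus1)
    then have "2 * J $$ (i,j) = 0" if "i < n" "j < n" for i j
      using that by (metis mult_2 add.right_inverse)
    then have "J = 0\<^sub>m n n" using J two by (intro eq_matI) auto
    then have "1 \<cdot>\<^sub>m J + 0 \<cdot>\<^sub>m 1\<^sub>m n = 0\<^sub>m n n \<and> 0 \<cdot>\<^sub>m 1\<^sub>m n + 1 \<cdot>\<^sub>m J = 0\<^sub>m n n" using J by auto
    then show False using one_J_independent[of 0 1] by simp
  qed
  have act: "\<Lambda> (\<pi> g v) = \<chi> g * \<Lambda> v"
    if g: "g \<in> normalizer (GL n) H" and \<Lambda>: "\<Lambda> \<in> invariant_forms scale \<pi> H" for g \<Lambda> v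
  proof (cases "g \<in> H")
    case True
    then show ?thesis using \<Lambda>H[OF \<Lambda>] by (simp add: \<chi>_def)
  next
    case False
    then obtain h where h: "h \<in> H" "g = w * h"
      using normalizer_cases[OF commutant] g H by blast
    then have "\<Lambda> (\<pi> g v) = c * \<Lambda> v"
      using \<Lambda>w[OF \<Lambda> \<psi>0] \<Lambda>H[OF \<Lambda>] w_GL(1) by (simp add: rep_comp H c_def)
    then show ?thesis using False by (simp add: \<chi>_def)
  qed
  obtain v where v: "\<Lambda>\<^sub>0 v \<noteq> 0" using \<Lambda>0 by auto
  have \<chi>_mult: "\<chi> (g * h) = \<chi> g * \<chi> h"
    if "g \<in> normalizer (GL n) H" "h \<in> normalizer (GL n) H" for g h
  proof -
    have G: "g \<in> carrier (GL n)" "h \<in> carrier (GL n)" using that N.subset by auto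
    \<comment> \<open>Evaluation at a vector where the form is non-zero gives multiplicativity
      without separating the cosets of H.\<close>
    have "\<chi> (g * h) * \<Lambda>\<^sub>0 v = \<Lambda>\<^sub>0 (\<pi> (g * h) v)"
      using act[OF _ \<Lambda>0(1), of "g * h" v] N.m_closed[OF that] by simp
    also have "\<dots> = \<chi> g * \<chi> h * \<Lambda>\<^sub>0 v"
      using that by (simp add: rep_comp G act[OF _ \<Lambda>0(1)])
    finally show ?thesis using v by simp
  qed
  have wN: "w \<in> normalizer (GL n) H" using w_normalizes H by simp
  \<comment> \<open>Because \<open>w\<close> is an involution outside H, c^2 = 1, so
    \<open>c\<close> is a unit as the values of a character must be.\<close>
  have "\<chi> w * \<chi> w = \<chi> (1\<^sub>m n)" using \<chi>_mult[OF wN wN] w by simp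
  also have "\<dots> = 1" using cent_one by (simp add: \<chi>_def H GL_one)
  finally have "c \<noteq> 0" using \<open>w \<notin> H\<close> by (auto simp: \<chi>_def)
  then have "\<chi> \<in> characters (GL n \<lparr>carrier := normalizer (GL n) H\<rparr>)"
    using \<chi>_mult by (simp add: characters_def hom_def \<chi>_def)
  moreover have "gamma_factor s scale n \<pi> \<psi> = \<chi> w" if "nontrivial_additive_character UNIV \<psi>" for \<psi>
    using \<Lambda>w[OF \<Lambda>0(1) that, of v] act[OF wN \<Lambda>0(1), of v] v by simp
  ultimately show ?thesis using act by (intro bexI[of _ \<chi>]) (auto simp: fun_eq_iff)
qed

section \<open>Block matrices\<close>

lemma four_block_cases:
  assumes "X \<in> carrier_mat (m + m) (m + m)"
  obtains A B C D where "A \<in> carrier_mat m m" "B \<in> carrier_mat m m" "C \<in> carrier_mat m m"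
    "D \<in> carrier_mat m m" "X = four_block_mat A B C D"
proof
  let ?A = "mat m m (\<lambda>(i,j). X $$ (i,j))" and ?B = "mat m m (\<lambda>(i,j). X $$ (i,j + m))"
    and ?C = "mat m m (\<lambda>(i,j). X $$ (i + m,j))" and ?D = "mat m m (\<lambda>(i,j). X $$ (i + m,j + m))"
  show "?A \<in> carrier_mat m m" "?B \<in> carrier_mat m m" "?C \<in> carrier_mat m m" "?D \<in> carrier_mat m m"
    by simp_all
  show "X = four_block_mat ?A ?B ?C ?D"
    using assms by (intro eq_matI) auto
qed

lemma four_block_eq_iff:
  assumes "A \<in> carrier_mat m m" "B \<in> carrier_mat m m" "C \<in> carrier_mat m m" "D \<in> carrier_mat m m"
    "A' \<in> carrier_mat m m" "B' \<in> carrier_mat m m" "C' \<in> carrier_mat m m" "D' \<in> carrier_mat m m"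
  shows "four_block_mat A B C D = four_block_mat A' B' C' D'
    \<longleftrightarrow> A = A' \<and> B = B' \<and> C = C' \<and> D = D'"
proof
  assume eq: "four_block_mat A B C D = four_block_mat A' B' C' D'"
  have "A $$ (i,j) = A' $$ (i,j) \<and> B $$ (i,j) = B' $$ (i,j) \<and> C $$ (i,j) = C' $$ (i,j)
      \<and> D $$ (i,j) = D' $$ (i,j)" if "i < m" "j < m" for i j
    using arg_cong[OF eq, of "\<lambda>X. X $$ (i,j)"] arg_cong[OF eq, of "\<lambda>X. X $$ (i,j + m)"]
      arg_cong[OF eq, of "\<lambda>X. X $$ (i + m,j)"] arg_cong[OF eq, of "\<lambda>X. X $$ (i + m,j + m)"]
      that assms by simp
  then show "A = A' \<and> B = B' \<and> C = C' \<and> D = D'"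
    using assms by (intro conjI eq_matI) auto
qed simp

lemma four_block_eq_one_iff:
  assumes "A \<in> carrier_mat m m" "D \<in> carrier_mat m m"
  shows "four_block_mat A (0\<^sub>m m m) (0\<^sub>m m m) D = 1\<^sub>m (m + m) \<longleftrightarrow> A = 1\<^sub>m m \<and> D = 1\<^sub>m m"
  unfolding four_block_one_mat[symmetric] by (subst four_block_eq_iff[of _ m]) (use assms in simp_all)

text \<open>Only invertible test matrices are available, and the transvections 1 + E_ij suffice:
  comparing entries (p,j) of Ag and gA shows that A_pi is 0 for p \<noteq> i and A_jj for p =
  i.\<close>

lemma scalar_commutant:
  fixes A :: "'k::field mat"
  assumes A: "A \<in> carrier_mat m m" and comm: "\<And>g. g \<in> carrier (GL m) \<Longrightarrow> A * g = g * A"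
  obtains c where "A = c \<cdot>\<^sub>m 1\<^sub>m m"
proof -
  have key: "A $$ (p,i) = (if p = i then A $$ (j,j) else 0)"
    if "p < m" "i < m" "j < m" "i \<noteq> j" for p i j
  proof -
    define g where "g = addrow_mat m (1::'k) i j"
    have "g \<in> carrier (GL m)"
      using addrow_mat_inv[OF that(2,3,4), of "1::'k"] addrow_mat_inv[OF that(2,3,4), of "- 1::'k"]
      by (intro GL_I[of _ _ "addrow_mat m (- 1) i j"]) (auto simp: g_def)
    then have eq: "A * g = g * A" by (rule comm)
    have "(A * g) $$ (p,j) = (\<Sum>l<m. A $$ (p,l) * g $$ (l,j))"
      using that A by (simp add: g_def scalar_prod_def atLeast0LessThan)
    also have "\<dots> = (\<Sum>l<m. (if l = j then A $$ (p,l) else 0) + (if l = i then A $$ (p,l) else 0))"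
      using that by (intro sum.cong) (auto simp: g_def addrow_mat_def)
    also have "\<dots> = A $$ (p,j) + A $$ (p,i)" using that by (simp add: sum.distrib)
    finally have 1: "(A * g) $$ (p,j) = A $$ (p,j) + A $$ (p,i)" .
    have "(g * A) $$ (p,j) = (\<Sum>l<m. g $$ (p,l) * A $$ (l,j))"
      using that A by (simp add: g_def scalar_prod_def atLeast0LessThan)
    also have "\<dots> = (\<Sum>l<m. (if l = p then A $$ (l,j) else 0)
        + (if l = j then (if p = i then A $$ (l,j) else 0) else 0))"
      using that by (intro sum.cong) (auto simp: g_def addrow_mat_def)
    also have "\<dots> = A $$ (p,j) + (if p = i then A $$ (j,j) else 0)"
      using that by (simp add: sum.distrib)
    finally show ?thesis using 1 eq by simp
  qed
  have "A = A $$ (0,0) \<cdot>\<^sub>m 1\<^sub>m m"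
  proof (rule eq_matI)
    fix p i assume "p < dim_row (A $$ (0,0) \<cdot>\<^sub>m 1\<^sub>m m)" "i < dim_col (A $$ (0,0) \<cdot>\<^sub>m 1\<^sub>m m)"
    then have pi: "p < m" "i < m" by auto
    \<comment> \<open>Off the diagonal the auxiliary index is j = p; on the diagonal j = 0 compares
      A_ii with A_00.\<close>
    have "A $$ (p,i) = (if p = i then A $$ (0,0) else 0)"
      using key[of p i 0] key[of p i p] pi by (cases "p = i"; cases "i = 0") auto
    then show "A $$ (p,i) = (A $$ (0,0) \<cdot>\<^sub>m 1\<^sub>m m) $$ (p,i)" using pi by simp
  qed (use A in auto)
  then show ?thesis using that by blast
qed

lemma four_block_diag_GL:
  fixes A :: "'k::field mat"
  assumes "A \<in> carrier (GL m)" "D \<in> carrier (GL m)"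
  shows "four_block_mat A (0\<^sub>m m m) (0\<^sub>m m m) D \<in> carrier (GL (m + m))"
proof (rule GL_I)
  let ?i = "four_block_mat (inv\<^bsub>GL m\<^esub> A) (0\<^sub>m m m) (0\<^sub>m m m) (inv\<^bsub>GL m\<^esub> D)"
  note c = GL_carrier_mat[OF assms(1)] GL_carrier_mat[OF assms(2)] GL_inv[OF assms(1)] GL_inv[OF assms(2)]
  show "four_block_mat A (0\<^sub>m m m) (0\<^sub>m m m) D * ?i = 1\<^sub>m (m + m)"
    "?i * four_block_mat A (0\<^sub>m m m) (0\<^sub>m m m) D = 1\<^sub>m (m + m)"
    using c by (simp_all add: mult_four_block_mat[of _ m m _ m _ m _ _ m _ m])
qed (use assms GL_carrier_mat GL_inv in \<open>auto intro!: four_block_carrier_mat\<close>)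

text \<open>Commuting with diag(g,g) means that every block commutes with g. These matrices belong
  to H in both the linear and the twisted case.\<close>

lemma block_commutant:
  fixes A B C D :: "'k::field mat"
  assumes c: "A \<in> carrier_mat m m" "B \<in> carrier_mat m m" "C \<in> carrier_mat m m" "D \<in> carrier_mat m m"
    and comm: "\<And>g. g \<in> carrier (GL m) \<Longrightarrow>
      four_block_mat A B C D * four_block_mat g (0\<^sub>m m m) (0\<^sub>m m m) g
      = four_block_mat g (0\<^sub>m m m) (0\<^sub>m m m) g * four_block_mat A B C D"
  shows "\<exists>a b c d. A = a \<cdot>\<^sub>m 1\<^sub>m m \<and> B = b \<cdot>\<^sub>m 1\<^sub>m m \<and> C = c \<cdot>\<^sub>m 1\<^sub>m m \<and> D = d \<cdot>\<^sub>m 1\<^sub>m m"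
proof -
  have "A * g = g * A \<and> B * g = g * B \<and> C * g = g * C \<and> D * g = g * D" if g: "g \<in> carrier (GL m)" for g
    using comm[OF g] GL_carrier_mat[OF g] c
    by (simp add: mult_four_block_mat[of _ m m _ m _ m _ _ m _ m] four_block_eq_iff[of _ m])
  then show ?thesis
    using scalar_commutant[OF c(1)] scalar_commutant[OF c(2)] scalar_commutant[OF c(3)]
      scalar_commutant[OF c(4)] by metis
qed

text \<open>Both algebras are parametrized by pairs of m x m matrices, so each has |k|^(2m^2)
  elements, the positive square root of |k|^(4m^2).\<close>

lemma card_block_image:
  assumes "inj_on f (carrier_mat m m \<times> carrier_mat m m)"
  shows "card (f ` (carrier_mat m m \<times> carrier_mat m m :: ('k::{finite,field} mat \<times> 'k mat) set))
    = card (UNIV :: 'k set) ^ (2 * m\<^sup>2)"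
proof -
  have "card (carrier_mat m m :: 'k mat set) = card (UNIV :: 'k set) ^ (m * m)"
    using card_mats_over[of "UNIV :: 'k set" m] by (simp add: mats_over_UNIV)
  then show ?thesis
    using assms by (simp add: card_image card_cartesian_product power2_eq_square mult_2 flip: power_add)
qed

section \<open>The two matrices J, their centralizers and commutants\<close>

definition J_linear :: "nat \<Rightarrow> 'k::field mat" where
  "J_linear m = four_block_mat (1\<^sub>m m) (0\<^sub>m m m) (0\<^sub>m m m) ((- 1) \<cdot>\<^sub>m 1\<^sub>m m)"

text \<open>The image of \<surd>\<alpha>, that is x = 0 and y = 1 in the embedding of the quadratic
  extension.\<close>

definition J_twisted :: "'k::field \<Rightarrow> nat \<Rightarrow> 'k mat" where
  "J_twisted \<alpha> m = four_block_mat (0\<^sub>m m m) (1\<^sub>m m) (\<alpha> \<cdot>\<^sub>m 1\<^sub>m m) (0\<^sub>m m m)"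

lemmas block_mult = mult_four_block_mat[of _ m m _ m _ m _ _ m _ m for m]
lemmas block_smult = smult_four_block_mat[of _ m m _ m _ m for m]
lemmas scalar_mult = mult_smult_distrib[of _ m m _ m for m] mult_smult_assoc_mat[of _ m m _ m for m]

lemma anticommuting_linear:
  assumes "m > 0" "(2::'k::{finite,field}) \<noteq> 0"
  shows "anticommuting_matrices (m + m) (J_linear m)
    (four_block_mat (0\<^sub>m m m) (1\<^sub>m m) (1\<^sub>m m) (0\<^sub>m m m)) (1::'k)"
  using assms
  by unfold_locales
    (auto simp: J_linear_def block_mult[of _ m] block_smult[of _ m] scalar_mult[of _ m] smult_smult_mat
      one_smult_mat intro!: four_block_carrier_mat)

lemma anticommuting_twisted:
  assumes "m > 0" "(2::'k::{finite,field}) \<noteq> 0" "\<alpha> \<noteq> 0"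
  shows "anticommuting_matrices (m + m) (J_twisted \<alpha> m)
    (four_block_mat (1\<^sub>m m) (0\<^sub>m m m) (0\<^sub>m m m) (- 1\<^sub>m m)) (\<alpha>::'k)"
proof -
  have m1: "- 1\<^sub>m m = (- 1 :: 'k) \<cdot>\<^sub>m 1\<^sub>m m" by (intro eq_matI) auto
  have a1: "four_block_mat (\<alpha> \<cdot>\<^sub>m 1\<^sub>m m) (0\<^sub>m m m) (0\<^sub>m m m) (\<alpha> \<cdot>\<^sub>m 1\<^sub>m m) = \<alpha> \<cdot>\<^sub>m 1\<^sub>m (m + m)"
    by (intro eq_matI) auto
  show ?thesis
    unfolding m1 using assms
    by unfold_locales
      (auto simp: J_twisted_def block_mult[of _ m] block_smult[of _ m] scalar_mult[of _ m] smult_smult_mat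
        one_smult_mat a1 intro!: four_block_carrier_mat)
qed

text \<open>Commuting with diag(1,-1) forces the off-diagonal blocks to equal their negatives, and 2
  \<noteq> 0 makes them vanish.\<close>

lemma cent_linear:
  assumes "m > 0" "(2::'k::{finite,field}) \<noteq> 0"
  shows "anticommuting_matrices.cent (m + m) (J_linear m :: 'k mat)
    = (\<lambda>(A,D). four_block_mat A (0\<^sub>m m m) (0\<^sub>m m m) D) ` (carrier_mat m m \<times> carrier_mat m m)"
proof -
  interpret anticommuting_matrices "m + m" "J_linear m"
    "four_block_mat (0\<^sub>m m m) (1\<^sub>m m) (1\<^sub>m m) (0\<^sub>m m m)" "1::'k"
    by (rule anticommuting_linear[OF assms])
  have zero: "B = 0\<^sub>m m m" if "B \<in> carrier_mat m m" "(- 1) \<cdot>\<^sub>m B = B" for B :: "'k mat"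
  proof (rule eq_matI)
    fix i j assume "i < dim_row (0\<^sub>m m m :: 'k mat)" "j < dim_col (0\<^sub>m m m :: 'k mat)"
    then have ij: "i < m" "j < m" by auto
    have "- B $$ (i,j) = B $$ (i,j)"
      using arg_cong[OF that(2), of "\<lambda>X. X $$ (i,j)"] that(1) ij by simp
    then have "2 * B $$ (i,j) = 0" by (metis mult_2 add.right_inverse)
    then show "B $$ (i,j) = 0\<^sub>m m m $$ (i,j)" using assms(2) ij by simp
  qed (use that in auto)
  show ?thesis
  proof (intro equalityI subsetI)
    fix x assume "x \<in> cent"
    then have x: "x \<in> carrier_mat (m + m) (m + m)" "x * J_linear m = J_linear m * x"
      by (auto simp: cent_def)
    obtain A B C D where c: "A \<in> carrier_mat m m" "B \<in> carrier_mat m m" "C \<in> carrier_mat m m"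
      "D \<in> carrier_mat m m" and xe: "x = four_block_mat A B C D" by (rule four_block_cases[OF x(1)])
    have "(- 1) \<cdot>\<^sub>m B = B \<and> (- 1) \<cdot>\<^sub>m C = C"
      using x(2) c unfolding xe J_linear_def
      by (simp add: block_mult[of _ m] scalar_mult[of _ m] four_block_eq_iff[of _ m])
    then have "x = four_block_mat A (0\<^sub>m m m) (0\<^sub>m m m) D"
      using zero[OF c(2)] zero[OF c(3)] xe by simp
    then show "x \<in> (\<lambda>(A,D). four_block_mat A (0\<^sub>m m m) (0\<^sub>m m m) D) ` (carrier_mat m m \<times> carrier_mat m m)"
      using c by (intro image_eqI[of _ _ "(A, D)"]) auto
  next
    fix x :: "'k mat"
    assume "x \<in> (\<lambda>(A,D). four_block_mat A (0\<^sub>m m m) (0\<^sub>m m m) D) ` (carrier_mat m m \<times> carrier_mat m m)"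
    then show "x \<in> cent"
      unfolding cent_def by (auto simp: J_linear_def block_mult[of _ m] scalar_mult[of _ m]
          intro!: four_block_carrier_mat)
  qed
qed

text \<open>For blocks A, B, C, D, comparing the two products with J gives C = \<alpha>B and D = A,
  which is the shape of the embedded M_m(k[\<surd>\<alpha>]).\<close>

lemma cent_twisted:
  assumes "m > 0" "(2::'k::{finite,field}) \<noteq> 0" "\<alpha> \<noteq> 0"
  shows "anticommuting_matrices.cent (m + m) (J_twisted (\<alpha>::'k) m)
    = (\<lambda>(x,y). four_block_mat x y (\<alpha> \<cdot>\<^sub>m y) x) ` (carrier_mat m m \<times> carrier_mat m m)"
proof -
  interpret anticommuting_matrices "m + m" "J_twisted \<alpha> m"
    "four_block_mat (1\<^sub>m m) (0\<^sub>m m m) (0\<^sub>m m m) (- 1\<^sub>m m)" \<alpha>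
    by (rule anticommuting_twisted[OF assms])
  show ?thesis
  proof (intro equalityI subsetI)
    fix x assume "x \<in> cent"
    then have x: "x \<in> carrier_mat (m + m) (m + m)" "x * J_twisted \<alpha> m = J_twisted \<alpha> m * x"
      by (auto simp: cent_def)
    obtain A B C D where c: "A \<in> carrier_mat m m" "B \<in> carrier_mat m m" "C \<in> carrier_mat m m"
      "D \<in> carrier_mat m m" and xe: "x = four_block_mat A B C D" by (rule four_block_cases[OF x(1)])
    have xJ: "x * J_twisted \<alpha> m = four_block_mat (\<alpha> \<cdot>\<^sub>m B) A (\<alpha> \<cdot>\<^sub>m D) C"
      "J_twisted \<alpha> m * x = four_block_mat C D (\<alpha> \<cdot>\<^sub>m A) (\<alpha> \<cdot>\<^sub>m B)"
      unfolding xe J_twisted_def using c by (simp_all add: block_mult[of _ m] scalar_mult[of _ m])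
    from trans[OF trans[OF xJ(1)[symmetric] x(2)] xJ(2)]
    have "\<alpha> \<cdot>\<^sub>m B = C \<and> A = D \<and> \<alpha> \<cdot>\<^sub>m D = \<alpha> \<cdot>\<^sub>m A \<and> C = \<alpha> \<cdot>\<^sub>m B"
      by (rule four_block_eq_iff[of _ m, THEN iffD1, rotated -1]) (use c in simp_all)
    then have "C = \<alpha> \<cdot>\<^sub>m B" "D = A" by blast+
    then show "x \<in> (\<lambda>(x,y). four_block_mat x y (\<alpha> \<cdot>\<^sub>m y) x) ` (carrier_mat m m \<times> carrier_mat m m)"
      using c xe by (intro image_eqI[of _ _ "(A, B)"]) auto
  next
    fix x :: "'k mat"
    assume "x \<in> (\<lambda>(x,y). four_block_mat x y (\<alpha> \<cdot>\<^sub>m y) x) ` (carrier_mat m m \<times> carrier_mat m m)"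
    then show "x \<in> cent"
      unfolding cent_def by (auto simp: J_twisted_def block_mult[of _ m] scalar_mult[of _ m]
          intro!: four_block_carrier_mat)
  qed
qed

text \<open>The inverse of an invertible block diagonal matrix again lies in the centralizer, so it
  is block diagonal and its blocks invert those of the original.\<close>

lemma GL_block_diag_eq:
  assumes "m > 0" "(2::'k::{finite,field}) \<noteq> 0"
  shows "GL_block_diag m = anticommuting_matrices.cent (m + m) (J_linear m :: 'k mat) \<inter> carrier (GL (m + m))"
proof -
  interpret anticommuting_matrices "m + m" "J_linear m"
    "four_block_mat (0\<^sub>m m m) (1\<^sub>m m) (1\<^sub>m m) (0\<^sub>m m m)" "1::'k"
    by (rule anticommuting_linear[OF assms])
  note ce = cent_linear[OF assms]
  show ?thesis
  proof (intro equalityI subsetI)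
    fix g assume g: "g \<in> cent \<inter> carrier (GL (m + m))"
    obtain A D where AD: "A \<in> carrier_mat m m" "D \<in> carrier_mat m m"
      "g = four_block_mat A (0\<^sub>m m m) (0\<^sub>m m m) D" using g unfolding ce by auto
    have "inv\<^bsub>GL (m + m)\<^esub> g \<in> cent" using subgroup.m_inv_closed[OF subgroup_H g] by blast
    then obtain A' D' where AD': "A' \<in> carrier_mat m m" "D' \<in> carrier_mat m m"
      "inv\<^bsub>GL (m + m)\<^esub> g = four_block_mat A' (0\<^sub>m m m) (0\<^sub>m m m) D'" unfolding ce by auto
    have "A * A' = 1\<^sub>m m \<and> D * D' = 1\<^sub>m m"
      using GL_inv(3)[of g "m + m"] g AD(1,2) AD'(1,2) unfolding AD'(3) unfolding AD(3)
      by (simp add: block_mult[of _ m] four_block_eq_one_iff)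
    moreover have "A' * A = 1\<^sub>m m \<and> D' * D = 1\<^sub>m m"
      using GL_inv(4)[of g "m + m"] g AD(1,2) AD'(1,2) unfolding AD'(3) unfolding AD(3)
      by (simp add: block_mult[of _ m] four_block_eq_one_iff)
    ultimately have "A \<in> carrier (GL m)" "D \<in> carrier (GL m)"
      using AD AD' by (auto intro: GL_I)
    then show "g \<in> GL_block_diag m" using AD(3) by (auto simp: GL_block_diag_def)
  next
    fix g :: "'k mat" assume "g \<in> GL_block_diag m"
    then obtain A D where "A \<in> carrier (GL m)" "D \<in> carrier (GL m)"
      "g = four_block_mat A (0\<^sub>m m m) (0\<^sub>m m m) D" by (auto simp: GL_block_diag_def)
    then show "g \<in> cent \<inter> carrier (GL (m + m))"
      using four_block_diag_GL GL_carrier_mat unfolding ce by fastforce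
  qed
qed

text \<open>As J itself lies in H, \<open>X\<close> commutes with J and is block diagonal; commuting
  with all diag(g,g) makes its two blocks scalars a and d, and diag(a,d) is a combination of 1 and
  diag(1,-1).\<close>

lemma linear_commutant:
  fixes X :: "'k::{finite,field} mat"
  assumes m: "m > 0" and two: "(2::'k) \<noteq> 0"
    and X: "X \<in> carrier_mat (m + m) (m + m)"
    and comm: "\<And>h. h \<in> anticommuting_matrices.cent (m + m) (J_linear m) \<inter> carrier (GL (m + m)) \<Longrightarrow> X * h = h * X"
  shows "\<exists>a b. X = a \<cdot>\<^sub>m 1\<^sub>m (m + m) + b \<cdot>\<^sub>m J_linear m"
proof -
  interpret anticommuting_matrices "m + m" "J_linear m"
    "four_block_mat (0\<^sub>m m m) (1\<^sub>m m) (1\<^sub>m m) (0\<^sub>m m m)" "1::'k"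
    by (rule anticommuting_linear[OF m two])
  note ce = cent_linear[OF m two]
  have "X * J_linear m = J_linear m * X" using comm cent_J J_GL by simp
  then have "X \<in> cent" using X by (simp add: cent_def)
  then obtain A D where AD: "A \<in> carrier_mat m m" "D \<in> carrier_mat m m"
    "X = four_block_mat A (0\<^sub>m m m) (0\<^sub>m m m) D" unfolding ce by auto
  have "\<exists>a b c d. A = a \<cdot>\<^sub>m 1\<^sub>m m \<and> 0\<^sub>m m m = b \<cdot>\<^sub>m (1\<^sub>m m :: 'k mat)
      \<and> 0\<^sub>m m m = c \<cdot>\<^sub>m (1\<^sub>m m :: 'k mat) \<and> D = d \<cdot>\<^sub>m 1\<^sub>m m"
  proof (rule block_commutant)
    fix g :: "'k mat" assume g: "g \<in> carrier (GL m)"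
    then have "four_block_mat g (0\<^sub>m m m) (0\<^sub>m m m) g \<in> cent \<inter> carrier (GL (m + m))"
      using four_block_diag_GL[OF g g] GL_carrier_mat[OF g] unfolding ce by auto
    from comm[OF this] show "four_block_mat A (0\<^sub>m m m) (0\<^sub>m m m) D * four_block_mat g (0\<^sub>m m m) (0\<^sub>m m m) g
      = four_block_mat g (0\<^sub>m m m) (0\<^sub>m m m) g * four_block_mat A (0\<^sub>m m m) (0\<^sub>m m m) D"
      unfolding AD(3) .
  qed (use AD in auto)
  then obtain a d where ad: "A = a \<cdot>\<^sub>m 1\<^sub>m m" "D = d \<cdot>\<^sub>m 1\<^sub>m m" by blast
  \<comment> \<open>The coefficients of 1 and J are the half sum and half difference of the two
    scalars, which exist because 2 \<noteq> 0.\<close>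
  have half: "(a + d) / 2 + (a - d) / 2 = a" "(a + d) / 2 - (a - d) / 2 = d"
  proof -
    have "(a + d) / 2 + (a - d) / 2 = (a + a) / 2" "(a + d) / 2 - (a - d) / 2 = (d + d) / 2"
      unfolding add_divide_distrib[symmetric] diff_divide_distrib[symmetric] by simp_all
    then show "(a + d) / 2 + (a - d) / 2 = a" "(a + d) / 2 - (a - d) / 2 = d"
      unfolding mult_2[symmetric] using two by simp_all
  qed
  have "X = ((a + d) / 2) \<cdot>\<^sub>m 1\<^sub>m (m + m) + ((a - d) / 2) \<cdot>\<^sub>m J_linear m"
    unfolding AD(3) ad J_linear_def
    using half by (intro eq_matI) auto
  then show ?thesis by blast
qed

text \<open>Commuting with J puts \<open>X\<close> into the centralizer, and commuting with
  diag(g,g), the case y = 0 of the embedding, makes its blocks x and y scalar.\<close>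

lemma twisted_commutant:
  fixes X :: "'k::{finite,field} mat"
  assumes m: "m > 0" and two: "(2::'k) \<noteq> 0" and \<alpha>: "\<alpha> \<noteq> 0"
    and X: "X \<in> carrier_mat (m + m) (m + m)"
    and comm: "\<And>h. h \<in> anticommuting_matrices.cent (m + m) (J_twisted \<alpha> m) \<inter> carrier (GL (m + m)) \<Longrightarrow> X * h = h * X"
  shows "\<exists>a b. X = a \<cdot>\<^sub>m 1\<^sub>m (m + m) + b \<cdot>\<^sub>m J_twisted \<alpha> m"
proof -
  interpret anticommuting_matrices "m + m" "J_twisted \<alpha> m"
    "four_block_mat (1\<^sub>m m) (0\<^sub>m m m) (0\<^sub>m m m) (- 1\<^sub>m m)" \<alpha>
    by (rule anticommuting_twisted[OF m two \<alpha>])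
  note ce = cent_twisted[OF m two \<alpha>]
  have "X * J_twisted \<alpha> m = J_twisted \<alpha> m * X" using comm cent_J J_GL by simp
  then have "X \<in> cent" using X by (simp add: cent_def)
  then obtain x y where xy: "x \<in> carrier_mat m m" "y \<in> carrier_mat m m"
    "X = four_block_mat x y (\<alpha> \<cdot>\<^sub>m y) x" unfolding ce by auto
  have "\<exists>a b c d. x = a \<cdot>\<^sub>m 1\<^sub>m m \<and> y = b \<cdot>\<^sub>m 1\<^sub>m m \<and> \<alpha> \<cdot>\<^sub>m y = c \<cdot>\<^sub>m 1\<^sub>m m \<and> x = d \<cdot>\<^sub>m 1\<^sub>m m"
  proof (rule block_commutant)
    fix g :: "'k mat" assume g: "g \<in> carrier (GL m)"
    have "four_block_mat g (0\<^sub>m m m) (0\<^sub>m m m) g = four_block_mat g (0\<^sub>m m m) (\<alpha> \<cdot>\<^sub>m 0\<^sub>m m m) g" by simp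
    then have "four_block_mat g (0\<^sub>m m m) (0\<^sub>m m m) g \<in> cent \<inter> carrier (GL (m + m))"
      using four_block_diag_GL[OF g g] GL_carrier_mat[OF g] unfolding ce
      by (auto intro!: image_eqI[of _ _ "(g, 0\<^sub>m m m)"])
    from comm[OF this] show "four_block_mat x y (\<alpha> \<cdot>\<^sub>m y) x * four_block_mat g (0\<^sub>m m m) (0\<^sub>m m m) g
      = four_block_mat g (0\<^sub>m m m) (0\<^sub>m m m) g * four_block_mat x y (\<alpha> \<cdot>\<^sub>m y) x"
      unfolding xy(3) .
  qed (use xy in auto)
  then obtain a b where ab: "x = a \<cdot>\<^sub>m 1\<^sub>m m" "y = b \<cdot>\<^sub>m 1\<^sub>m m" by blast
  have "X = a \<cdot>\<^sub>m 1\<^sub>m (m + m) + b \<cdot>\<^sub>m J_twisted \<alpha> m"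
    unfolding xy(3) ab J_twisted_def by (intro eq_matI) auto
  then show ?thesis by blast
qed

section \<open>Quadratic extensions\<close>

text \<open>Dimension 2 is turned into the count |K|^2 = |k|, which makes |K| invertible in R and
  shows that 1 and any x outside K span k over K.\<close>

lemma quadratic_subfieldD:
  fixes K :: "'k::{finite,field} set"
  assumes "quadratic_subfield K"
  shows "0 \<in> K" "1 \<in> K" "\<And>x y. x \<in> K \<Longrightarrow> y \<in> K \<Longrightarrow> x + y \<in> K"
    "\<And>x. x \<in> K \<Longrightarrow> - x \<in> K" "\<And>x y. x \<in> K \<Longrightarrow> y \<in> K \<Longrightarrow> x * y \<in> K"
    "\<And>x. x \<in> K \<Longrightarrow> inverse x \<in> K" "card K * card K = card (UNIV :: 'k set)"
proof -
  have sf: "subfield K (class_ring :: 'k ring)"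
    and dim: "ring.dimension (class_ring :: 'k ring) (Suc (Suc 0)) K UNIV"
    using assms by (simp_all add: quadratic_subfield_def numeral_2_eq_2)
  note sr = subringE[OF subfieldE(1)[OF sf]]
  show K0: "0 \<in> K" and "1 \<in> K" and add: "\<And>x y. x \<in> K \<Longrightarrow> y \<in> K \<Longrightarrow> x + y \<in> K"
    and mult: "\<And>x y. x \<in> K \<Longrightarrow> y \<in> K \<Longrightarrow> x * y \<in> K"
    using sr(2,3,6,7) by simp_all
  show uminus: "- x \<in> K" if "x \<in> K" for x
    using sr(5)[OF that] by (simp add: class_ring_simps)
  show inv: "inverse x \<in> K" if "x \<in> K" for x
  proof (cases "x = 0")
    case False
    define y where "y = inv\<^bsub>class_ring\<^esub> x"
    have "y \<in> K" "x * y = 1"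
      using ring.subfield_m_inv[OF class_ring.ring_axioms sf, of x] that False by (auto simp: y_def)
    then show ?thesis using inverse_unique[of x y] by simp
  qed (use K0 in simp)
  \<comment> \<open>A space of dimension 2 is a line extension of a line extension of 0; the vectors
    \<open>v\<close> and \<open>u\<close> form a basis of k over K.\<close>
  obtain v E where vE: "v \<notin> E" "ring.dimension class_ring (Suc 0) K E"
    "UNIV = ring.line_extension class_ring K v E"
    using dim by (cases rule: ring.dimension.cases[OF class_ring.ring_axioms, consumes 1]) auto
  obtain u E' where uE: "u \<notin> E'" "ring.dimension class_ring 0 K E'"
    "E = ring.line_extension class_ring K u E'"
    using vE(2) by (cases rule: ring.dimension.cases[OF class_ring.ring_axioms, consumes 1]) auto
  have E': "E' = {0}" using ring.dimension_zero[OF class_ring.ring_axioms sf uE(2)] by simp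
  have u: "u \<noteq> 0" using uE(1) E' by simp
  have E: "x \<in> E \<longleftrightarrow> (\<exists>b\<in>K. x = b * u)" for x
    unfolding uE(3) ring.line_extension_mem_iff[OF class_ring.ring_axioms] E' by auto
  have all: "\<exists>a\<in>K. \<exists>b\<in>K. x = a * v + b * u" for x
  proof -
    have "x \<in> ring.line_extension class_ring K v E" using vE(3) by auto
    then obtain a y where "a \<in> K" "y \<in> E" "x = a * v + y"
      unfolding ring.line_extension_mem_iff[OF class_ring.ring_axioms] by auto
    moreover from \<open>y \<in> E\<close> obtain b where "b \<in> K" "y = b * u" unfolding E by blast
    ultimately show ?thesis by blast
  qed
  have "inj_on (\<lambda>(a,b). a * v + b * u) (K \<times> K)"
  proof (rule inj_onI)
    fix p q assume pq: "p \<in> K \<times> K" "q \<in> K \<times> K"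
      "(\<lambda>(a,b). a * v + b * u) p = (\<lambda>(a,b). a * v + b * u) q"
    obtain a b a' b' where ab: "p = (a,b)" "q = (a',b')" "a \<in> K" "b \<in> K" "a' \<in> K" "b' \<in> K"
      using pq(1,2) by auto
    have eq: "(a - a') * v = (b' - b) * u"
      using pq(3) ab(1,2) by (simp add: algebra_simps)
    have "a = a'"
    proof (rule ccontr)
      assume "a \<noteq> a'"
      then have "v = inverse (a + - a') * (b' + - b) * u"
        using eq by (simp add: field_simps)
      moreover have "inverse (a + - a') * (b' + - b) \<in> K" using ab by (intro mult inv add uminus)
      ultimately have "v \<in> E" using E by blast
      then show False using vE(1) by simp
    qed
    then show "p = q" using eq u ab by simp
  qed
  moreover have "(\<lambda>(a,b). a * v + b * u) ` (K \<times> K) = UNIV"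
    using all by (auto simp: image_iff)
  ultimately show "card K * card K = card (UNIV :: 'k set)"
    by (metis card_cartesian_product card_image)
qed

text \<open>Completing the square: any x outside K satisfies x^2 = a + bx over K, and e = x - b/2
  has the square a + b^2/4 in K.\<close>

lemma quadratic_subfield_sqrt:
  fixes K :: "'k::{finite,field} set"
  assumes K: "quadratic_subfield K" and two: "(2::'k) \<noteq> 0"
  obtains e where "e \<notin> K" "e * e \<in> K" "\<And>z. \<exists>a\<in>K. \<exists>b\<in>K. z = a + b * e"
proof -
  note KD = quadratic_subfieldD[OF K]
  have diff: "x - y \<in> K" if "x \<in> K" "y \<in> K" for x y using KD(3)[OF that(1) KD(4)[OF that(2)]] by simp
  have div: "x / y \<in> K" if "x \<in> K" "y \<in> K" for x y
    using KD(5)[OF that(1) KD(6)[OF that(2)]] by (simp add: divide_inverse)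
  have inj: "inj_on (\<lambda>(a,b). a + b * x) (K \<times> K)" if x: "x \<notin> K" for x
  proof (rule inj_onI)
    fix p q assume pq: "p \<in> K \<times> K" "q \<in> K \<times> K"
      "(\<lambda>(a,b). a + b * x) p = (\<lambda>(a,b). a + b * x) q"
    obtain a b a' b' where ab: "p = (a,b)" "q = (a',b')" "a \<in> K" "b \<in> K" "a' \<in> K" "b' \<in> K"
      using pq(1,2) by auto
    have eq: "(b - b') * x = a' - a" using pq(3) ab(1,2) by (simp add: algebra_simps)
    have "b = b'"
    proof (rule ccontr)
      assume "b \<noteq> b'"
      then have "x = (a' - a) / (b - b')" using eq by (simp add: nonzero_eq_divide_eq mult.commute)
      then show False using x div diff ab by metis
    qed
    then show "p = q" using eq ab by simp
  qed
  have span: "\<exists>a\<in>K. \<exists>b\<in>K. z = a + b * x" if x: "x \<notin> K" for x z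
  proof -
    have "card ((\<lambda>(a,b). a + b * x) ` (K \<times> K)) = card (UNIV :: 'k set)"
      using card_image[OF inj[OF x]] KD(7) by (simp add: card_cartesian_product)
    then have "(\<lambda>(a,b). a + b * x) ` (K \<times> K) = UNIV" by (intro card_subset_eq) auto
    then have "z \<in> (\<lambda>(a,b). a + b * x) ` (K \<times> K)" by simp
    then show ?thesis by auto
  qed
  have "K \<noteq> UNIV"
  proof
    assume "K = UNIV"
    then have "card (UNIV :: 'k set) = 1" using KD(7) by (simp add: card_eq_0_iff)
    then have "(0::'k) = 1" by (metis card_1_singletonE singletonD UNIV_I)
    then show False by simp
  qed
  then obtain x where x: "x \<notin> K" by blast
  obtain a b where ab: "a \<in> K" "b \<in> K" "x * x = a + b * x" using span[OF x] by blast
  have K2: "2 \<in> K" using KD(3)[OF KD(2,2)] by simp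
  define c where "c = b / 2"
  have c: "c \<in> K" "b = 2 * c" using div[OF ab(2) K2] two by (simp_all add: c_def)
  define e where "e = x - c"
  have "e \<notin> K"
  proof
    assume "e \<in> K"
    then have "e + c \<in> K" using KD(3) c by blast
    then show False using x by (simp add: e_def)
  qed
  moreover have "e * e = x * x - b * x + c * c" unfolding c(2) e_def by (simp add: algebra_simps)
  then have "e * e = a + c * c" unfolding ab(3) by simp
  then have "e * e \<in> K" using KD(3,5) ab c by simp
  ultimately show ?thesis using that span by blast
qed

section \<open>The Galois group and the trace of a quadratic extension\<close>

lemma galois_groupD:
  assumes "\<sigma> \<in> galois_group K"
  shows "\<sigma> (x + y) = \<sigma> x + \<sigma> y" "\<sigma> (x * y) = \<sigma> x * \<sigma> y" "x \<in> K \<Longrightarrow> \<sigma> x = x"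
  using assms by (auto simp: galois_group_def ring_iso_def Ring.ring_hom_def)

lemma galois_groupI:
  fixes \<sigma> :: "'k::field \<Rightarrow> 'k"
  assumes "\<And>x y. \<sigma> (x + y) = \<sigma> x + \<sigma> y" "\<And>x y. \<sigma> (x * y) = \<sigma> x * \<sigma> y" "\<And>x. x \<in> K \<Longrightarrow> \<sigma> x = x"
    "1 \<in> K" "bij \<sigma>"
  shows "\<sigma> \<in> galois_group K"
  using assms by (auto simp: galois_group_def ring_iso_def Ring.ring_hom_def)

text \<open>The trace is a sum over the Galois group, so this group is determined: it consists of
  the identity and a + be \<mapsto> a - be. The trace of a + be is then 2a, and its kernel is the
  line Ke, which any non-zero \<open>\<delta>\<close> in it spans.\<close>

lemma quadratic_ext_trace:
  fixes K :: "'k::{finite,field} set"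
  assumes K: "quadratic_subfield K" and two: "(2::'k) \<noteq> 0"
  shows "\<And>x y. ext_trace K (x + y) = ext_trace K x + ext_trace K y"
    "\<And>c x. c \<in> K \<Longrightarrow> ext_trace K (c * x) = c * ext_trace K x"
    "\<And>x. ext_trace K x \<in> K"
    "\<And>\<delta>. \<lbrakk>\<delta> \<noteq> 0; ext_trace K \<delta> = 0\<rbrakk> \<Longrightarrow> \<delta> * \<delta> \<in> K \<and> (\<forall>z. ext_trace K z = 0 \<longleftrightarrow> (\<exists>c\<in>K. z = \<delta> * c))"
proof -
  note KD = quadratic_subfieldD[OF K]
  have diff: "x - y \<in> K" if "x \<in> K" "y \<in> K" for x y using KD(3)[OF that(1) KD(4)[OF that(2)]] by simp
  obtain e where e: "e \<notin> K" "e * e \<in> K" "\<And>z. \<exists>a\<in>K. \<exists>b\<in>K. z = a + b * e"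
    using quadratic_subfield_sqrt[OF K two] by blast
  have e0: "e \<noteq> 0" using e(1) KD(1) by auto
  have "\<forall>z. \<exists>p. fst p \<in> K \<and> snd p \<in> K \<and> z = fst p + snd p * e" using e(3) by fastforce
  then obtain P where P: "\<And>z. fst (P z) \<in> K \<and> snd (P z) \<in> K \<and> z = fst (P z) + snd (P z) * e"
    by metis
  have uniq: "a = c \<and> b = d" if "a + b * e = c + d * e" "a \<in> K" "b \<in> K" "c \<in> K" "d \<in> K" for a b c d
  proof -
    have eq: "(b - d) * e = c - a" using that(1) by (simp add: algebra_simps)
    have "b = d"
    proof (rule ccontr)
      assume "b \<noteq> d"
      then have "e = inverse (b - d) * (c - a)" using eq by (simp add: field_simps)
      moreover have "inverse (b - d) * (c - a) \<in> K" using that by (intro KD(5) KD(6) diff)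
      ultimately show False using e(1) by simp
    qed
    then show ?thesis using eq by simp
  qed
  define \<sigma> where "\<sigma> z = fst (P z) - snd (P z) * e" for z
  have \<sigma>: "\<sigma> (a + b * e) = a - b * e" if "a \<in> K" "b \<in> K" for a b
    using uniq[of "fst (P (a + b * e))" "snd (P (a + b * e))" a b] P[of "a + b * e"] that
    by (simp add: \<sigma>_def)
  have \<sigma>_gal: "\<sigma> \<in> galois_group K"
  proof (rule galois_groupI)
    fix x y
    obtain a b c d where ab: "a \<in> K" "b \<in> K" "c \<in> K" "d \<in> K" "x = a + b * e" "y = c + d * e"
      using e(3)[of x] e(3)[of y] by blast
    have "x + y = (a + c) + (b + d) * e" using ab(5,6) by (simp add: algebra_simps)
    then have "\<sigma> (x + y) = (a + c) - (b + d) * e"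
      using \<sigma>[OF KD(3)[OF ab(1,3)] KD(3)[OF ab(2,4)]] by (simp only:)
    also have "\<dots> = (a - b * e) + (c - d * e)" by (simp add: algebra_simps)
    also have "\<dots> = \<sigma> x + \<sigma> y" unfolding ab(5,6) \<sigma>[OF ab(1,2)] \<sigma>[OF ab(3,4)] ..
    finally show "\<sigma> (x + y) = \<sigma> x + \<sigma> y" .
    have xy: "x * y = (a * c + b * d * (e * e)) + (a * d + b * c) * e"
      using ab(5,6) by (simp add: algebra_simps)
    have "a * c + b * d * (e * e) \<in> K" "a * d + b * c \<in> K" using ab e(2) KD(3,5) by simp_all
    then have "\<sigma> (x * y) = (a * c + b * d * (e * e)) - (a * d + b * c) * e"
      unfolding xy by (rule \<sigma>)
    also have "\<dots> = (a - b * e) * (c - d * e)" by (simp add: algebra_simps)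
    also have "\<dots> = \<sigma> x * \<sigma> y" unfolding ab(5,6) \<sigma>[OF ab(1,2)] \<sigma>[OF ab(3,4)] ..
    finally show "\<sigma> (x * y) = \<sigma> x * \<sigma> y" .
  next
    show "\<sigma> x = x" if "x \<in> K" for x using \<sigma>[OF that KD(1)] by simp
    have "\<sigma> (\<sigma> z) = z" for z
    proof -
      obtain a b where ab: "a \<in> K" "b \<in> K" "z = a + b * e" using e(3) by blast
      then show ?thesis using \<sigma>[OF ab(1,2)] \<sigma>[OF ab(1) KD(4)[OF ab(2)]] by simp
    qed
    then show "bij \<sigma>" by (intro o_bij[of \<sigma> \<sigma>]) (auto simp: fun_eq_iff)
  qed (rule KD(2))
  have id_gal: "(\<lambda>x. x) \<in> galois_group K"
    using KD(2) by (intro galois_groupI) (auto simp: bij_def inj_def)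
  have gal: "\<tau> = (\<lambda>x. x) \<or> \<tau> = \<sigma>" if \<tau>: "\<tau> \<in> galois_group K" for \<tau>
  proof -
    note \<tau>D = galois_groupD[OF \<tau>]
    have \<tau>z: "\<tau> z = fst (P z) + snd (P z) * \<tau> e" for z
    proof -
      have "\<tau> z = \<tau> (fst (P z) + snd (P z) * e)"
        by (rule arg_cong[of _ _ \<tau>]) (use P[of z] in blast)
      also have "\<dots> = fst (P z) + snd (P z) * \<tau> e"
        unfolding \<tau>D(1,2) using \<tau>D(3)[of "fst (P z)"] \<tau>D(3)[of "snd (P z)"] P[of z] by simp
      finally show ?thesis .
    qed
    \<comment> \<open>An automorphism over K is fixed by the image of e, and this image has the same
      square as e.\<close>
    have "\<tau> e * \<tau> e = e * e" using \<tau>D(2)[of e e] \<tau>D(3)[OF e(2)] by simp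
    then have "(\<tau> e - e) * (\<tau> e + e) = 0" by (simp add: algebra_simps)
    then have "\<tau> e = e \<or> \<tau> e = - e" by (auto simp: eq_neg_iff_add_eq_0)
    then show ?thesis
    proof
      assume "\<tau> e = e"
      then have "\<tau> z = z" for z using \<tau>z[of z] P[of z] by simp
      then show ?thesis by auto
    next
      assume "\<tau> e = - e"
      then have "\<tau> z = \<sigma> z" for z using \<tau>z[of z] by (simp add: \<sigma>_def)
      then show ?thesis by auto
    qed
  qed
  have \<sigma>e: "\<sigma> e = - e" using \<sigma>[OF KD(1,2)] by simp
  \<comment> \<open>The trace sums over a set of automorphisms, so it has two terms only if these
    two are distinct.\<close>
  have "\<sigma> \<noteq> (\<lambda>x. x)"
  proof
    assume "\<sigma> = (\<lambda>x. x)"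
    then have "- e = e" using \<sigma>e by metis
    then have "2 * e = 0" by (metis mult_2 add.right_inverse)
    then show False using two e0 by simp
  qed
  moreover have "galois_group K = {\<lambda>x. x, \<sigma>}" using gal id_gal \<sigma>_gal by blast
  ultimately have tr': "ext_trace K z = z + \<sigma> z" for z by (auto simp: ext_trace_def)
  have tr: "ext_trace K (a + b * e) = 2 * a" if "a \<in> K" "b \<in> K" for a b
    unfolding tr' \<sigma>[OF that] by simp
  note \<sigma>D = galois_groupD[OF \<sigma>_gal]
  show "ext_trace K (x + y) = ext_trace K x + ext_trace K y" for x y
    by (simp add: tr' \<sigma>D)
  show "ext_trace K (c * x) = c * ext_trace K x" if "c \<in> K" for c x
    using that by (simp add: tr' \<sigma>D algebra_simps)
  show "ext_trace K x \<in> K" for x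
  proof -
    obtain a b where ab: "a \<in> K" "b \<in> K" "x = a + b * e" using e(3) by blast
    have "ext_trace K x = a + a" unfolding ab(3) tr[OF ab(1,2)] by (rule mult_2)
    then show ?thesis using KD(3)[OF ab(1,1)] by (simp only:)
  qed
  have tr0: "ext_trace K z = 0 \<longleftrightarrow> (\<exists>b\<in>K. z = b * e)" for z
  proof
    assume z: "ext_trace K z = 0"
    obtain a b where ab: "a \<in> K" "b \<in> K" "z = a + b * e" using e(3) by blast
    have "2 * a = 0" using z tr[OF ab(1,2)] ab(3) by simp
    then have "z = b * e" using two ab(3) by simp
    then show "\<exists>b\<in>K. z = b * e" using ab by blast
  next
    assume "\<exists>b\<in>K. z = b * e"
    then obtain b where "b \<in> K" "z = 0 + b * e" by auto
    then show "ext_trace K z = 0" using tr[OF KD(1)] by simp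
  qed
  fix \<delta> assume \<delta>: "\<delta> \<noteq> 0" "ext_trace K \<delta> = 0"
  then obtain d where d: "d \<in> K" "\<delta> = d * e" using tr0 by blast
  have "d \<noteq> 0" using d \<delta> by auto
  have "\<delta> * \<delta> = d * d * (e * e)" using d(2) by (simp add: algebra_simps)
  then have "\<delta> * \<delta> \<in> K" using d(1) e(2) KD(5) by simp
  moreover have "(\<exists>b\<in>K. z = b * e) \<longleftrightarrow> (\<exists>c\<in>K. z = \<delta> * c)" for z
  proof
    assume "\<exists>b\<in>K. z = b * e"
    then obtain b where b: "b \<in> K" "z = b * e" by blast
    have "z = \<delta> * (b * inverse d)" using b d \<open>d \<noteq> 0\<close> by simp
    moreover have "b * inverse d \<in> K" using b d KD(5,6) by blast
    ultimately show "\<exists>c\<in>K. z = \<delta> * c" by blast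
  next
    assume "\<exists>c\<in>K. z = \<delta> * c"
    then obtain c where c: "c \<in> K" "z = \<delta> * c" by blast
    then have "z = (d * c) * e" using d by simp
    then show "\<exists>b\<in>K. z = b * e" using c d KD(5) by blast
  qed
  ultimately show "\<delta> * \<delta> \<in> K \<and> (\<forall>z. ext_trace K z = 0 \<longleftrightarrow> (\<exists>c\<in>K. z = \<delta> * c))"
    using tr0 by simp
qed

lemma sum_closed:
  assumes "(0::'k::comm_monoid_add) \<in> K" "\<And>x y. x \<in> K \<Longrightarrow> y \<in> K \<Longrightarrow> x + y \<in> K"
    "\<And>i. i \<in> I \<Longrightarrow> f i \<in> K"
  shows "(\<Sum>i\<in>I. f i) \<in> K"
  using assms(3) by (induction I rule: infinite_finite_induct) (auto simp: assms(1,2))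

text \<open>Here M is the algebra of matrices over K and w = \<delta>. The trace is K-linear and M
  contains the c E_ij with c in K, so orthogonality to M means that every entry has trace 0, that
  is, lies in \<delta>K.\<close>

lemma (in cuspidal_GL_rep) galois_distinction:
  fixes K :: "'k set"
  assumes K: "quadratic_subfield K" and two: "(2::'k) \<noteq> 0" and char: "CHAR('r) \<noteq> CHAR('k)"
    and dist: "distinguished scale \<pi> (matrix_units n (mats_over K n))"
    and \<psi>: "nontrivial_additive_character K \<psi>"
    and \<delta>: "\<delta> \<noteq> 0" "ext_trace K \<delta> = 0"
  shows "gamma_factor (of_nat (card (mats_over K n))) scale n \<pi> (\<psi> \<circ> ext_trace K)
    = central_character scale n \<pi> \<delta>"
proof -
  note KD = quadratic_subfieldD[OF K] and tr = quadratic_ext_trace[OF K two]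
    and \<psi>D = nontrivial_additive_characterD[OF \<psi>]
  define M where "M = mats_over K n"
  define s where "s = (of_nat (card M) :: 'r)"
  define w where "w = \<delta> \<cdot>\<^sub>m (1\<^sub>m n :: 'k mat)"
  have tr\<delta>: "ext_trace K z = 0 \<longleftrightarrow> (\<exists>c\<in>K. z = \<delta> * c)" for z
    using tr(4)[OF \<delta>] by auto
  have \<delta>\<delta>: "\<delta> * \<delta> \<in> K" using tr(4)[OF \<delta>] by blast
  have M_iff: "A \<in> M \<longleftrightarrow> A \<in> carrier_mat n n \<and> (\<forall>i<n. \<forall>j<n. A $$ (i,j) \<in> K)" for A
    by (simp add: M_def mats_over_iff)
  have M_carrier: "M \<subseteq> carrier_mat n n" using M_iff by blast
  have M_one: "1\<^sub>m n \<in> M" using KD(1,2) by (auto simp: M_iff)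
  have M_mult: "x * y \<in> M" if "x \<in> M" "y \<in> M" for x y
    using that KD(1,3,5) unfolding M_iff
    by (auto simp: scalar_prod_def intro!: sum_closed)
  have M_add: "x + y \<in> M" if "x \<in> M" "y \<in> M" for x y
    using that KD(3) by (auto simp: M_iff)
  have "(of_nat (card K) :: 'r) * of_nat (card K) = of_nat (card (UNIV :: 'k set))"
    using KD(7) by (metis of_nat_mult)
  then have "(of_nat (card K) :: 'r) \<noteq> 0" using of_nat_card_field_nonzero[OF char] by auto
  then have s: "s \<noteq> 0" by (simp add: s_def M_def card_mats_over)
  have w: "w \<in> carrier (GL n)"
    using \<delta> by (intro GL_I[of _ _ "inverse \<delta> \<cdot>\<^sub>m 1\<^sub>m n"])
      (auto simp: w_def mult_smult_distrib[of _ n n _ n] mult_smult_assoc_mat[of _ n n _ n]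
        smult_smult_mat one_smult_mat)
  have w_image: "y \<in> (*) w ` M \<longleftrightarrow> (\<forall>i<n. \<forall>j<n. ext_trace K (y $$ (i,j)) = 0)"
    if y: "y \<in> carrier_mat n n" for y
  proof
    assume "y \<in> (*) w ` M"
    then obtain x where x: "x \<in> M" "y = w * x" by blast
    then have xc: "x \<in> carrier_mat n n" using M_carrier by blast
    have "y = \<delta> \<cdot>\<^sub>m x" using x xc by (simp add: w_def mult_smult_assoc_mat[of _ n n _ n])
    then show "\<forall>i<n. \<forall>j<n. ext_trace K (y $$ (i,j)) = 0"
      using x xc by (auto simp: tr\<delta> M_iff)
  next
    assume a: "\<forall>i<n. \<forall>j<n. ext_trace K (y $$ (i,j)) = 0"
    define x where "x = inverse \<delta> \<cdot>\<^sub>m y"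
    have xc: "x \<in> carrier_mat n n" using y by (simp add: x_def)
    have "x $$ (i,j) \<in> K" if ij: "i < n" "j < n" for i j
    proof -
      obtain c where "c \<in> K" "y $$ (i,j) = \<delta> * c" using a ij tr\<delta> by blast
      then have "c \<in> K" "x $$ (i,j) = inverse \<delta> * \<delta> * c"
        using ij y by (simp_all add: x_def mult.assoc)
      then show ?thesis using \<delta>(1) by simp
    qed
    then have "x \<in> M" using xc by (simp add: M_iff)
    moreover have "y = w * x"
      using y \<delta> by (simp add: w_def x_def mult_smult_assoc_mat[of _ n n _ n] smult_smult_mat one_smult_mat)
    ultimately show "y \<in> (*) w ` M" by blast
  qed
  have tr_zero: "ext_trace K 0 = 0" using tr(2)[OF KD(1), of 0] by simp
  have tr_sum: "ext_trace K (\<Sum>i\<in>I. f i) = (\<Sum>i\<in>I. ext_trace K (f i))" for I :: "nat set" and f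
    by (induction I rule: infinite_finite_induct) (simp_all add: tr_zero tr(1))
  have \<psi>0: "\<psi> 0 = 1" using \<psi>D(1)[OF KD(1,1)] \<psi>D(2)[OF KD(1)] by simp
  have orth: "(\<Sum>x\<in>M. (\<psi> \<circ> ext_trace K) (mat_trace (y * x))) = (if y \<in> (*) w ` M then s else 0)"
    if y: "y \<in> carrier_mat n n" for y
  proof -
    let ?\<chi> = "\<lambda>x. \<psi> (ext_trace K (mat_trace (y * x)))"
    have "(\<Sum>x\<in>M. ?\<chi> x) = (if \<forall>x\<in>M. ?\<chi> x = 1 then of_nat (card M) else 0)"
    proof (rule sum_character[OF M_carrier M_add])
      fix x z assume "x \<in> M" "z \<in> M"
      then have "x \<in> carrier_mat n n" "z \<in> carrier_mat n n" using M_carrier by auto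
      then show "?\<chi> (x + z) = ?\<chi> x * ?\<chi> z"
        using y by (simp add: mult_add_distrib_mat[of _ n n _ n] mat_trace_add[of _ n] tr \<psi>D(1))
    qed
    moreover have "(\<forall>x\<in>M. ?\<chi> x = 1) \<longleftrightarrow> (\<forall>i<n. \<forall>j<n. ext_trace K (y $$ (i,j)) = 0)"
    proof
      assume a: "\<forall>i<n. \<forall>j<n. ext_trace K (y $$ (i,j)) = 0"
      show "\<forall>x\<in>M. ?\<chi> x = 1"
      proof
        fix x assume x: "x \<in> M"
        then have xc: "x \<in> carrier_mat n n" using M_carrier by blast
        have "mat_trace (y * x) = (\<Sum>i<n. \<Sum>j<n. x $$ (j,i) * y $$ (i,j))"
          using xc y by (auto simp: mat_trace_def scalar_prod_def atLeast0LessThan mult.commute intro!: sum.cong)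
        then have "ext_trace K (mat_trace (y * x)) = (\<Sum>i<n. \<Sum>j<n. ext_trace K (x $$ (j,i) * y $$ (i,j)))"
          by (simp add: tr_sum)
        also have "\<dots> = 0" using x a by (auto simp: tr(2) M_iff intro!: sum.neutral)
        finally show "?\<chi> x = 1" by (simp add: \<psi>0)
      qed
    next
      assume a: "\<forall>x\<in>M. ?\<chi> x = 1"
      show "\<forall>i<n. \<forall>j<n. ext_trace K (y $$ (i,j)) = 0"
      proof (intro allI impI, rule ccontr)
        fix i j assume ij: "i < n" "j < n" and t: "ext_trace K (y $$ (i,j)) \<noteq> 0"
        obtain b where b: "b \<in> K" "\<psi> b \<noteq> 1" using \<psi>D(3) by blast
        \<comment> \<open>With this factor the test matrix c E_ji gives a trace equal to b, where
          \<psi> is not 1; c lies in K because the trace does.\<close>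
        define c where "c = b * inverse (ext_trace K (y $$ (i,j)))"
        have c: "c \<in> K" unfolding c_def using b tr(3) KD(5,6) by blast
        have "mat n n (\<lambda>(p,q). if p = j \<and> q = i then c else 0) \<in> M"
          using c KD(1) by (auto simp: M_iff)
        then have "\<psi> (ext_trace K (c * y $$ (i,j))) = 1"
          using a mat_trace_elementary[OF y ij, of c] by force
        moreover have "ext_trace K (c * y $$ (i,j)) = b" using tr(2)[OF c] t by (simp add: c_def)
        ultimately show False using b by simp
      qed
    qed
    ultimately show ?thesis unfolding comp_def s_def w_image[OF y] by (simp only:)
  qed
  have H: "matrix_units n (mats_over K n) = M \<inter> carrier (GL n)"
    unfolding M_def[symmetric] by (rule matrix_units_eq[OF M_carrier M_one M_mult])
  obtain \<Lambda> where \<Lambda>: "\<Lambda> \<in> invariant_forms scale \<pi> (M \<inter> carrier (GL n))" "\<Lambda> \<noteq> (\<lambda>_. 0)"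
    using dist unfolding distinguished_def H by blast
  have \<Lambda>d: "\<Lambda> \<in> dual_space scale" using \<Lambda> by (simp add: invariant_forms_def)
  obtain v where v: "\<Lambda> v \<noteq> 0" using \<Lambda>(2) by auto
  have "gamma_factor s scale n \<pi> (\<psi> \<circ> ext_trace K) * \<Lambda> v = \<Lambda> (\<pi> (inv\<^bsub>GL n\<^esub> w) v)"
    using invariant_form_transform[OF M_carrier M_one M_mult
        subgroup_units_submonoid[OF M_carrier M_one M_mult] w s orth \<Lambda>(1)]
      gamma_factor_eq[OF \<Lambda>d \<Lambda>(2) \<Lambda>d, of s "\<psi> \<circ> ext_trace K" v] by simp
  \<comment> \<open>The scalar w^2 = \<delta>^2 lies in H, so inserting it before w^-1 leaves the
    value of the invariant form unchanged and replaces w^-1 by w.\<close>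
  also have "\<dots> = \<Lambda> (\<pi> (w * w) (\<pi> (inv\<^bsub>GL n\<^esub> w) v))"
  proof -
    have "w * w = (\<delta> * \<delta>) \<cdot>\<^sub>m 1\<^sub>m n"
      by (simp add: w_def mult_smult_assoc_mat[of _ n n _ n] smult_smult_mat)
    then have "w * w \<in> M" using \<delta>\<delta> KD(1) by (auto simp: M_iff)
    then have "\<Lambda> \<circ> \<pi> (w * w) = \<Lambda>" using \<Lambda>(1) GL_mult[OF w w] by (simp add: invariant_forms_def)
    then show ?thesis by (metis comp_apply)
  qed
  also have "\<dots> = \<Lambda> (\<pi> w v)"
    using w GL_inv[OF w] GL_inv_cancel_right(1)[OF w GL_carrier_mat[OF w]]
    by (simp add: GL_mult flip: rep_comp)
  also have "\<dots> = central_character scale n \<pi> \<delta> * \<Lambda> v"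
    unfolding w_def using \<delta> by (simp add: central_char dual_hom[OF \<Lambda>d])
  finally show ?thesis using v by (simp add: s_def M_def)
qed

theorem theorem1p1:
  fixes scale :: "'r::alg_closed_field \<Rightarrow> 'v::ab_group_add \<Rightarrow> 'v"
    and n :: nat
    and \<pi> :: "'k::{finite,field} mat \<Rightarrow> 'v \<Rightarrow> 'v"
  assumes "odd CHAR('k)"
    and "CHAR('r) \<noteq> CHAR('k)"
    and "n \<ge> 2"
    and "irreducible_GL_rep scale n \<pi>"
    and "cuspidal scale n \<pi>"
  shows
    "(\<forall>(K\<^sub>0 :: 'k set) (\<psi>\<^sub>0 :: 'k \<Rightarrow> 'r) (\<delta> :: 'k).
        quadratic_subfield K\<^sub>0 \<and>
        distinguished scale \<pi> (matrix_units n (mats_over K\<^sub>0 n)) \<and>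
        nontrivial_additive_character K\<^sub>0 \<psi>\<^sub>0 \<and>
        \<delta> \<noteq> 0 \<and> ext_trace K\<^sub>0 \<delta> = 0
        \<longrightarrow> gamma_factor (of_nat (card (mats_over K\<^sub>0 n))) scale n \<pi> (\<psi>\<^sub>0 \<circ> ext_trace K\<^sub>0)
              = central_character scale n \<pi> \<delta>)
     \<and>
     (\<forall>(m :: nat) (H :: 'k mat set) (w :: 'k mat).
        n = 2 * m \<and>
        (H = GL_block_diag m \<and>
           w = four_block_mat (0\<^sub>m m m) (1\<^sub>m m) (1\<^sub>m m) (0\<^sub>m m m)
         \<or> (\<exists>\<alpha>. \<alpha> \<noteq> 0 \<and> (\<nexists>b. \<alpha> = b\<^sup>2) \<and> H = matrix_units n (quadratic_mats \<alpha> m) \<and>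
              w = four_block_mat (1\<^sub>m m) (0\<^sub>m m m) (0\<^sub>m m m) (- 1\<^sub>m m))) \<and>
        distinguished scale \<pi> H
        \<longrightarrow> (\<exists>\<chi> \<in> characters (GL n \<lparr>carrier := normalizer (GL n) H\<rparr>).
               (\<forall>g\<in>normalizer (GL n) H. \<forall>\<Lambda>\<in>invariant_forms scale \<pi> H.
                  \<Lambda> \<circ> \<pi> g = (\<lambda>v. \<chi> g * \<Lambda> v)) \<and>
               (\<forall>\<psi>. nontrivial_additive_character UNIV \<psi>
                  \<longrightarrow> gamma_factor (of_nat (card (UNIV :: 'k set) ^ (2 * m\<^sup>2))) scale n \<pi> \<psi> = \<chi> w)))"
proof -
  interpret cuspidal_GL_rep scale n \<pi>
    using assms(3-5) by (intro cuspidal_GL_rep.intro cuspidal_GL_rep_axioms.intro)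
      (simp_all add: irreducible_GL_rep_def)
  have two: "(2::'k) \<noteq> 0"
  proof
    assume "(2::'k) = 0"
    then have "of_nat 2 = (0::'k)" by simp
    then have "CHAR('k) dvd 2" by (simp only: of_nat_eq_0_iff_char_dvd)
    then have "CHAR('k) = 2" using prime_CHAR_finite_field[where ?'k = 'k] by (metis primes_dvd_imp_eq two_is_prime_nat)
    then show False using assms(1) by simp
  qed
  show ?thesis
  proof (intro conjI allI impI; elim conjE)
    fix K\<^sub>0 :: "'k set" and \<psi>\<^sub>0 :: "'k \<Rightarrow> 'r" and \<delta> :: 'k
    assume "quadratic_subfield K\<^sub>0" "distinguished scale \<pi> (matrix_units n (mats_over K\<^sub>0 n))"
      "nontrivial_additive_character K\<^sub>0 \<psi>\<^sub>0" "\<delta> \<noteq> 0" "ext_trace K\<^sub>0 \<delta> = 0"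
    then show "gamma_factor (of_nat (card (mats_over K\<^sub>0 n))) scale n \<pi> (\<psi>\<^sub>0 \<circ> ext_trace K\<^sub>0)
        = central_character scale n \<pi> \<delta>"
      using galois_distinction[OF _ two assms(2)] by blast
  next
    fix m and H :: "'k mat set" and w :: "'k mat"
    assume n: "n = 2 * m" and dist: "distinguished scale \<pi> H"
      and Hw: "H = GL_block_diag m \<and> w = four_block_mat (0\<^sub>m m m) (1\<^sub>m m) (1\<^sub>m m) (0\<^sub>m m m)
         \<or> (\<exists>\<alpha>. \<alpha> \<noteq> 0 \<and> (\<nexists>b. \<alpha> = b\<^sup>2) \<and> H = matrix_units n (quadratic_mats \<alpha> m) \<and>
              w = four_block_mat (1\<^sub>m m) (0\<^sub>m m m) (0\<^sub>m m m) (- 1\<^sub>m m))"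
    let ?s = "of_nat (card (UNIV :: 'k set) ^ (2 * m\<^sup>2)) :: 'r"
    have nm: "n = m + m" and m: "m > 0" using n n_ge_2 by auto
    have s0: "?s \<noteq> 0" using of_nat_card_field_nonzero[OF assms(2)] by simp
    show "\<exists>\<chi> \<in> characters (GL n \<lparr>carrier := normalizer (GL n) H\<rparr>).
               (\<forall>g\<in>normalizer (GL n) H. \<forall>\<Lambda>\<in>invariant_forms scale \<pi> H.
                  \<Lambda> \<circ> \<pi> g = (\<lambda>v. \<chi> g * \<Lambda> v)) \<and>
               (\<forall>\<psi>. nontrivial_additive_character UNIV \<psi>
                  \<longrightarrow> gamma_factor ?s scale n \<pi> \<psi> = \<chi> w)"
      using Hw
    proof (elim disjE exE conjE)
      assume H: "H = GL_block_diag m" and w: "w = four_block_mat (0\<^sub>m m m) (1\<^sub>m m) (1\<^sub>m m) (0\<^sub>m m m)"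
      show ?thesis
      proof (rule centralizer_distinction[OF _ assms(2) _ s0 _ _ dist])
        show "anticommuting_matrices n (J_linear m) w 1"
          unfolding nm w by (rule anticommuting_linear[OF m two])
        \<comment> \<open>Injectivity of the parametrization identifies the prescribed root
          |k|^(2m^2) with |M|, the constant in the transformation rule.\<close>
        have "inj_on (\<lambda>(A,D). four_block_mat A (0\<^sub>m m m) (0\<^sub>m m m) D)
            (carrier_mat m m \<times> carrier_mat m m :: ('k mat \<times> 'k mat) set)"
          by (rule inj_onI) (auto simp: four_block_eq_iff[of _ m])
        then show "?s = of_nat (card (anticommuting_matrices.cent n (J_linear m :: 'k mat)))"
          unfolding nm cent_linear[OF m two] by (simp only: card_block_image)
        show HJ: "H = anticommuting_matrices.cent n (J_linear m) \<inter> carrier (GL n)"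
          unfolding nm H by (rule GL_block_diag_eq[OF m two])
        show "\<exists>a b. A = a \<cdot>\<^sub>m 1\<^sub>m n + b \<cdot>\<^sub>m J_linear m"
          if "A \<in> carrier_mat n n" "\<And>h. h \<in> H \<Longrightarrow> A * h = h * A" for A
          using linear_commutant[OF m two, of A] that unfolding HJ nm by blast
      qed
    next
      fix \<alpha> assume \<alpha>: "\<alpha> \<noteq> 0" and H: "H = matrix_units n (quadratic_mats \<alpha> m)"
        and w: "w = four_block_mat (1\<^sub>m m) (0\<^sub>m m m) (0\<^sub>m m m) (- 1\<^sub>m m)"
      have AM: "anticommuting_matrices n (J_twisted \<alpha> m) w \<alpha>"
        unfolding nm w by (rule anticommuting_twisted[OF m two \<alpha>])
      interpret anticommuting_matrices n "J_twisted \<alpha> m" w \<alpha> by (rule AM)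
      have cent: "cent = (\<lambda>(x,y). four_block_mat x y (\<alpha> \<cdot>\<^sub>m y) x) ` (carrier_mat m m \<times> carrier_mat m m)"
        unfolding nm by (rule cent_twisted[OF m two \<alpha>])
      then have "quadratic_mats \<alpha> m = cent" by (auto simp: quadratic_mats_def)
      then have HJ: "H = cent \<inter> carrier (GL n)"
        unfolding H using matrix_units_eq[OF cent_carrier cent_one cent_mult] by simp
      show ?thesis
      proof (rule centralizer_distinction[OF AM assms(2) _ s0 HJ _ dist])
        have "inj_on (\<lambda>(x,y). four_block_mat x y (\<alpha> \<cdot>\<^sub>m y) x)
            (carrier_mat m m \<times> carrier_mat m m :: ('k mat \<times> 'k mat) set)"
          by (rule inj_onI) (auto simp: four_block_eq_iff[of _ m])
        then show "?s = of_nat (card cent)"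
          unfolding cent by (simp only: card_block_image)
        show "\<exists>a b. A = a \<cdot>\<^sub>m 1\<^sub>m n + b \<cdot>\<^sub>m J_twisted \<alpha> m"
          if "A \<in> carrier_mat n n" "\<And>h. h \<in> H \<Longrightarrow> A * h = h * A" for A
          using twisted_commutant[OF m two \<alpha>, of A] that unfolding HJ nm by blast
      qed
    qed
  qed
qed

end
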